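(* For given $m\in\mathbb N$ and $\iota\in I=\{1,2\}$, let $\varphi,\psi$ be the states associated with any unit vectors $\zeta\in\mathcal H^{(m-1)}(\iota)$ and $\zeta'\in\mathcal H^{(m)}(\bar\iota)$, respectively. Then the operators $U_\iota(m)$ and $Z_\iota(m)U_{\bar\iota}(m+1)$ have the same $\varphi$-distributions. Similarly, if $X_1,X_2$ are positive, then the operators $Y_\iota(m)$ and $Z_\iota(m)Y_{\bar\iota}(m+1)$ have the same $\varphi$-distributions. Moreover, the pairs $(x_\iota(m),u_{\bar\iota}(m+1))$ and (in the positive case) $(x_\iota(m),y_{\bar\iota}(m+1))$ are orthogonal with respect to $(\varphi,\psi)$ for each $\iota\in I$ and $m\in\mathbb N$.
   Context: $I=\{1,2\}$, $\bar 1=2$, $\bar 2=1$. $(\mathcal H_\iota,\xi_\iota)$, $\iota\in I$, are Hilbert spaces with distinguished unit vectors, $\mathcal H_\iota^0=\mathcal H_\iota\ominus\mathbb C\xi_\iota$. Their free product is $(\mathcal H,\xi)$, $\mathcal H=\mathbb C\xi\oplus\bigoplus_{n\ge1}\bigoplus_{\iota_1\ne\iota_2\ne\dots\ne\iota_n}\mathcal H_{\iota_1}^0\otimes\dots\otimes\mathcal H_{\iota_n}^0$. For $n\ge1$, $\mathcal H^{(n)}(\iota)$ is the direct sum of those $\mathcal H_{\iota_1}^0\otimes\dots\otimes\mathcal H_{\iota_n}^0$ ($\iota_1\neq\dots\neq\iota_n$) with $\iota_1\ne\iota$; $\mathcal H^{(0)}(\iota)=\mathbb C\xi$. For each $\iota$,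 $\mathcal H=\bigoplus_{n\ge1}\big(\mathcal H^{(n-1)}(\iota)\oplus\mathcal H^{(n)}(\bar\iota)\big)$ and $P_\iota(n)$ is the orthogonal projection onto the $n$-th summand. $\lambda$ denotes the free product representation: $a\in B(\mathcal H_\iota)$ acts as $a\otimes1$ under the natural unitary $\mathcal H\cong\mathcal H_\iota\otimes\bigoplus_{n\ge0}\mathcal H^{(n)}(\iota)$. For fixed $x\in B(\mathcal H_1)$, $y\in B(\mathcal H_2)$ put $X_1=\lambda(x)$, $X_2=\lambda(y)$ (free with respect to the vacuum state $\langle\cdot\,\xi,\xi\rangle$), $X_\iota(j)=P_\iota(j)X_\iota P_\iota(j)$, $x_\iota(j)=X_\iota(j)-P_\iota(j)$. The s-free Fock space is $\mathcal K_\iota=\bigoplus_{n\ \rm odd}\big(\mathcal H^{(n-1)}(\iota)\oplus\mathcal H^{(n)}(\bar\iota)\big)$ ($\mathbb C\xi$ plus all tensors whose last factor lies in $\mathcal H_\iota^0$). $X_\iota(j),P_\iota(j)$ are regarded as operators on $\mathcal K_\iota$ if $j$ is odd and on $\mathcal K_{\bar\iota}$ if $j$ is even. With $J(m)=\{m,m+2,m+4,\dots\}$ and $1=1_{\mathcal K_\iota}$ for $m$ odd, $1=1_{\mathcal K_{\bar\iota}}$ for $m$ even, put $R_\iota(m)=1+\sum_{j\in J(m)}x_\iota(j)$, $Z_\iota(m)=1+x_\iota(m)$, $U_\iota(m)=R_\iota(m)R_{\bar\iota}(m+1)$, $u_\iota(m)=U_\iota(m)-1$, and, if $X_1,X_2$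 are positive, $Y_\iota(m)=\sqrt{R_{\bar\iota}(m+1)}\,R_\iota(m)\sqrt{R_{\bar\iota}(m+1)}$, $y_\iota(m)=Y_\iota(m)-1$. All operators with upper data $(\iota,m)$ and $(\bar\iota,m+1)$ act on the same space. The state associated with a unit vector $\zeta$ is $\langle\cdot\,\zeta,\zeta\rangle$; the distribution of $a$ in a state $\omega$ is $X^n\mapsto\omega(a^n)$. A pair $(a,b)$ is orthogonal w.r.t. $(\varphi,\psi)$ if, with $\mathcal A_1,\mathcal A_2$ the non-unital algebras generated by $a$ and by $b$, (i) $\varphi(b'w_2)=\varphi(w_1b')=0$, and (ii) $\varphi(w_1a_1b'a_2w_2)=\psi(b')\big(\varphi(w_1a_1a_2w_2)-\varphi(w_1a_1)\varphi(a_2w_2)\big)$, for all $a_1,a_2\in\mathcal A_1$, $b'\in\mathcal A_2$ and $w_1,w_2$ in the unital algebra generated by $\mathcal A_1,\mathcal A_2$. *)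

theory Defs
  imports "HOL-Analysis.Analysis"
begin

section \<open>Complex Hilbert spaces\<close>

text \<open>The inner product \<open>cinner\<close> is linear in its first argument.  The real structure supplied
  by \<^class>\<open>real_inner\<close> is the underlying one, so that
  \<open>norm x ^ 2 = cinner x x\<close>.\<close>

class complex_hilbert = real_inner + banach +
  fixes scaleC :: "complex \<Rightarrow> 'a \<Rightarrow> 'a"  (infixr \<open>*\<^sub>C\<close> 75)
    and cinner :: "'a \<Rightarrow> 'a \<Rightarrow> complex"
  assumes scaleC_add_right: "c *\<^sub>C (x + y) = c *\<^sub>C x + c *\<^sub>C y"
    and scaleC_add_left: "(c + d) *\<^sub>C x = c *\<^sub>C x + d *\<^sub>C x"
    and scaleC_scaleC: "c *\<^sub>C d *\<^sub>C x = (c * d) *\<^sub>C x"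
    and scaleR_scaleC: "r *\<^sub>R x = of_real r *\<^sub>C x"
    and cinner_add_left: "cinner (x + y) z = cinner x z + cinner y z"
    and cinner_scaleC_left: "cinner (c *\<^sub>C x) y = c * cinner x y"
    and cinner_commute: "cinner x y = cnj (cinner y x)"
    and inner_Re_cinner: "inner x y = Re (cinner x y)"

definition closed_csubspace :: "'a::complex_hilbert set \<Rightarrow> bool" where
  "closed_csubspace M \<longleftrightarrow> closed M \<and> subspace M \<and> (\<forall>c. \<forall>v\<in>M. c *\<^sub>C v \<in> M)"

abbreviation closed_cspan :: "'a::complex_hilbert set \<Rightarrow> 'a set" where
  "closed_cspan S \<equiv> closed_csubspace hull S"

definition proj :: "'a::complex_hilbert set \<Rightarrow> 'a \<Rightarrow> 'a" where
  "proj M v = (THE p. p \<in> M \<and> (\<forall>q\<in>M. cinner (v - p) q = 0))"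

text \<open>A bounded operator on a closed subspace \<open>M\<close> of an ambient Hilbert space is identified with
  its extension by \<open>0\<close> on the orthogonal complement of \<open>M\<close>.  Under this identification the
  unit of \<open>B(M)\<close> is \<open>proj M\<close>, the product is composition, and operators on a smaller
  subspace are automatically operators on \<open>M\<close>.\<close>

definition bounded_ops :: "'a::complex_hilbert set \<Rightarrow> ('a \<Rightarrow> 'a) set" where
  "bounded_ops M = {S. bounded_linear S \<and> (\<forall>c v. S (c *\<^sub>C v) = c *\<^sub>C S v) \<and>
     (\<forall>v. S v \<in> M) \<and> (\<forall>v. (\<forall>q\<in>M. cinner v q = 0) \<longrightarrow> S v = 0)}"

definition positive_op :: "'a::complex_hilbert set \<Rightarrow> ('a \<Rightarrow> 'a) \<Rightarrow> bool" where
  "positive_op M S \<longleftrightarrow> S \<in> bounded_ops M \<and> (\<forall>v. cinner (S v) v \<in> \<real>\<^sub>\<ge>\<^sub>0)"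

definition sqrt_op :: "'a::complex_hilbert set \<Rightarrow> ('a \<Rightarrow> 'a) \<Rightarrow> ('a \<Rightarrow> 'a)" where
  "sqrt_op M A = (THE S. positive_op M S \<and> S \<circ> S = A)"

section \<open>States, distributions and orthogonality\<close>

definition vector_state :: "'a::complex_hilbert \<Rightarrow> ('a \<Rightarrow> 'a) \<Rightarrow> complex" where
  "vector_state \<zeta> S = cinner (S \<zeta>) \<zeta>"

text \<open>The distribution, i.e. the linear functional \<open>X\<^sup>n \<mapsto> \<omega> (a\<^sup>n)\<close> on polynomials, is
  represented by its values on the monomials.  The argument \<open>e\<close> is the unit of the algebra.\<close>

definition distribution ::
  "('a \<Rightarrow> 'a) \<Rightarrow> (('a \<Rightarrow> 'a) \<Rightarrow> complex) \<Rightarrow> ('a \<Rightarrow> 'a) \<Rightarrow> nat \<Rightarrow> complex" where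
  "distribution e \<omega> a = (\<lambda>n. \<omega> (((\<circ>) a ^^ n) e))"

inductive_set gen_alg :: "('a::complex_hilbert \<Rightarrow> 'a) set \<Rightarrow> ('a \<Rightarrow> 'a) set"
  for S :: "('a \<Rightarrow> 'a) set" where
  base: "a \<in> S \<Longrightarrow> a \<in> gen_alg S"
| zero: "(\<lambda>v. 0) \<in> gen_alg S"
| add: "a \<in> gen_alg S \<Longrightarrow> b \<in> gen_alg S \<Longrightarrow> (\<lambda>v. a v + b v) \<in> gen_alg S"
| scale: "a \<in> gen_alg S \<Longrightarrow> (\<lambda>v. c *\<^sub>C a v) \<in> gen_alg S"
| mult: "a \<in> gen_alg S \<Longrightarrow> b \<in> gen_alg S \<Longrightarrow> a \<circ> b \<in> gen_alg S"

definition orthogonal_pair ::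
  "('a::complex_hilbert \<Rightarrow> 'a) \<Rightarrow> (('a \<Rightarrow> 'a) \<Rightarrow> complex) \<Rightarrow> (('a \<Rightarrow> 'a) \<Rightarrow> complex) \<Rightarrow>
   ('a \<Rightarrow> 'a) \<Rightarrow> ('a \<Rightarrow> 'a) \<Rightarrow> bool" where
  "orthogonal_pair e \<phi> \<psi> a b \<longleftrightarrow>
     (let A\<^sub>1 = gen_alg {a}; A\<^sub>2 = gen_alg {b}; W = gen_alg (insert e (A\<^sub>1 \<union> A\<^sub>2)) in
      (\<forall>b'\<in>A\<^sub>2. \<forall>w\<^sub>1\<in>W. \<forall>w\<^sub>2\<in>W. \<phi> (b' \<circ> w\<^sub>2) = 0 \<and> \<phi> (w\<^sub>1 \<circ> b') = 0) \<and>
      (\<forall>a\<^sub>1\<in>A\<^sub>1. \<forall>a\<^sub>2\<in>A\<^sub>1. \<forall>b'\<in>A\<^sub>2. \<forall>w\<^sub>1\<in>W. \<forall>w\<^sub>2\<in>W.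
         \<phi> (w\<^sub>1 \<circ> a\<^sub>1 \<circ> b' \<circ> a\<^sub>2 \<circ> w\<^sub>2) =
         \<psi> b' * (\<phi> (w\<^sub>1 \<circ> a\<^sub>1 \<circ> a\<^sub>2 \<circ> w\<^sub>2) - \<phi> (w\<^sub>1 \<circ> a\<^sub>1) * \<phi> (a\<^sub>2 \<circ> w\<^sub>2))))"

section \<open>The free product of two Hilbert spaces\<close>

datatype side = One | Two

fun bar :: "side \<Rightarrow> side" where
  "bar One = Two"
| "bar Two = One"

definition centered :: "(side \<Rightarrow> 'a::complex_hilbert set) \<Rightarrow> (side \<Rightarrow> 'a) \<Rightarrow> side \<Rightarrow> 'a set" where
  "centered H \<xi> \<iota> = {h \<in> H \<iota>. cinner h (\<xi> \<iota>) = 0}"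

text \<open>The word \<open>[(\<iota>\<^sub>1,h\<^sub>1), \<dots>, (\<iota>\<^sub>n,h\<^sub>n)]\<close> stands for the elementary tensor
  \<open>h\<^sub>1 \<otimes> \<dots> \<otimes> h\<^sub>n\<close> in the summand indexed by \<open>\<iota>\<^sub>1 \<noteq> \<dots> \<noteq> \<iota>\<^sub>n\<close>, the empty word for the vacuum.\<close>

definition words ::
  "(side \<Rightarrow> 'a::complex_hilbert set) \<Rightarrow> (side \<Rightarrow> 'a) \<Rightarrow> (side \<times> 'a) list set" where
  "words H \<xi> = {w. distinct_adj (map fst w) \<and> (\<forall>(\<iota>, h) \<in> set w. h \<in> centered H \<xi> \<iota>)}"

text \<open>\<open>H One\<close> and \<open>H Two\<close> are two arbitrary Hilbert spaces, realised as closed subspaces of a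
  common ambient space only in order to be indexed by \<^typ>\<open>side\<close>.  Their free product
  is a Hilbert space direct sum of Hilbert space tensor products, hence determined up to a
  canonical unitary by the inner products of elementary tensors; \<open>T\<close> is the map
  that sends a word to its elementary tensor in an arbitrary such realisation.
  Realisations exist for all \<open>H\<close> and \<open>\<xi>\<close>, see \<open>free_product_exists\<close> below.\<close>

locale free_product =
  fixes H :: "side \<Rightarrow> 'a::complex_hilbert set"
    and \<xi> :: "side \<Rightarrow> 'a"
    and T :: "(side \<times> 'a) list \<Rightarrow> 'h::complex_hilbert"
  assumes closed_csubspace_H: "closed_csubspace (H \<iota>)"
    and \<xi>_in_H: "\<xi> \<iota> \<in> H \<iota>"
    and norm_\<xi>: "norm (\<xi> \<iota>) = 1"
    and cinner_T: "\<lbrakk>w \<in> words H \<xi>; w' \<in> words H \<xi>\<rbrakk> \<Longrightarrow>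
      cinner (T w) (T w') =
        (if map fst w = map fst w' then \<Prod>k<length w. cinner (snd (w ! k)) (snd (w' ! k)) else 0)"
begin

definition total :: "'h set" where
  "total = closed_cspan (T ` words H \<xi>)"

definition words_avoiding :: "side \<Rightarrow> (side \<times> 'a) list set" where
  "words_avoiding \<iota> = {w \<in> words H \<xi>. w = [] \<or> fst (hd w) \<noteq> \<iota>}"

text \<open>\<open>level \<iota> n\<close> is \<open>\<H>\<^sup>(\<^sup>n\<^sup>)(\<iota>)\<close>.\<close>

definition level :: "side \<Rightarrow> nat \<Rightarrow> 'h set" where
  "level \<iota> n = closed_cspan (T ` {w \<in> words_avoiding \<iota>. length w = n})"

text \<open>\<open>summand \<iota> n\<close> (for \<open>n \<ge> 1\<close>) is \<open>\<H>\<^sup>(\<^sup>n\<^sup>-\<^sup>1\<^sup>)(\<iota>) \<oplus> \<H>\<^sup>(\<^sup>n\<^sup>)(bar \<iota>)\<close>; the two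
  levels are orthogonal, so their sum is the closed span of the union.\<close>

definition summand :: "side \<Rightarrow> nat \<Rightarrow> 'h set" where
  "summand \<iota> n = closed_cspan (level \<iota> (n - 1) \<union> level (bar \<iota>) n)"

definition P :: "side \<Rightarrow> nat \<Rightarrow> 'h \<Rightarrow> 'h" where
  "P \<iota> n = proj (summand \<iota> n)"

text \<open>The natural unitary from \<open>H \<iota> \<otimes> (\<Oplus>n\<ge>0. level \<iota> n)\<close> onto \<open>total\<close>, on
  \<open>h \<otimes> T w\<close> with \<open>w\<close> in \<open>words_avoiding \<iota>\<close>: the component of \<open>h\<close> along \<open>\<xi> \<iota>\<close>
  is dropped into the scalars, the centered component becomes a new first factor.\<close>

definition join :: "side \<Rightarrow> 'a \<Rightarrow> (side \<times> 'a) list \<Rightarrow> 'h" where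
  "join \<iota> h w = cinner h (\<xi> \<iota>) *\<^sub>C T w + T ((\<iota>, h - cinner h (\<xi> \<iota>) *\<^sub>C \<xi> \<iota>) # w)"

text \<open>The free product representation: \<open>b\<close> acts as \<open>b \<otimes> 1\<close>.\<close>

definition rep :: "side \<Rightarrow> ('a \<Rightarrow> 'a) \<Rightarrow> 'h \<Rightarrow> 'h" where
  "rep \<iota> b = (THE L. L \<in> bounded_ops total \<and>
     (\<forall>h\<in>H \<iota>. \<forall>w\<in>words_avoiding \<iota>. L (join \<iota> h w) = join \<iota> (b h) w))"

section \<open>Operators on s-free Fock spaces\<close>

definition sfree_space :: "side \<Rightarrow> 'h set" where
  "sfree_space \<iota> = closed_cspan (\<Union>n\<in>{n. odd n}. summand \<iota> n)"

text \<open>The s-free Fock space on which the operators with upper data \<open>(\<iota>, m)\<close> act, and its unit.\<close>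

definition space_of :: "side \<Rightarrow> nat \<Rightarrow> 'h set" where
  "space_of \<iota> m = (if odd m then sfree_space \<iota> else sfree_space (bar \<iota>))"

definition unit_of :: "side \<Rightarrow> nat \<Rightarrow> 'h \<Rightarrow> 'h" where
  "unit_of \<iota> m = proj (space_of \<iota> m)"

text \<open>In the following, \<open>a One\<close> and \<open>a Two\<close> are the given operators \<open>x\<close> and \<open>y\<close>.\<close>

definition X_free :: "(side \<Rightarrow> 'a \<Rightarrow> 'a) \<Rightarrow> side \<Rightarrow> 'h \<Rightarrow> 'h" where
  "X_free a \<iota> = rep \<iota> (a \<iota>)"

definition X_op :: "(side \<Rightarrow> 'a \<Rightarrow> 'a) \<Rightarrow> side \<Rightarrow> nat \<Rightarrow> 'h \<Rightarrow> 'h" where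
  "X_op a \<iota> j = P \<iota> j \<circ> X_free a \<iota> \<circ> P \<iota> j"

definition x_op :: "(side \<Rightarrow> 'a \<Rightarrow> 'a) \<Rightarrow> side \<Rightarrow> nat \<Rightarrow> 'h \<Rightarrow> 'h" where
  "x_op a \<iota> j = (\<lambda>v. X_op a \<iota> j v - P \<iota> j v)"

definition J :: "nat \<Rightarrow> nat set" where
  "J m = {m + 2 * k | k. True}"

text \<open>The infinite sum converges in the strong operator topology.\<close>

definition R_op :: "(side \<Rightarrow> 'a \<Rightarrow> 'a) \<Rightarrow> side \<Rightarrow> nat \<Rightarrow> 'h \<Rightarrow> 'h" where
  "R_op a \<iota> m = (\<lambda>v. unit_of \<iota> m v + (\<Sum>\<^sub>\<infinity>j\<in>J m. x_op a \<iota> j v))"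

definition Z_op :: "(side \<Rightarrow> 'a \<Rightarrow> 'a) \<Rightarrow> side \<Rightarrow> nat \<Rightarrow> 'h \<Rightarrow> 'h" where
  "Z_op a \<iota> m = (\<lambda>v. unit_of \<iota> m v + x_op a \<iota> m v)"

definition U_op :: "(side \<Rightarrow> 'a \<Rightarrow> 'a) \<Rightarrow> side \<Rightarrow> nat \<Rightarrow> 'h \<Rightarrow> 'h" where
  "U_op a \<iota> m = R_op a \<iota> m \<circ> R_op a (bar \<iota>) (m + 1)"

definition u_op :: "(side \<Rightarrow> 'a \<Rightarrow> 'a) \<Rightarrow> side \<Rightarrow> nat \<Rightarrow> 'h \<Rightarrow> 'h" where
  "u_op a \<iota> m = (\<lambda>v. U_op a \<iota> m v - unit_of \<iota> m v)"

definition Y_op :: "(side \<Rightarrow> 'a \<Rightarrow> 'a) \<Rightarrow> side \<Rightarrow> nat \<Rightarrow> 'h \<Rightarrow> 'h" where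
  "Y_op a \<iota> m =
     (let S = sqrt_op (space_of \<iota> m) (R_op a (bar \<iota>) (m + 1)) in S \<circ> R_op a \<iota> m \<circ> S)"

definition y_op :: "(side \<Rightarrow> 'a \<Rightarrow> 'a) \<Rightarrow> side \<Rightarrow> nat \<Rightarrow> 'h \<Rightarrow> 'h" where
  "y_op a \<iota> m = (\<lambda>v. Y_op a \<iota> m v - unit_of \<iota> m v)"

end

section \<open>Realisations of the free product exist\<close>

lemma cinner_add_right: "cinner x (y + z) = cinner x y + cinner x (z::'a::complex_hilbert)"
  by (metis cinner_commute cinner_add_left complex_cnj_add)

lemma cinner_scaleC_right: "cinner x (c *\<^sub>C y) = cnj c * cinner x (y::'a::complex_hilbert)"
  by (metis cinner_commute cinner_scaleC_left complex_cnj_mult)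

lemma cinner_scaleR_left: "cinner (r *\<^sub>R x) y = of_real r * cinner x (y::'a::complex_hilbert)"
  by (simp add: scaleR_scaleC cinner_scaleC_left)

lemma cinner_scaleR_right: "cinner x (r *\<^sub>R y) = of_real r * cinner x (y::'a::complex_hilbert)"
  by (simp add: scaleR_scaleC cinner_scaleC_right)

lemma cinner_zero_left [simp]: "cinner 0 (y::'a::complex_hilbert) = 0"
  using cinner_add_left[of 0 0 y] by simp

lemma cinner_zero_right [simp]: "cinner (y::'a::complex_hilbert) 0 = 0"
  using cinner_add_right[of y 0 0] by simp

lemma cinner_minus_left: "cinner (- x) y = - cinner x (y::'a::complex_hilbert)"
  using cinner_add_left[of x "-x" y] by (simp add: eq_neg_iff_add_eq_0 add.commute)

lemma cinner_minus_right: "cinner x (- y) = - cinner x (y::'a::complex_hilbert)"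
  using cinner_add_right[of x y "-y"] by (simp add: eq_neg_iff_add_eq_0 add.commute)

lemma cinner_diff_left: "cinner (x - y) z = cinner x z - cinner y (z::'a::complex_hilbert)"
  using cinner_add_left[of x "-y" z] by (simp add: cinner_minus_left)

lemma cinner_diff_right: "cinner x (y - z) = cinner x y - cinner x (z::'a::complex_hilbert)"
  using cinner_add_right[of x y "-z"] by (simp add: cinner_minus_right)

lemma cinner_sum_left: "cinner (sum f A) y = (\<Sum>i\<in>A. cinner (f i) (y::'a::complex_hilbert))"
  by (induction A rule: infinite_finite_induct) (simp_all add: cinner_add_left)

lemma cinner_self: "cinner x x = of_real ((norm (x::'a::complex_hilbert))\<^sup>2)"
proof -
  have "Im (cinner x x) = 0"
    using arg_cong[OF cinner_commute[of x x], of Im] by simp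
  then show ?thesis
    by (simp add: complex_eq_iff power2_norm_eq_inner inner_Re_cinner)
qed

lemma scaleC_zero_left [simp]: "0 *\<^sub>C (x::'a::complex_hilbert) = 0"
  using scaleC_add_left[of 0 0 x] by simp

lemma scaleC_diff_left: "(c - d) *\<^sub>C x = c *\<^sub>C x - d *\<^sub>C (x::'a::complex_hilbert)"
  using scaleC_add_left[of "c - d" d x] by (simp add: algebra_simps)

lemma scaleC_diff_right: "c *\<^sub>C (x - y) = c *\<^sub>C x - c *\<^sub>C (y::'a::complex_hilbert)"
  using scaleC_add_right[of c "x - y" y] by (simp add: algebra_simps)

lemma scaleC_zero_right [simp]: "c *\<^sub>C (0::'a::complex_hilbert) = 0"
  using scaleC_add_right[of c 0 "0::'a"] by simp

lemma scaleC_one [simp]: "1 *\<^sub>C (x::'a::complex_hilbert) = x"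
  using scaleR_scaleC[of 1 x] by simp

lemma norm_scaleC: "norm (c *\<^sub>C x) = cmod c * norm (x::'a::complex_hilbert)"
proof -
  have "of_real ((norm (c *\<^sub>C x))\<^sup>2) = (of_real ((cmod c * norm x)\<^sup>2) :: complex)"
    unfolding cinner_self[symmetric] cinner_scaleC_left cinner_scaleC_right
    by (simp only: cinner_self power_mult_distrib of_real_mult complex_norm_square mult.left_commute mult.assoc)
  then show ?thesis
    by (metis mult_nonneg_nonneg norm_ge_zero of_real_eq_iff power2_eq_imp_eq)
qed

lemma cmod_cinner_le: "cmod (cinner x y) \<le> norm x * norm (y::'a::complex_hilbert)"
proof (cases "cinner x y = 0")
  case False
  define c where "c = cnj (cinner x y) / of_real (cmod (cinner x y))"
  have c: "cmod c = 1" using False by (simp add: c_def norm_divide)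
  have "of_real (cmod (cinner x y)) = cinner (c *\<^sub>C x) y"
  proof -
    have "cnj (cinner x y) * cinner x y = of_real (cmod (cinner x y)) * of_real (cmod (cinner x y))"
      using complex_norm_square[of "cinner x y"] by (simp add: power2_eq_square mult.commute)
    then show ?thesis using False by (simp add: c_def cinner_scaleC_left)
  qed
  then have "cmod (cinner x y) = inner (c *\<^sub>C x) y"
    by (metis Re_complex_of_real inner_Re_cinner)
  also have "\<dots> \<le> norm (c *\<^sub>C x) * norm y" by (rule norm_cauchy_schwarz)
  finally show ?thesis by (simp add: norm_scaleC c)
qed simp

lemma closed_csubspace_closed_cspan: "closed_csubspace (closed_cspan S)"
  by (rule hull_in) (auto simp: closed_csubspace_def subspace_def)

lemma closed_csubspace_diff:
  "closed_csubspace M \<Longrightarrow> u \<in> M \<Longrightarrow> v \<in> M \<Longrightarrow> u - v \<in> M"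
  by (auto simp: closed_csubspace_def subspace_diff)

lemma projection_exists:
  fixes M :: "'a::complex_hilbert set"
  assumes M: "closed_csubspace M"
  obtains p where "p \<in> M" "\<And>q. q \<in> M \<Longrightarrow> cinner (v - p) q = 0"
proof -
  have sub: "subspace M" and cl: "closed M" and sc: "\<And>c v. v \<in> M \<Longrightarrow> c *\<^sub>C v \<in> M"
    using M by (auto simp: closed_csubspace_def)
  define D where "D = (INF q\<in>M. (norm (v - q))\<^sup>2)"
  have ne: "M \<noteq> {}" using sub subspace_0 by blast
  have bdd: "bdd_below ((\<lambda>q. (norm (v - q))\<^sup>2) ` M)"
    by (rule bdd_belowI[of _ 0]) auto
  have D_le: "D \<le> (norm (v - q))\<^sup>2" if "q \<in> M" for q
    unfolding D_def using bdd that by (rule cINF_lower)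
  have "\<exists>q\<in>M. (norm (v - q))\<^sup>2 < D + 1 / Suc n" for n
  proof (rule ccontr)
    assume "\<not> ?thesis"
    then have "D + 1 / Suc n \<le> D"
      unfolding D_def using ne by (intro cINF_greatest) (auto simp: not_less D_def)
    then show False by simp
  qed
  then obtain s where s: "\<And>n. s n \<in> M" "\<And>n. (norm (v - s n))\<^sup>2 < D + 1 / Suc n"
    by metis
  have par: "(norm (s k - s n))\<^sup>2 \<le> 2 / Suc k + 2 / Suc n" for k n
  proof -
    have "(1/2) *\<^sub>R (s k + s n) \<in> M" using sub s by (auto simp: subspace_def)
    then have "D \<le> (norm (v - (1/2) *\<^sub>R (s k + s n)))\<^sup>2" by (rule D_le)
    moreover have "(norm (s k - s n))\<^sup>2 + 4 * (norm (v - (1/2) *\<^sub>R (s k + s n)))\<^sup>2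
        = 2 * (norm (v - s k))\<^sup>2 + 2 * (norm (v - s n))\<^sup>2"
      unfolding power2_norm_eq_inner
      by (simp add: inner_diff_left inner_diff_right inner_add_left inner_add_right
        inner_commute algebra_simps)
    ultimately show ?thesis using s(2)[of k] s(2)[of n] by linarith
  qed
  have "Cauchy s"
  proof (rule metric_CauchyI)
    fix e :: real assume e: "e > 0"
    obtain N :: nat where N: "4 / e\<^sup>2 < N" using reals_Archimedean2 by blast
    have "dist (s k) (s n) < e" if "k \<ge> N" "n \<ge> N" for k n
    proof -
      have N0: "real N > 0" using N e by (meson divide_pos_pos less_trans zero_less_numeral zero_less_power)
      have "2 / real (Suc k) \<le> 2 / N" "2 / real (Suc n) \<le> 2 / N"
        using that N0 by (auto intro!: divide_left_mono)
      then have "(norm (s k - s n))\<^sup>2 \<le> 4 / N" using par[of k n] by simp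
      also have "\<dots> < e\<^sup>2" using N N0 e by (simp add: field_simps)
      finally show ?thesis using e by (simp add: dist_norm power_less_imp_less_base)
    qed
    then show "\<exists>N. \<forall>m\<ge>N. \<forall>n\<ge>N. dist (s m) (s n) < e" by blast
  qed
  then obtain p where p: "s \<longlonglongrightarrow> p" using Cauchy_convergent_iff convergent_def by blast
  have pM: "p \<in> M" using cl p s(1) closed_sequentially by blast
  have "(\<lambda>n. (norm (v - s n))\<^sup>2) \<longlonglongrightarrow> (norm (v - p))\<^sup>2" by (intro tendsto_intros p)
  moreover have "(\<lambda>n. D + 1 / real (Suc n)) \<longlonglongrightarrow> D + 0"
    using LIMSEQ_inverse_real_of_nat by (intro tendsto_intros) (simp add: inverse_eq_divide)
  ultimately have pD: "(norm (v - p))\<^sup>2 \<le> D"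
    using s(2) by (intro LIMSEQ_le[where Y = "\<lambda>n. D + 1 / real (Suc n)"]) (auto intro: less_imp_le)
  have re: "Re (cinner (v - p) q) = 0" if q: "q \<in> M" for q
  proof (rule ccontr)
    assume c: "Re (cinner (v - p) q) \<noteq> 0"
    define r where "r = inner (v - p) q"
    have r: "r \<noteq> 0" using c by (simp add: r_def inner_Re_cinner)
    have qq: "inner q q > 0" using r by (auto simp: r_def)
    define t where "t = r / inner q q"
    have "p + t *\<^sub>R q \<in> M" using sub pM q by (auto simp: subspace_def)
    then have "(norm (v - p))\<^sup>2 \<le> (norm (v - (p + t *\<^sub>R q)))\<^sup>2" using pD D_le order_trans by blast
    also have "\<dots> = (norm (v - p))\<^sup>2 - 2 * t * r + t\<^sup>2 * inner q q"
      unfolding power2_norm_eq_inner r_def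
      by (simp add: inner_diff_left inner_diff_right inner_add_left inner_add_right
        inner_commute algebra_simps power2_eq_square)
    also have "t\<^sup>2 * inner q q = t * r" using qq by (simp add: t_def power2_eq_square)
    finally have "t * r \<le> 0" by (simp add: mult.commute)
    moreover have "t * r = r\<^sup>2 / inner q q" by (simp add: t_def power2_eq_square)
    ultimately show False using r qq by (simp add: divide_le_0_iff)
  qed
  have "cinner (v - p) q = 0" if "q \<in> M" for q
    using re[OF that] re[OF sc[OF that, of \<i>]] by (simp add: cinner_scaleC_right complex_eq_iff)
  then show thesis using that pM by blast
qed

subsection \<open>Orthonormal bases\<close>

definition orthonormal :: "'a::complex_hilbert set \<Rightarrow> bool" where
  "orthonormal B \<longleftrightarrow> (\<forall>b\<in>B. \<forall>c\<in>B. cinner b c = (if b = c then 1 else 0))"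

lemma orthonormal_basis_exists:
  fixes M :: "'a::complex_hilbert set"
  assumes M: "closed_csubspace M"
  obtains B where "B \<subseteq> M" "orthonormal B" "closed_cspan B = M"
proof -
  define \<A> where "\<A> = {B. B \<subseteq> M \<and> orthonormal B}"
  have "\<exists>B\<in>\<A>. \<forall>X\<in>\<A>. B \<subseteq> X \<longrightarrow> X = B"
  proof (rule subset_Zorn')
    fix C assume C: "subset.chain \<A> C"
    have "orthonormal (\<Union>C)"
      unfolding orthonormal_def
    proof (intro ballI)
      fix b c assume "b \<in> \<Union>C" "c \<in> \<Union>C"
      then obtain X Y where XY: "X \<in> C" "b \<in> X" "Y \<in> C" "c \<in> Y" by blast
      then have "X \<subseteq> Y \<or> Y \<subseteq> X" using C unfolding subset.chain_def by blast
      then obtain W where W: "W \<in> C" "b \<in> W" "c \<in> W" using XY by blast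
      then have "orthonormal W" using C by (auto simp: subset.chain_def \<A>_def)
      then show "cinner b c = (if b = c then 1 else 0)"
        using W by (simp add: orthonormal_def)
    qed
    moreover have "\<Union>C \<subseteq> M" using C unfolding subset.chain_def \<A>_def by blast
    ultimately show "\<Union>C \<in> \<A>" by (simp add: \<A>_def)
  qed
  then obtain B where B: "B \<subseteq> M" "orthonormal B"
    and max: "\<And>X. X \<subseteq> M \<Longrightarrow> orthonormal X \<Longrightarrow> B \<subseteq> X \<Longrightarrow> X = B"
    by (auto simp: \<A>_def)
  have sub: "closed_cspan B \<subseteq> M" by (rule hull_minimal) (use B(1) M in auto)
  have "v \<in> closed_cspan B" if v: "v \<in> M" for v
  proof -
    obtain p where p: "p \<in> closed_cspan B" "\<And>q. q \<in> closed_cspan B \<Longrightarrow> cinner (v - p) q = 0"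
      using projection_exists[OF closed_csubspace_closed_cspan] by blast
    have "v = p"
    proof (rule ccontr)
      assume "v \<noteq> p"
      define n where "n = norm (v - p)"
      have n: "n > 0" using \<open>v \<noteq> p\<close> by (simp add: n_def)
      define u where "u = (1 / n) *\<^sub>R (v - p)"
      have uM: "u \<in> M"
        using M sub p(1) v by (auto simp: u_def closed_csubspace_def subspace_def subspace_diff)
      have uu: "cinner u u = 1"
        using n by (simp add: cinner_self u_def n_def)
      have ub: "cinner u b = 0" if "b \<in> B" for b
        using p(2)[of b] that hull_inc[of b B closed_csubspace] by (simp add: u_def cinner_scaleR_left)
      have bu: "cinner b u = 0" if "b \<in> B" for b
        using ub[OF that] cinner_commute[of b u] by simp
      have "u \<notin> B" using ub uu by force
      moreover have "orthonormal (insert u B)"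
        using B(2) uu ub bu unfolding orthonormal_def by auto
      ultimately show False using max[of "insert u B"] uM B(1) by auto
    qed
    then show ?thesis using p by simp
  qed
  then show thesis using that B sub by blast
qed

lemma parseval:
  fixes B :: "'a::complex_hilbert set"
  assumes B: "orthonormal B" and x: "x \<in> closed_cspan B"
  shows "((\<lambda>b. cinner x b * cinner b y) has_sum cinner x y) B"
proof -
  define pr where "pr F x = (\<Sum>b\<in>F. cinner x b *\<^sub>C b)" for F and x :: 'a
  have pr_in: "cinner (pr F x) c = (if c \<in> F then cinner x c else 0)"
    if "finite F" "F \<subseteq> B" "c \<in> B" for F x c
  proof -
    have "cinner (pr F x) c = (\<Sum>b\<in>F. cinner x b * (if b = c then 1 else 0))"
      unfolding pr_def cinner_sum_left cinner_scaleC_left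
      using that B by (intro sum.cong) (auto simp: orthonormal_def)
    also have "\<dots> = (\<Sum>b\<in>F. if b = c then cinner x b else 0)" by (intro sum.cong) auto
    finally show ?thesis using that by simp
  qed
  have pr_diff: "pr F (x - y) = pr F x - pr F y" for F x y
    by (simp add: pr_def cinner_diff_left scaleC_diff_left sum_subtractf)
  have best: "norm (x - pr F x) \<le> norm (x - w)"
    if "finite F" "F \<subseteq> B" "w = (\<Sum>b\<in>F. g b *\<^sub>C b)" for F x w and g :: "'a \<Rightarrow> complex"
  proof -
    define d where "d = pr F x - w"
    have d: "d = (\<Sum>b\<in>F. (cinner x b - g b) *\<^sub>C b)"
      unfolding d_def pr_def that(3) sum_subtractf[symmetric]
      by (simp add: scaleC_diff_left)
    have "cinner d (x - pr F x) = 0"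
      unfolding d cinner_sum_left cinner_scaleC_left
    proof (intro sum.neutral ballI)
      fix b assume b: "b \<in> F"
      have "cinner (x - pr F x) b = 0"
        using pr_in[OF that(1,2), of b x] that b by (auto simp: cinner_diff_left)
      then show "(cinner x b - g b) * cinner b (x - pr F x) = 0"
        using cinner_commute[of b "x - pr F x"] by simp
    qed
    then have "inner d (x - pr F x) = 0" "inner (x - pr F x) d = 0"
      by (simp add: inner_Re_cinner, metis inner_Re_cinner inner_commute zero_complex.sel(1))
    moreover have xw: "x - w = (x - pr F x) + d" by (simp add: d_def)
    ultimately have "(norm (x - w))\<^sup>2 = (norm (x - pr F x))\<^sup>2 + (norm d)\<^sup>2"
      unfolding power2_norm_eq_inner xw inner_add_left inner_add_right by linarith
    then show ?thesis by (simp add: power2_le_imp_le)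
  qed
  have contr: "norm (x - pr F x) \<le> norm x" if "finite F" "F \<subseteq> B" for F x
    using best[OF that, of 0 "\<lambda>_. 0" x] by simp
  have mono: "norm (x - pr G x) \<le> norm (x - pr F x)" if "finite G" "F \<subseteq> G" "G \<subseteq> B" for F G x
  proof (rule best[where g = "\<lambda>b. if b \<in> F then cinner x b else 0"])
    show "pr F x = (\<Sum>b\<in>G. (if b \<in> F then cinner x b else 0) *\<^sub>C b)"
      unfolding pr_def using that by (intro sum.mono_neutral_cong_left) auto
  qed (use that in auto)
  define N where "N = {x. \<forall>e>0. \<exists>F. finite F \<and> F \<subseteq> B \<and> norm (x - pr F x) < e}"
  have N_D: "\<exists>F. finite F \<and> F \<subseteq> B \<and> norm (v - pr F v) < e" if "v \<in> N" "e > 0" for v e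
    using that by (simp add: N_def)
  have "closed_csubspace N"
    unfolding closed_csubspace_def
  proof (intro conjI allI ballI)
    show "closed N"
      unfolding closed_sequential_limits
    proof (intro allI impI; elim conjE)
      fix s l assume s: "\<forall>n. s n \<in> N" "s \<longlonglongrightarrow> l"
      show "l \<in> N" unfolding N_def
      proof (intro CollectI allI impI)
        fix e :: real assume e: "e > 0"
        then obtain n where n: "norm (s n - l) < e / 2"
          using LIMSEQ_D[OF s(2), of "e / 2"] by auto
        obtain F where F: "finite F" "F \<subseteq> B" "norm (s n - pr F (s n)) < e / 2"
          using N_D[of "s n" "e / 2"] s(1) e by auto
        have "norm (l - pr F l) \<le> norm (s n - pr F (s n)) + norm ((l - s n) - pr F (l - s n))"
          unfolding pr_diff using norm_triangle_ineq[of "s n - pr F (s n)" "(l - s n) - (pr F l - pr F (s n))"]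
          by (simp add: algebra_simps)
        also have "\<dots> < e" using F n contr[OF F(1,2), of "l - s n"] by (simp add: norm_minus_commute)
        finally show "\<exists>F. finite F \<and> F \<subseteq> B \<and> norm (l - pr F l) < e" using F by blast
      qed
    qed
    have sc: "c *\<^sub>C v \<in> N" if v: "v \<in> N" for c v
      unfolding N_def
    proof (intro CollectI allI impI)
      fix e :: real assume e: "e > 0"
      have "e / (cmod c + 1) > 0" using e by (simp add: add_nonneg_pos)
      then obtain F where F: "finite F" "F \<subseteq> B" "norm (v - pr F v) < e / (cmod c + 1)"
        using N_D[OF v] by blast
      have scs: "c *\<^sub>C sum f F = (\<Sum>b\<in>F. c *\<^sub>C f b)" for f :: "'a \<Rightarrow> 'a"
        using F(1)
        by (induction F) (simp_all add: scaleC_add_right)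
      have "c *\<^sub>C v - pr F (c *\<^sub>C v) = c *\<^sub>C (v - pr F v)"
        by (simp add: scaleC_diff_right pr_def scs cinner_scaleC_left scaleC_scaleC)
      then have "norm (c *\<^sub>C v - pr F (c *\<^sub>C v)) = cmod c * norm (v - pr F v)" by (simp add: norm_scaleC)
      also have "\<dots> \<le> (cmod c + 1) * norm (v - pr F v)" by (simp add: mult_right_mono)
      also have "\<dots> < e" using F(3) by (simp add: pos_less_divide_eq add_nonneg_pos mult.commute)
      finally show "\<exists>F. finite F \<and> F \<subseteq> B \<and> norm (c *\<^sub>C v - pr F (c *\<^sub>C v)) < e" using F by blast
    qed
    then show "c *\<^sub>C v \<in> N" if "v \<in> N" for c v using that by blast
    show "subspace N"
      unfolding subspace_def
    proof (intro conjI ballI allI)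
      show "0 \<in> N" unfolding N_def by (auto intro!: exI[of _ "{}"] simp: pr_def)
      show "r *\<^sub>R v \<in> N" if "v \<in> N" for r v using sc[OF that] by (simp add: scaleR_scaleC)
      fix u v assume uv: "u \<in> N" "v \<in> N"
      show "u + v \<in> N" unfolding N_def
      proof (intro CollectI allI impI)
        fix e :: real assume e: "e > 0"
        obtain F where F: "finite F" "F \<subseteq> B" "norm (u - pr F u) < e / 2"
          using N_D[of u "e / 2"] uv(1) e by auto
        obtain G where G: "finite G" "G \<subseteq> B" "norm (v - pr G v) < e / 2"
          using N_D[of v "e / 2"] uv(2) e by auto
        let ?K = "F \<union> G"
        have "pr ?K (u + v) = pr ?K u + pr ?K v"
          using pr_diff[of ?K "u + v" v] by simp
        then have "norm (u + v - pr ?K (u + v)) \<le> norm (u - pr ?K u) + norm (v - pr ?K v)"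
          using norm_triangle_ineq[of "u - pr ?K u" "v - pr ?K v"] by (simp add: algebra_simps)
        also have "\<dots> < e"
          using mono[of ?K F u] mono[of ?K G v] F G by simp
        finally show "\<exists>F. finite F \<and> F \<subseteq> B \<and> norm (u + v - pr F (u + v)) < e"
          using F G by (intro exI[of _ ?K]) auto
      qed
    qed
  qed
  moreover have "B \<subseteq> N"
  proof
    fix b assume b: "b \<in> B"
    have "pr {b} b = b" using b B by (simp add: pr_def orthonormal_def)
    then show "b \<in> N" unfolding N_def using b by (auto intro!: exI[of _ "{b}"])
  qed
  ultimately have xN: "x \<in> N" using x hull_minimal[of B N closed_csubspace] by blast
  show ?thesis
    unfolding has_sum_def
  proof (rule tendstoI)
    fix e :: real assume e: "e > 0"
    have "e / (norm y + 1) > 0" using e by (simp add: add_nonneg_pos)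
    then obtain F where F: "finite F" "F \<subseteq> B" "norm (x - pr F x) < e / (norm y + 1)"
      using xN unfolding N_def by blast
    have "dist (\<Sum>b\<in>G. cinner x b * cinner b y) (cinner x y) < e"
      if G: "finite G" "F \<subseteq> G" "G \<subseteq> B" for G
    proof -
      have "dist (\<Sum>b\<in>G. cinner x b * cinner b y) (cinner x y) = cmod (cinner (x - pr G x) y)"
        by (simp add: dist_norm cinner_diff_left pr_def cinner_sum_left cinner_scaleC_left norm_minus_commute)
      also have "\<dots> \<le> norm (x - pr G x) * norm y" by (rule cmod_cinner_le)
      also have "\<dots> \<le> norm (x - pr F x) * (norm y + 1)"
        using mono[OF G] by (intro mult_mono) auto
      also have "\<dots> < e" using F(3) by (simp add: pos_less_divide_eq add_nonneg_pos)
      finally show ?thesis .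
    qed
    then show "\<forall>\<^sub>F G in finite_subsets_at_top B. dist (\<Sum>b\<in>G. cinner x b * cinner b y) (cinner x y) < e"
      unfolding eventually_finite_subsets_at_top using F by blast
  qed
qed


subsection \<open>Square-summable families\<close>

typedef 'i ell2 = "{f :: 'i \<Rightarrow> complex. (\<lambda>i. (cmod (f i))\<^sup>2) summable_on UNIV}"
  morphisms coord Abs_ell2
  by (rule exI[of _ "\<lambda>_. 0"]) simp

setup_lifting type_definition_ell2

lemma ell2_add_summable:
  fixes f g :: "'i \<Rightarrow> complex"
  assumes "(\<lambda>i. (cmod (f i))\<^sup>2) summable_on UNIV" "(\<lambda>i. (cmod (g i))\<^sup>2) summable_on UNIV"
  shows "(\<lambda>i. (cmod (f i + g i))\<^sup>2) summable_on UNIV"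
proof (rule summable_on_comparison_test)
  show "(\<lambda>i. 2 * (cmod (f i))\<^sup>2 + 2 * (cmod (g i))\<^sup>2) summable_on UNIV"
    using assms by (intro summable_on_add summable_on_cmult_right)
  fix i
  have "(cmod (f i + g i))\<^sup>2 \<le> (cmod (f i) + cmod (g i))\<^sup>2"
    by (intro power_mono norm_triangle_ineq) simp
  also have "\<dots> \<le> 2 * (cmod (f i))\<^sup>2 + 2 * (cmod (g i))\<^sup>2"
    using sum_squares_ge_zero[of "cmod (f i) - cmod (g i)" 0]
    by (simp add: power2_eq_square algebra_simps)
  finally show "(cmod (f i + g i))\<^sup>2 \<le> 2 * (cmod (f i))\<^sup>2 + 2 * (cmod (g i))\<^sup>2" .
qed simp

lemma ell2_prod_abs_summable:
  fixes f g :: "'i \<Rightarrow> complex"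
  assumes "(\<lambda>i. (cmod (f i))\<^sup>2) summable_on UNIV" "(\<lambda>i. (cmod (g i))\<^sup>2) summable_on UNIV"
  shows "(\<lambda>i. norm (f i * cnj (g i))) summable_on UNIV"
proof (rule summable_on_comparison_test)
  show "(\<lambda>i. (cmod (f i))\<^sup>2 + (cmod (g i))\<^sup>2) summable_on UNIV"
    using assms by (rule summable_on_add)
  show "norm (f i * cnj (g i)) \<le> (cmod (f i))\<^sup>2 + (cmod (g i))\<^sup>2" for i
  proof -
    have "0 \<le> (cmod (f i) - cmod (g i))\<^sup>2" "0 \<le> cmod (f i) * cmod (g i)" by simp_all
    then show ?thesis unfolding norm_mult complex_mod_cnj power2_diff by linarith
  qed
qed simp

definition ell2_cinner :: "'i ell2 \<Rightarrow> 'i ell2 \<Rightarrow> complex" where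
  "ell2_cinner f g = (\<Sum>\<^sub>\<infinity>i. coord f i * cnj (coord g i))"

instantiation ell2 :: (type) real_inner
begin

lift_definition zero_ell2 :: "'a ell2" is "\<lambda>_. 0" by simp
lift_definition plus_ell2 :: "'a ell2 \<Rightarrow> 'a ell2 \<Rightarrow> 'a ell2" is "\<lambda>f g i. f i + g i"
  by (rule ell2_add_summable)
lift_definition uminus_ell2 :: "'a ell2 \<Rightarrow> 'a ell2" is "\<lambda>f i. - f i" by simp
lift_definition scaleR_ell2 :: "real \<Rightarrow> 'a ell2 \<Rightarrow> 'a ell2" is "\<lambda>r f i. of_real r * f i"
  by (simp add: norm_mult power_mult_distrib summable_on_cmult_right)
definition minus_ell2 :: "'a ell2 \<Rightarrow> 'a ell2 \<Rightarrow> 'a ell2" where "minus_ell2 f g = f + (- g)"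
definition inner_ell2 :: "'a ell2 \<Rightarrow> 'a ell2 \<Rightarrow> real" where "inner_ell2 f g = Re (ell2_cinner f g)"
definition norm_ell2 :: "'a ell2 \<Rightarrow> real" where "norm_ell2 f = sqrt (inner f f)"
definition dist_ell2 :: "'a ell2 \<Rightarrow> 'a ell2 \<Rightarrow> real" where "dist_ell2 f g = norm (f - g)"
definition sgn_ell2 :: "'a ell2 \<Rightarrow> 'a ell2" where "sgn_ell2 f = inverse (norm f) *\<^sub>R f"
definition uniformity_ell2 :: "('a ell2 \<times> 'a ell2) filter" where
  "uniformity_ell2 = (INF e\<in>{0 <..}. principal {(x, y). dist x y < e})"
definition open_ell2 :: "'a ell2 set \<Rightarrow> bool" where
  "open_ell2 U = (\<forall>x\<in>U. eventually (\<lambda>(x', y). x' = x \<longrightarrow> y \<in> U) uniformity)"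

lemma coord_simps:
  "coord (f + g) i = coord f i + coord g i" "coord (- f) i = - coord f i"
  "coord (f - g) i = coord f i - coord g i" "coord 0 i = 0"
  "coord (r *\<^sub>R f) i = of_real r * coord f i"
  by (simp_all add: minus_ell2_def scaleR_ell2.rep_eq plus_ell2.rep_eq uminus_ell2.rep_eq
      zero_ell2.rep_eq)

lemma coord_eqI: "(\<And>i. coord f i = coord g i) \<Longrightarrow> f = g"
  by (metis coord_inject ext)

lemma coord_sq_summable: "(\<lambda>i. (cmod (coord f i))\<^sup>2) summable_on UNIV"
  using coord[of f] by simp

lemma coord_prod_summable: "(\<lambda>i. coord f i * cnj (coord g i)) summable_on UNIV"
  by (rule abs_summable_summable, rule ell2_prod_abs_summable) (rule coord_sq_summable)+

lemma inner_self_ell2: "inner f f = (\<Sum>\<^sub>\<infinity>i. (cmod (coord f i))\<^sup>2)"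
proof -
  have "((\<lambda>i. (cmod (coord f i))\<^sup>2) has_sum (\<Sum>\<^sub>\<infinity>i. (cmod (coord f i))\<^sup>2)) UNIV"
    using coord_sq_summable by (rule has_sum_infsum)
  then have "((\<lambda>i. complex_of_real ((cmod (coord f i))\<^sup>2)) has_sum
      complex_of_real (\<Sum>\<^sub>\<infinity>i. (cmod (coord f i))\<^sup>2)) UNIV"
    by (rule has_sum_of_real)
  then show ?thesis
    unfolding inner_ell2_def ell2_cinner_def complex_norm_square
    by (simp add: infsumI)
qed

lemma inner_self_nonneg_ell2: "inner f f \<ge> (0::real)" for f :: "'a ell2"
  unfolding inner_self_ell2 by (rule infsum_nonneg) simp

lemma coord_sum_le: "finite F \<Longrightarrow> (\<Sum>i\<in>F. (cmod (coord f i))\<^sup>2) \<le> inner f f"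
  unfolding inner_self_ell2 by (intro finite_sum_le_infsum coord_sq_summable) auto

lemma cmod_coord_sq_le: "(cmod (coord f i))\<^sup>2 \<le> inner f f"
  using coord_sum_le[of "{i}" f] by simp

lemma ell2_cinner_add: "ell2_cinner (f + g) h = ell2_cinner f h + ell2_cinner g h"
  unfolding ell2_cinner_def
  by (subst infsum_add[symmetric]) (auto intro: coord_prod_summable simp: coord_simps algebra_simps)

lemma ell2_cinner_scale:
  "(\<And>i. coord f' i = c * coord f i) \<Longrightarrow> ell2_cinner f' h = c * ell2_cinner f h"
  unfolding ell2_cinner_def by (simp add: infsum_cmult_right' mult.assoc)

lemma ell2_cinner_commute: "ell2_cinner f g = cnj (ell2_cinner g f)"
  unfolding ell2_cinner_def by (simp add: infsum_cnj[symmetric] mult.commute)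

instance
proof
  fix x y z :: "'a ell2" and r s :: real
  show "x + y + z = x + (y + z)" "x + y = y + x" "0 + x = x" "- x + x = 0" "x - y = x + - y"
    "r *\<^sub>R (x + y) = r *\<^sub>R x + r *\<^sub>R y" "(r + s) *\<^sub>R x = r *\<^sub>R x + s *\<^sub>R x"
    "r *\<^sub>R s *\<^sub>R x = (r * s) *\<^sub>R x" "1 *\<^sub>R x = x"
    by (rule coord_eqI; simp add: coord_simps algebra_simps)+
  show "dist x y = norm (x - y)" by (rule dist_ell2_def)
  show "sgn x = inverse (norm x) *\<^sub>R x" by (rule sgn_ell2_def)
  show "(uniformity :: ('a ell2 \<times> 'a ell2) filter) = (INF e\<in>{0 <..}. principal {(x, y). dist x y < e})"
    by (rule uniformity_ell2_def)
  show "open U = (\<forall>x\<in>U. eventually (\<lambda>(x', y). x' = x \<longrightarrow> y \<in> U) uniformity)" for U :: "'a ell2 set"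
    by (rule open_ell2_def)
  show "inner x y = inner y x"
    unfolding inner_ell2_def by (subst ell2_cinner_commute) simp
  show "inner (x + y) z = inner x z + inner y z" by (simp add: inner_ell2_def ell2_cinner_add)
  show "inner (r *\<^sub>R x) y = r * inner x y"
    unfolding inner_ell2_def by (subst ell2_cinner_scale[where f = x and c = "of_real r"]) (simp_all add: coord_simps)
  show "0 \<le> inner x x" by (rule inner_self_nonneg_ell2)
  show "(inner x x = 0) = (x = 0)"
  proof
    assume "inner x x = 0"
    then show "x = 0" using cmod_coord_sq_le[of x] by (intro coord_eqI) (simp add: coord_simps)
  next
    assume "x = 0"
    then show "inner x x = 0" by (simp add: inner_self_ell2 coord_simps)
  qed
  show "norm x = sqrt (inner x x)" by (rule norm_ell2_def)
qed

end

instance ell2 :: (type) banach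
proof
  fix X :: "nat \<Rightarrow> 'a ell2" assume X: "Cauchy X"
  have nsq: "inner f f = (norm f)\<^sup>2" for f :: "'a ell2"
    by (simp add: norm_ell2_def inner_self_nonneg_ell2)
  have cle: "cmod (coord f i) \<le> norm f" for f :: "'a ell2" and i
    unfolding norm_ell2_def using cmod_coord_sq_le[of f i] by (rule real_le_rsqrt)
  have ev: "\<exists>N. \<forall>k\<ge>N. \<forall>n\<ge>N. norm (X k - X n) < e" if "e > 0" for e
    using X that unfolding Cauchy_def dist_ell2_def by blast
  have "\<exists>g. (\<lambda>n. coord (X n) i) \<longlonglongrightarrow> g" for i
  proof -
    have "Cauchy (\<lambda>n. coord (X n) i)"
      unfolding Cauchy_def dist_norm
    proof (intro allI impI)
      fix e :: real assume "e > 0"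
      then obtain N where N: "\<forall>k\<ge>N. \<forall>n\<ge>N. norm (X k - X n) < e" using ev by blast
      have "cmod (coord (X k) i - coord (X n) i) < e" if "k \<ge> N" "n \<ge> N" for k n
        using cle[of "X k - X n" i] N that by (simp add: coord_simps) (meson le_less_trans)
      then show "\<exists>N. \<forall>k\<ge>N. \<forall>n\<ge>N. cmod (coord (X k) i - coord (X n) i) < e" by blast
    qed
    then show ?thesis using Cauchy_convergent_iff convergent_def by blast
  qed
  then obtain g where g: "\<And>i. (\<lambda>n. coord (X n) i) \<longlonglongrightarrow> g i" by metis
  have fin: "(\<Sum>i\<in>F. (cmod (coord (X k) i - g i))\<^sup>2) \<le> e\<^sup>2"
    if N: "\<forall>k\<ge>N. \<forall>n\<ge>N. norm (X k - X n) < e" and "k \<ge> N" "finite F" for N k e F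
  proof (rule LIMSEQ_le_const2)
    show "(\<lambda>n. \<Sum>i\<in>F. (cmod (coord (X k) i - coord (X n) i))\<^sup>2)
        \<longlonglongrightarrow> (\<Sum>i\<in>F. (cmod (coord (X k) i - g i))\<^sup>2)"
      by (intro tendsto_intros g)
    show "\<exists>N. \<forall>n\<ge>N. (\<Sum>i\<in>F. (cmod (coord (X k) i - coord (X n) i))\<^sup>2) \<le> e\<^sup>2"
    proof (intro exI allI impI)
      fix n assume "n \<ge> N"
      have "(\<Sum>i\<in>F. (cmod (coord (X k) i - coord (X n) i))\<^sup>2) \<le> (norm (X k - X n))\<^sup>2"
        using coord_sum_le[OF that(3), of "X k - X n"] by (simp add: coord_simps nsq)
      also have "\<dots> \<le> e\<^sup>2" using N \<open>n \<ge> N\<close> that(2)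
        by (intro power_mono) (auto intro: less_imp_le simp: norm_ell2_def inner_self_nonneg_ell2)
      finally show "(\<Sum>i\<in>F. (cmod (coord (X k) i - coord (X n) i))\<^sup>2) \<le> e\<^sup>2" .
    qed
  qed
  have summ: "(\<lambda>i. (cmod (coord (X k) i - g i))\<^sup>2) summable_on UNIV"
    if N: "\<forall>k\<ge>N. \<forall>n\<ge>N. norm (X k - X n) < e" and "k \<ge> N" for N k e
    using fin[OF that] by (intro nonneg_bdd_above_summable_on bdd_aboveI[where M = "e\<^sup>2"]) auto
  obtain N1 where N1: "\<forall>k\<ge>N1. \<forall>n\<ge>N1. norm (X k - X n) < 1" using ev[of 1] by auto
  have "(\<lambda>i. (cmod (coord (- X N1) i + (coord (X N1) i - g i)))\<^sup>2) summable_on UNIV"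
    by (intro ell2_add_summable coord_sq_summable summ[OF N1]) simp
  then have "(\<lambda>i. (cmod (g i))\<^sup>2) summable_on UNIV" by (simp add: coord_simps)
  then have G: "coord (Abs_ell2 g) = g" by (simp add: Abs_ell2_inverse)
  have "X \<longlonglongrightarrow> Abs_ell2 g"
    unfolding LIMSEQ_def dist_ell2_def
  proof (intro allI impI)
    fix e :: real assume e: "e > 0"
    obtain N where N: "\<forall>k\<ge>N. \<forall>n\<ge>N. norm (X k - X n) < e / 2" using ev[of "e / 2"] e by auto
    have "norm (X k - Abs_ell2 g) < e" if "k \<ge> N" for k
    proof -
      have "(\<Sum>\<^sub>\<infinity>i. (cmod (coord (X k) i - g i))\<^sup>2) \<le> (e / 2)\<^sup>2"
        by (rule infsum_le_finite_sums[OF summ[OF N that]]) (rule fin[OF N that])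
      then have "(norm (X k - Abs_ell2 g))\<^sup>2 \<le> (e / 2)\<^sup>2"
        unfolding nsq[symmetric] inner_self_ell2 coord_simps G .
      then have "norm (X k - Abs_ell2 g) \<le> e / 2"
        by (rule power2_le_imp_le) (use e in simp)
      then show ?thesis using e by linarith
    qed
    then show "\<exists>N. \<forall>n\<ge>N. norm (X n - Abs_ell2 g) < e" by blast
  qed
  then show "convergent X" by (auto simp: convergent_def)
qed

instantiation ell2 :: (type) complex_hilbert
begin

lift_definition scaleC_ell2 :: "complex \<Rightarrow> 'a ell2 \<Rightarrow> 'a ell2" is "\<lambda>c f i. c * f i"
  by (simp add: norm_mult power_mult_distrib summable_on_cmult_right)
definition cinner_ell2 :: "'a ell2 \<Rightarrow> 'a ell2 \<Rightarrow> complex" where "cinner_ell2 = ell2_cinner"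

instance
proof
  fix x y z :: "'a ell2" and r :: real and c d :: complex
  show "c *\<^sub>C (x + y) = c *\<^sub>C x + c *\<^sub>C y" "(c + d) *\<^sub>C x = c *\<^sub>C x + d *\<^sub>C x"
    "c *\<^sub>C d *\<^sub>C x = (c * d) *\<^sub>C x" "r *\<^sub>R x = of_real r *\<^sub>C x"
    by (rule coord_eqI; simp add: coord_simps scaleC_ell2.rep_eq algebra_simps)+
  show "cinner (x + y) z = cinner x z + cinner y z"
    unfolding cinner_ell2_def by (rule ell2_cinner_add)
  show "cinner (c *\<^sub>C x) y = c * cinner x y"
    unfolding cinner_ell2_def by (rule ell2_cinner_scale) (simp add: scaleC_ell2.rep_eq)
  show "cinner x y = cnj (cinner y x)"
    unfolding cinner_ell2_def by (rule ell2_cinner_commute)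
  show "inner x y = Re (cinner x y)"
    unfolding cinner_ell2_def by (rule inner_ell2_def)
qed

end

subsection \<open>Existence\<close>

text \<open>Expanding in orthonormal bases of the centered subspaces realises the free product inside
  \<open>\<ell>\<^sup>2\<close> of the set of basis words.\<close>

lemma has_sum_prod_words:
  fixes f :: "'p \<Rightarrow> 'b \<Rightarrow> complex" and B :: "'p \<Rightarrow> 'b set"
  assumes "\<And>p. p \<in> set w \<Longrightarrow> (f p has_sum s p) (B p)"
  shows "((\<lambda>bs. \<Prod>k<length w. f (w ! k) (bs ! k)) has_sum (\<Prod>k<length w. s (w ! k)))
    {bs. length bs = length w \<and> (\<forall>k<length w. bs ! k \<in> B (w ! k))}"
  using assms
proof (induction w)
  case Nil
  have "{bs :: 'b list. length bs = length ([] :: 'p list) \<and>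
      (\<forall>k<length []. bs ! k \<in> B ([] ! k))} = {[]}" by auto
  then show ?case by (simp add: has_sum_finiteI)
next
  case (Cons p w)
  let ?W = "\<lambda>w. {bs. length bs = length w \<and> (\<forall>k<length w. bs ! k \<in> B (w ! k))}"
  let ?F = "\<lambda>bs. \<Prod>k<length w. f (w ! k) (bs ! k)"
  have 1: "(f p has_sum s p) (B p)" using Cons.prems by simp
  have 2: "(?F has_sum (\<Prod>k<length w. s (w ! k))) (?W w)" by (rule Cons.IH) (use Cons.prems in simp)

  have sums: "(\<lambda>b. norm (f p b)) summable_on B p" "(\<lambda>bs. norm (?F bs)) summable_on ?W w"
    using has_sum_imp_summable[OF 1] has_sum_imp_summable[OF 2]
    by (simp_all only: summable_on_iff_abs_summable_on_complex)
  let ?G = "\<lambda>(b, bs). f p b * ?F bs"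
  have "(\<lambda>x. norm (?G x)) summable_on B p \<times> ?W w"
  proof (rule Infinite_Sum.abs_summable_on_Sigma_iff[THEN iffD2], unfold case_prod_conv norm_mult, intro conjI ballI)
    fix b assume "b \<in> B p"
    show "(\<lambda>y. norm (f p b) * norm (?F y)) summable_on ?W w"
      using sums(2) by (rule summable_on_cmult_right)
  next
    show "(\<lambda>b. norm (\<Sum>\<^sub>\<infinity>bs\<in>?W w. norm (f p b) * norm (?F bs))) summable_on B p"
      unfolding infsum_cmult_right' real_norm_def abs_mult abs_norm_cancel
      using sums(1) by (rule summable_on_cmult_left)
  qed
  then have "?G summable_on B p \<times> ?W w" by (rule abs_summable_summable)
  then have "(?G has_sum s p * (\<Prod>k<length w. s (w ! k))) (B p \<times> ?W w)"
    by (intro has_sum_SigmaI[where g = "\<lambda>b. f p b * (\<Prod>k<length w. s (w ! k))"])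
       (auto intro: has_sum_cmult_right has_sum_cmult_left 1 2)
  moreover have "?W (p # w) = (\<lambda>(b, bs). b # bs) ` (B p \<times> ?W w)"
  proof (intro equalityI subsetI)
    fix bs assume bs: "bs \<in> ?W (p # w)"
    then obtain c cs where c: "bs = c # cs" by (cases bs) auto
    have "c \<in> B p" using bs c by force
    moreover have "cs \<in> ?W w" using bs c by force
    ultimately show "bs \<in> (\<lambda>(b, bs). b # bs) ` (B p \<times> ?W w)" using c by force
  next
    fix bs assume "bs \<in> (\<lambda>(b, bs). b # bs) ` (B p \<times> ?W w)"
    then show "bs \<in> ?W (p # w)" by (auto simp: nth_Cons split: nat.splits)
  qed
  moreover have "(\<lambda>bs. \<Prod>k<length (p # w). f ((p # w) ! k) (bs ! k)) \<circ> (\<lambda>(b, bs). b # bs) = ?G"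
    by (auto simp: fun_eq_iff prod.lessThan_Suc_shift simp del: prod.lessThan_Suc)
  moreover have "inj_on (\<lambda>(b, bs). b # bs) (B p \<times> ?W w)" by (auto simp: inj_on_def)
  moreover have "(\<Prod>k<length (p # w). s ((p # w) ! k)) = s p * (\<Prod>k<length w. s (w ! k))"
    by (simp add: prod.lessThan_Suc_shift del: prod.lessThan_Suc)
  ultimately show ?case by (simp only: has_sum_reindex)
qed

theorem free_product_exists:
  fixes H :: "side \<Rightarrow> 'a::complex_hilbert set"
  assumes H: "\<And>\<iota>. closed_csubspace (H \<iota>)" and \<xi>: "\<And>\<iota>. \<xi> \<iota> \<in> H \<iota>" "\<And>\<iota>. norm (\<xi> \<iota>) = 1"
  shows "\<exists>T :: (side \<times> 'a) list \<Rightarrow> (side list \<times> 'a list) ell2. free_product H \<xi> T"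
proof -
  have "closed_csubspace (centered H \<xi> \<iota>)" for \<iota>
  proof -
    have bl: "bounded_linear (\<lambda>h. cinner h (\<xi> \<iota>))"
      by (rule bounded_linear_intro[where K = 1])
         (auto simp: cinner_add_left cinner_scaleR_left scaleR_conv_of_real
           intro: order_trans[OF cmod_cinner_le] simp: \<xi>)
    have "centered H \<xi> \<iota> = H \<iota> \<inter> (\<lambda>h. cinner h (\<xi> \<iota>)) -` {0}" by (auto simp: centered_def)
    moreover have "closed ((\<lambda>h. cinner h (\<xi> \<iota>)) -` {0})"
      by (intro closed_vimage closed_singleton linear_continuous_on[OF bl])
    ultimately have "closed (centered H \<xi> \<iota>)"
      using H[of \<iota>] by (auto simp: closed_csubspace_def)
    then show ?thesis
      using H[of \<iota>] by (auto simp: closed_csubspace_def subspace_def centered_def cinner_add_left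
          cinner_scaleC_left cinner_scaleR_left)
  qed
  then have "\<exists>B. orthonormal B \<and> closed_cspan B = centered H \<xi> \<iota>" for \<iota>
    by (metis orthonormal_basis_exists)
  then obtain B where B: "\<And>\<iota>. orthonormal (B \<iota>)" "\<And>\<iota>. closed_cspan (B \<iota>) = centered H \<xi> \<iota>"
    by metis
  let ?W = "\<lambda>w. {bs. length bs = length w \<and> (\<forall>k<length w. bs ! k \<in> B (fst (w ! k)))}"
  define f :: "(side \<times> 'a) list \<Rightarrow> side list \<times> 'a list \<Rightarrow> complex" where
    "f w = (\<lambda>(\<kappa>s, bs). if \<kappa>s = map fst w \<and> bs \<in> ?W w
       then \<Prod>k<length w. cinner (snd (w ! k)) (bs ! k) else 0)" for w
  have key: "((\<lambda>i. f w i * cnj (f w' i)) has_sum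
      (\<Prod>k<length w. cinner (snd (w ! k)) (snd (w' ! k)))) UNIV"
    if w: "w \<in> words H \<xi>" and w': "w' \<in> words H \<xi>" and eq: "map fst w = map fst w'" for w w'
  proof -
    have len: "length w = length w'" using eq map_eq_imp_length_eq by blast
    have fst: "fst (w ! k) = fst (w' ! k)" if "k < length w" for k
      using arg_cong[OF eq, of "\<lambda>l. l ! k"] that len by simp
    have WW: "?W w = ?W w'" using len fst by auto
    define z where "z = zip w w'"
    have z: "length z = length w" "\<And>k. k < length w \<Longrightarrow> z ! k = (w ! k, w' ! k)"
      using len by (auto simp: z_def)
    have par: "((\<lambda>b. cinner x b * cnj (cinner y b)) has_sum cinner x y) (B \<iota>)"
      if "x \<in> centered H \<xi> \<iota>" for x y \<iota>
      using parseval[OF B(1), of x \<iota> y] that B(2) by (simp add: cinner_commute[of _ y])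
    have cen: "snd (w ! k) \<in> centered H \<xi> (fst (w ! k))" if "k < length w" for k
      using w that nth_mem[OF that] by (auto simp: words_def case_prod_beta)
    have "((\<lambda>bs. \<Prod>k<length w. cinner (snd (w ! k)) (bs ! k) * cnj (cinner (snd (w' ! k)) (bs ! k))) has_sum
      (\<Prod>k<length w. cinner (snd (w ! k)) (snd (w' ! k)))) (?W w)"
    proof -
      have "((\<lambda>b. cinner (snd (fst p)) b * cnj (cinner (snd (snd p)) b)) has_sum
          cinner (snd (fst p)) (snd (snd p))) (B (fst (fst p)))" if p: "p \<in> set z" for p
      proof -
        obtain k where k: "k < length w" "z ! k = p" using p z by (metis in_set_conv_nth)
        show ?thesis using par[OF cen[OF k(1)]] k z by auto
      qed
      from has_sum_prod_words[where w = z and B = "\<lambda>p. B (fst (fst p))", OF this]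
      have "((\<lambda>bs. \<Prod>k<length w. cinner (snd (fst (z ! k))) (bs ! k) * cnj (cinner (snd (snd (z ! k))) (bs ! k)))
          has_sum (\<Prod>k<length w. cinner (snd (fst (z ! k))) (snd (snd (z ! k)))))
          {bs. length bs = length w \<and> (\<forall>k<length w. bs ! k \<in> B (fst (fst (z ! k))))}"
        by (simp add: z(1))
      moreover have "(\<Prod>k<length w. cinner (snd (fst (z ! k))) (bs ! k) * cnj (cinner (snd (snd (z ! k))) (bs ! k)))
          = (\<Prod>k<length w. cinner (snd (w ! k)) (bs ! k) * cnj (cinner (snd (w' ! k)) (bs ! k)))" for bs
        by (intro prod.cong) (auto simp: z(2))
      moreover have "(\<Prod>k<length w. cinner (snd (fst (z ! k))) (snd (snd (z ! k))))
          = (\<Prod>k<length w. cinner (snd (w ! k)) (snd (w' ! k)))"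
        by (intro prod.cong) (auto simp: z(2))
      moreover have "{bs. length bs = length w \<and> (\<forall>k<length w. bs ! k \<in> B (fst (fst (z ! k))))} = ?W w"
        by (auto simp: z(2))
      ultimately show ?thesis by simp
    qed
    then have "((\<lambda>i. f w i * cnj (f w' i)) \<circ> Pair (map fst w) has_sum
      (\<Prod>k<length w. cinner (snd (w ! k)) (snd (w' ! k)))) (?W w)"
      by (rule has_sum_cong[THEN iffD1, rotated]) (use WW eq len in \<open>auto simp: f_def prod.distrib\<close>)
    then have "((\<lambda>i. f w i * cnj (f w' i)) has_sum
      (\<Prod>k<length w. cinner (snd (w ! k)) (snd (w' ! k)))) (Pair (map fst w) ` ?W w)"
      by (subst has_sum_reindex) (auto simp: inj_on_def)
    then show ?thesis
      by (rule has_sum_cong_neutral[THEN iffD1, rotated -1]) (auto simp: f_def)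
  qed
  define T where "T w = Abs_ell2 (f w)" for w
  have T: "coord (T w) = f w" if "w \<in> words H \<xi>" for w
  proof -
    have "(\<lambda>i. norm (f w i * cnj (f w i))) summable_on UNIV"
      using has_sum_imp_summable[OF key[OF that that refl]]
      by (simp only: summable_on_iff_abs_summable_on_complex)
    then show ?thesis unfolding T_def
      by (intro Abs_ell2_inverse) (simp add: norm_mult power2_eq_square)
  qed
  have "free_product H \<xi> T"
  proof
    fix w w' assume w: "w \<in> words H \<xi>" "w' \<in> words H \<xi>"
    show "cinner (T w) (T w') =
        (if map fst w = map fst w' then \<Prod>k<length w. cinner (snd (w ! k)) (snd (w' ! k)) else 0)"
    proof (cases "map fst w = map fst w'")
      case True
      then show ?thesis using key[OF w] by (simp add: cinner_ell2_def ell2_cinner_def T w infsumI)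
    next
      case False
      then have z: "f w i * cnj (f w' i) = 0" for i by (auto simp: f_def split: prod.splits)
      then show ?thesis using False unfolding cinner_ell2_def ell2_cinner_def T[OF w(1)] T[OF w(2)] z by simp
    qed
  qed (use H \<xi> in auto)
  then show ?thesis by blast
qed

end

theory Submission
  imports Defs
begin

text \<open>
  Write \<open>V\<^sub>0 = level \<iota> (m - 1)\<close> and \<open>V\<^sub>1 = level (bar \<iota>) m\<close>, so that \<open>x\<^sub>\<iota>(m)\<close> lives on \<open>V\<^sub>0 \<oplus> V\<^sub>1\<close>, and put
  \<open>A = R\<^sub>\<iota>(m + 2)\<close>, \<open>B = R(m + 1)\<close> with lower index \<open>bar \<iota>\<close>, and \<open>Z = Z\<^sub>\<iota>(m)\<close>.  Then \<open>R\<^sub>\<iota>(m) = A Z = Z A\<close>, and \<open>A\<close>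
  and \<open>B\<close> act as the identity on \<open>V\<^sub>0\<close>, as do their square roots.  The operators to be compared are
  \<open>A (Z B)\<close> and \<open>(Z B) A\<close>, in the positive case \<open>(S Q) (Q Z S)\<close> and \<open>(Q Z S) (S Q)\<close> with
  \<open>S\<^sup>2 = B\<close> and \<open>Q\<^sup>2 = A\<close>; such pairs have equal moments in the state of \<open>\<zeta> \<in> V\<^sub>0\<close> because the factor that
  is moved fixes \<open>\<zeta>\<close>.

  For the orthogonality, all operators involved act on the leading tensor factors only, i.e. they
  commute with \<open>1 \<otimes> D\<close> for all \<open>D\<close> acting on the last \<open>m - 1\<close> factors, and polynomials \<open>b'\<close> in the
  second operator commute even with those acting on the last \<open>m\<close> factors.  Hence the compressions to \<open>V\<^sub>0\<close>, and
  that of \<open>b'\<close> to \<open>V\<^sub>1\<close>, are scalars, given by the states; moreover \<open>b'\<close> vanishes on \<open>V\<^sub>0\<close> and its range is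
  orthogonal to \<open>V\<^sub>0\<close>.
\<close>

subsection \<open>Bounded operators and closed subspaces\<close>

text \<open>\<open>T\<close> is known only through inner products of elementary tensors. Operators
  such as b (x) 1 and 1 (x) D therefore arise by extending a prescription on words, and
  well-definedness and boundedness both come from one norm estimate. \<open>proj\<close>,
  \<open>rep\<close> and \<open>sqrt_op\<close> are definite descriptions, which is why uniqueness
  accompanies each existence proof. As \<zeta> and \<zeta>' are arbitrary unit vectors of their
  levels, the compressions must be shown to be scalar, not just evaluated at one elementary tensor.
  With only two sides all words of a level have the same type, so a level is a single tensor product
  and the commutant of the matrix units on it is trivial. Commuting with them passes to square roots
  because the root is a strong limit of polynomials. That A Z = Z A and that A and B fix the vectors
  of the lower level are facts about word lengths: \<open>summand \<iota> j\<close> is spanned by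
  words of lengths j - 1 and j.\<close>

lemma bounded_ops_UNIV:
  "S \<in> bounded_ops UNIV \<longleftrightarrow> bounded_linear S \<and> (\<forall>c v. S (c *\<^sub>C v) = c *\<^sub>C S v)"
proof -
  \<comment> \<open>Only 0 is orthogonal to everything, so over \<open>UNIV\<close> both support
    conditions are void and \<open>bounded_ops UNIV\<close> is the class of all bounded
    complex-linear operators.\<close>
  have "v = 0" if "\<forall>q. cinner v q = 0" for v :: 'a
    using that[rule_format, of v] by (simp add: cinner_self)
  then show ?thesis
    unfolding bounded_ops_def using linear_0[OF bounded_linear.linear] by auto
qed

lemma bounded_opsD:
  assumes "S \<in> bounded_ops M"
  shows "bounded_linear S" "S (c *\<^sub>C v) = c *\<^sub>C S v" "S v \<in> M"
    "(\<And>q. q \<in> M \<Longrightarrow> cinner v q = 0) \<Longrightarrow> S v = 0" "S (u + v) = S u + S v" "S (u - v) = S u - S v"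
    "S 0 = 0" "S \<in> bounded_ops UNIV"
  using assms linear_add[OF bounded_linear.linear] linear_diff[OF bounded_linear.linear]
    linear_0[OF bounded_linear.linear]
  unfolding bounded_ops_UNIV by (auto simp: bounded_ops_def)

lemma bounded_ops_comp:
  assumes "S \<in> bounded_ops UNIV" "S' \<in> bounded_ops UNIV"
  shows "S \<circ> S' \<in> bounded_ops UNIV"
  using assms bounded_linear_compose unfolding bounded_ops_UNIV o_def by auto

lemma bounded_linear_scaleC: "bounded_linear (\<lambda>v::'a::complex_hilbert. c *\<^sub>C v)"
proof (rule bounded_linear_intro[where K = "cmod c"])
  show "c *\<^sub>C r *\<^sub>R v = r *\<^sub>R c *\<^sub>C v" for r and v :: 'a
    by (simp add: scaleR_scaleC scaleC_scaleC mult.commute)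
qed (simp_all add: scaleC_add_right norm_scaleC mult.commute)

lemma bounded_ops_linear_intros:
  shows "(\<lambda>v::'a::complex_hilbert. v) \<in> bounded_ops UNIV"
    "(\<lambda>v::'a. 0) \<in> bounded_ops UNIV"
    "S \<in> bounded_ops UNIV \<Longrightarrow> S' \<in> bounded_ops UNIV \<Longrightarrow> (\<lambda>v::'a. S v + S' v) \<in> bounded_ops UNIV"
    "S \<in> bounded_ops UNIV \<Longrightarrow> S' \<in> bounded_ops UNIV \<Longrightarrow> (\<lambda>v::'a. S v - S' v) \<in> bounded_ops UNIV"
    "S \<in> bounded_ops UNIV \<Longrightarrow> (\<lambda>v::'a. c *\<^sub>C S v) \<in> bounded_ops UNIV"
  unfolding bounded_ops_UNIV
  by (auto intro: bounded_linear_add bounded_linear_sub bounded_linear_compose[OF bounded_linear_scaleC]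
      simp: scaleC_add_right scaleC_diff_right scaleC_scaleC mult.commute)

lemma bounded_linear_cinner_left: "bounded_linear (\<lambda>v::'a::complex_hilbert. cinner v u)"
  by (rule bounded_linear_intro[where K = "norm u"])
     (auto simp: cinner_add_left cinner_scaleR_left scaleR_conv_of_real cmod_cinner_le)

lemma bounded_linear_cinner_right: "bounded_linear (\<lambda>v::'a::complex_hilbert. cinner u v)"
  by (rule bounded_linear_intro[where K = "norm u"])
     (auto simp: cinner_add_right cinner_scaleR_right scaleR_conv_of_real mult.commute[of "norm _" "norm u"] cmod_cinner_le)

lemma cinner_eq_zero_commute: "cinner x y = 0 \<longleftrightarrow> cinner y (x::'a::complex_hilbert) = 0"
  by (metis cinner_commute complex_cnj_zero)

lemma closed_csubspaceI:
  fixes M :: "'a::complex_hilbert set"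
  assumes "closed M" "0 \<in> M" "\<And>u v. u \<in> M \<Longrightarrow> v \<in> M \<Longrightarrow> u + v \<in> M" "\<And>c v. v \<in> M \<Longrightarrow> c *\<^sub>C v \<in> M"
  shows "closed_csubspace M"
  using assms by (simp add: closed_csubspace_def subspace_def scaleR_scaleC)

lemma closed_csubspaceD:
  assumes "closed_csubspace M"
  shows "closed M" "0 \<in> M" "u \<in> M \<Longrightarrow> v \<in> M \<Longrightarrow> u + v \<in> M" "v \<in> M \<Longrightarrow> c *\<^sub>C v \<in> M"
    "u \<in> M \<Longrightarrow> v \<in> M \<Longrightarrow> u - v \<in> M"
  using assms closed_csubspace_diff by (auto simp: closed_csubspace_def subspace_def)

lemma closed_csubspace_sum:
  assumes "closed_csubspace M" "\<And>i. i \<in> F \<Longrightarrow> f i \<in> M"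
  shows "sum f F \<in> M"
  using assms(2) by (induction F rule: infinite_finite_induct)
    (use closed_csubspaceD[OF assms(1)] in auto)

text \<open>The basis of all density arguments: an identity between bounded operators is checked on
  elementary tensors and spreads to their closed span.\<close>

lemma closed_csubspace_equalizer:
  assumes F: "F \<in> bounded_ops UNIV" and G: "G \<in> bounded_ops UNIV"
  shows "closed_csubspace {v. F v = G v}"
proof (rule closed_csubspaceI)
  show "closed {v. F v = G v}"
    using bounded_opsD(1)[OF F] bounded_opsD(1)[OF G]
    by (intro closed_Collect_eq linear_continuous_on)
qed (auto simp: bounded_opsD[OF F] bounded_opsD[OF G])

lemma closed_csubspace_vimage:
  assumes F: "F \<in> bounded_ops UNIV" and M: "closed_csubspace M"
  shows "closed_csubspace {v. F v \<in> M}"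
proof (rule closed_csubspaceI)
  have "closed (F -` M)"
    using closed_csubspaceD(1)[OF M] bounded_opsD(1)[OF F]
    by (intro closed_vimage linear_continuous_on) auto
  then show "closed {v. F v \<in> M}" by (simp add: vimage_def)
qed (auto simp: bounded_opsD[OF F] closed_csubspaceD[OF M])

lemma closed_csubspace_ortho:
  "closed_csubspace {v. \<forall>q\<in>S. cinner v q = 0}"
proof (rule closed_csubspaceI)
  have "{v. \<forall>q\<in>S. cinner v q = 0} = (\<Inter>q\<in>S. {v. cinner v q = 0})" by auto
  moreover have "closed {v. cinner v q = 0}" for q :: 'a
    by (intro closed_Collect_eq linear_continuous_on[OF bounded_linear_cinner_left] continuous_on_const)
  ultimately show "closed {v. \<forall>q\<in>S. cinner v q = 0}" by auto
qed (auto simp: cinner_add_left cinner_scaleC_left)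

lemma closed_cspan_induct:
  assumes "v \<in> closed_cspan S" "closed_csubspace {v. P v}" "\<And>s. s \<in> S \<Longrightarrow> P s"
  shows "P v"
  using hull_minimal[of S "{v. P v}" closed_csubspace] assms by auto

lemma closed_cspan_subset: "S \<subseteq> M \<Longrightarrow> closed_csubspace M \<Longrightarrow> closed_cspan S \<subseteq> M"
  by (rule hull_minimal)

text \<open>\<open>closed_csubspace_ortho\<close> handles the first argument of the inner product
  only; the spans are therefore treated one after the other, exchanging the arguments in
  between.\<close>

lemma closed_cspan_ortho:
  assumes "\<And>s s'. s \<in> S \<Longrightarrow> s' \<in> S' \<Longrightarrow> cinner s s' = 0" "u \<in> closed_cspan S" "v \<in> closed_cspan S'"
  shows "cinner u v = 0"
proof -
  have 1: "cinner v s = 0" if "s \<in> S" for s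
  proof -
    have "\<forall>q\<in>{s}. cinner v q = 0"
      by (rule closed_cspan_induct[OF assms(3) closed_csubspace_ortho])
         (use assms(1) that cinner_eq_zero_commute in auto)
    then show ?thesis by simp
  qed
  have "\<forall>q\<in>{v}. cinner u q = 0"
    by (rule closed_cspan_induct[OF assms(2) closed_csubspace_ortho])
       (use 1 cinner_eq_zero_commute in auto)
  then show ?thesis by simp
qed

subsection \<open>Orthogonal projections\<close>

lemma proj_unique:
  assumes "closed_csubspace M" "p \<in> M" "\<And>q. q \<in> M \<Longrightarrow> cinner (v - p) q = 0"
  shows "proj M v = p"
  unfolding proj_def
proof (rule the_equality)
  fix p' assume p': "p' \<in> M \<and> (\<forall>q\<in>M. cinner (v - p') q = 0)"
  have d: "p' - p \<in> M" using assms p' closed_csubspaceD(5) by blast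
  have "cinner (p' - p) (p' - p) = cinner (v - p) (p' - p) - cinner (v - p') (p' - p)"
    by (simp add: cinner_diff_left)
  also have "\<dots> = 0" using d p' assms(3) by simp
  finally show "p' = p" by (simp add: cinner_self)
qed (use assms in auto)

lemma
  assumes M: "closed_csubspace M"
  shows proj_in: "proj M v \<in> M" and proj_ortho: "q \<in> M \<Longrightarrow> cinner (v - proj M v) q = 0"
proof -
  obtain p where p: "p \<in> M" "\<And>q. q \<in> M \<Longrightarrow> cinner (v - p) q = 0"
    using projection_exists[OF M, of v] by blast
  have "proj M v = p" by (rule proj_unique[OF M p])
  then show "proj M v \<in> M" "q \<in> M \<Longrightarrow> cinner (v - proj M v) q = 0" using p by simp_all
qed

lemma proj_id: "closed_csubspace M \<Longrightarrow> v \<in> M \<Longrightarrow> proj M v = v"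
  by (rule proj_unique) auto

lemma proj_zero: "closed_csubspace M \<Longrightarrow> (\<And>q. q \<in> M \<Longrightarrow> cinner v q = 0) \<Longrightarrow> proj M v = 0"
  by (rule proj_unique) (auto simp: closed_csubspaceD)

lemma cinner_proj_left: "closed_csubspace M \<Longrightarrow> q \<in> M \<Longrightarrow> cinner (proj M v) q = cinner v q"
  using proj_ortho[of M q v] by (simp add: cinner_diff_left)

lemma cinner_proj: "closed_csubspace M \<Longrightarrow> cinner (proj M u) v = cinner u (proj M v)"
proof -
  assume M: "closed_csubspace M"
  have "cinner (proj M u) v = cnj (cinner v (proj M u))" by (rule cinner_commute)
  also have "\<dots> = cnj (cinner (proj M v) (proj M u))" by (simp only: cinner_proj_left[OF M proj_in[OF M]])
  also have "\<dots> = cinner (proj M u) (proj M v)" by (rule cinner_commute[symmetric])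
  also have "\<dots> = cinner u (proj M v)" by (rule cinner_proj_left[OF M proj_in[OF M]])
  finally show ?thesis .
qed

lemma norm_proj_Pythagoras:
  assumes "closed_csubspace M"
  shows "(norm v)\<^sup>2 = (norm (proj M v))\<^sup>2 + (norm (v - proj M v))\<^sup>2"
proof -
  have "cinner (v - proj M v) (proj M v) = 0"
    using proj_ortho[OF assms proj_in[OF assms]] .
  then have "inner (v - proj M v) (proj M v) = 0" by (simp add: inner_Re_cinner)
  then show ?thesis unfolding power2_norm_eq_inner
    by (simp add: inner_diff_left inner_diff_right inner_commute algebra_simps)
qed

lemma norm_proj_le: "closed_csubspace M \<Longrightarrow> norm (proj M v) \<le> norm v"
  using norm_proj_Pythagoras[of M v] by (simp add: power2_le_imp_le)

lemma proj_bounded_ops: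
  assumes M: "closed_csubspace M"
  shows "proj M \<in> bounded_ops M"
proof -
  have add: "proj M (u + v) = proj M u + proj M v" for u v
  proof (rule proj_unique[OF M])
    show "proj M u + proj M v \<in> M" by (intro closed_csubspaceD[OF M] proj_in[OF M])
    show "cinner (u + v - (proj M u + proj M v)) q = 0" if "q \<in> M" for q
      using proj_ortho[OF M that, of u] proj_ortho[OF M that, of v]
      by (simp add: cinner_diff_left cinner_add_left)
  qed
  have sc: "proj M (c *\<^sub>C v) = c *\<^sub>C proj M v" for c v
  proof (rule proj_unique[OF M])
    show "c *\<^sub>C proj M v \<in> M" by (intro closed_csubspaceD[OF M] proj_in[OF M])
    show "cinner (c *\<^sub>C v - c *\<^sub>C proj M v) q = 0" if "q \<in> M" for q
      using proj_ortho[OF M that, of v] by (simp add: cinner_diff_left cinner_scaleC_left)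
  qed
  have "bounded_linear (proj M)"
    by (rule bounded_linear_intro[where K = 1])
       (auto simp: add sc scaleR_scaleC norm_proj_le[OF M])
  then show ?thesis
    using sc proj_in[OF M] proj_zero[OF M] by (auto simp: bounded_ops_def)
qed

lemma proj_proj_subset:
  assumes "closed_csubspace M" "closed_csubspace N" "M \<subseteq> N"
  shows "proj M (proj N v) = proj M v" "proj N (proj M v) = proj M v"
proof -
  show "proj M (proj N v) = proj M v"
  proof (rule proj_unique[OF assms(1)])
    fix q assume q: "q \<in> M"
    then show "cinner (proj N v - proj M v) q = 0"
      using cinner_proj_left[OF assms(1) q, of v] cinner_proj_left[OF assms(2), of q v] assms(3)
      by (auto simp: cinner_diff_left)
  qed (rule proj_in[OF assms(1)])
  show "proj N (proj M v) = proj M v"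
    using proj_in[OF assms(1)] assms(3) by (intro proj_id[OF assms(2)]) auto
qed

lemma bounded_ops_proj_right:
  assumes S: "S \<in> bounded_ops M" and M: "closed_csubspace M"
  shows "S (proj M v) = S v"
proof -
  have "S (v - proj M v) = 0" by (rule bounded_opsD(4)[OF S]) (rule proj_ortho[OF M])
  then show ?thesis by (simp add: bounded_opsD(6)[OF S])
qed

subsection \<open>Extension of densely defined bounded operators\<close>

text \<open>The vectors \<open>f p\<close> may be linearly dependent, so the operator is built from
  its graph: \<open>G0\<close> is the linear relation of finite combinations, \<open>G\<close> its
  closure. The bound makes \<open>G\<close> single-valued, and completeness makes its domain closed,
  hence all of the closed span.\<close>

lemma bounded_operator_extension:
  fixes f g :: "'p \<Rightarrow> 'h::complex_hilbert"
  assumes bound: "\<And>F c. finite F \<Longrightarrow> F \<subseteq> I \<Longrightarrow>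
      norm (\<Sum>p\<in>F. c p *\<^sub>C g p) \<le> K * norm (\<Sum>p\<in>F. c p *\<^sub>C f p)"
    and g: "\<And>p. p \<in> I \<Longrightarrow> g p \<in> closed_cspan (f ` I)"
  obtains L where "L \<in> bounded_ops (closed_cspan (f ` I))" "\<And>p. p \<in> I \<Longrightarrow> L (f p) = g p"
proof -
  define M where "M = closed_cspan (f ` I)"
  have M: "closed_csubspace M" by (simp add: M_def closed_csubspace_closed_cspan)
  define G0 where "G0 = {(x, y). \<exists>F c. finite F \<and> F \<subseteq> I \<and>
    x = (\<Sum>p\<in>F. c p *\<^sub>C f p) \<and> y = (\<Sum>p\<in>F. c p *\<^sub>C g p)}"
  define G where "G = closure G0"
  have G0_I: "(x, y) \<in> G0"
    if "finite F" "F \<subseteq> I" "x = (\<Sum>p\<in>F. c p *\<^sub>C f p)" "y = (\<Sum>p\<in>F. c p *\<^sub>C g p)" for x y F c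
    using that unfolding G0_def by auto
  have G0_add: "(x + x', y + y') \<in> G0" if xy: "(x, y) \<in> G0" "(x', y') \<in> G0" for x y x' y'
  proof -
    obtain F c where F1: "finite F" "F \<subseteq> I" "x = (\<Sum>p\<in>F. c p *\<^sub>C f p)" "y = (\<Sum>p\<in>F. c p *\<^sub>C g p)"
      using xy(1) unfolding G0_def by auto
    obtain F' c' where F2: "finite F'" "F' \<subseteq> I" "x' = (\<Sum>p\<in>F'. c' p *\<^sub>C f p)" "y' = (\<Sum>p\<in>F'. c' p *\<^sub>C g p)"
      using xy(2) unfolding G0_def by auto
    note F = F1 F2
    define d where "d p = (if p \<in> F then c p else 0) + (if p \<in> F' then c' p else 0)" for p
    have *: "(\<Sum>p\<in>F. c p *\<^sub>C k p) + (\<Sum>p\<in>F'. c' p *\<^sub>C k p) = (\<Sum>p\<in>F \<union> F'. d p *\<^sub>C k p)" for k :: "'p \<Rightarrow> 'h"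
    proof -
      have "(\<Sum>p\<in>F. c p *\<^sub>C k p) = (\<Sum>p\<in>F \<union> F'. (if p \<in> F then c p else 0) *\<^sub>C k p)"
        using F(1,2,5,6) by (intro sum.mono_neutral_cong_left) auto
      moreover have "(\<Sum>p\<in>F'. c' p *\<^sub>C k p) = (\<Sum>p\<in>F \<union> F'. (if p \<in> F' then c' p else 0) *\<^sub>C k p)"
        using F(1,2,5,6) by (intro sum.mono_neutral_cong_left) auto
      ultimately show ?thesis by (simp add: d_def scaleC_add_left sum.distrib)
    qed
    show ?thesis
    proof (rule G0_I[of "F \<union> F'" _ d])
      show "finite (F \<union> F')" "F \<union> F' \<subseteq> I" using F(1,2,5,6) by auto
      show "x + x' = (\<Sum>p\<in>F \<union> F'. d p *\<^sub>C f p)" unfolding F(3,7) by (rule *)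
      show "y + y' = (\<Sum>p\<in>F \<union> F'. d p *\<^sub>C g p)" unfolding F(4,8) by (rule *)
    qed
  qed
  have G0_scale: "(a *\<^sub>C x, a *\<^sub>C y) \<in> G0" if xy: "(x, y) \<in> G0" for a x y
  proof -
    obtain F c where F: "finite F" "F \<subseteq> I" "x = (\<Sum>p\<in>F. c p *\<^sub>C f p)" "y = (\<Sum>p\<in>F. c p *\<^sub>C g p)"
      using xy unfolding G0_def by auto
    have "a *\<^sub>C (\<Sum>p\<in>F. c p *\<^sub>C k p) = (\<Sum>p\<in>F. (a * c p) *\<^sub>C k p)" for k :: "'p \<Rightarrow> 'h"
      by (simp add: linear_sum[OF bounded_linear.linear[OF bounded_linear_scaleC]] scaleC_scaleC)
    then show ?thesis unfolding F(3,4) by (intro G0_I[OF F(1,2)])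
  qed
  have G_seq: "\<exists>s t. (\<forall>n. (s n, t n) \<in> G0) \<and> s \<longlonglongrightarrow> x \<and> t \<longlonglongrightarrow> y" if xy: "(x, y) \<in> G" for x y
  proof -
    obtain z where z: "\<And>n. z n \<in> G0" "z \<longlonglongrightarrow> (x, y)"
      using xy unfolding G_def closure_sequential by blast
    then show ?thesis using tendsto_fst[OF z(2)] tendsto_snd[OF z(2)]
      by (intro exI[of _ "\<lambda>n. fst (z n)"] exI[of _ "\<lambda>n. snd (z n)"]) auto
  qed
  have G_I: "(x, y) \<in> G" if "\<And>n. (s n, t n) \<in> G0" "s \<longlonglongrightarrow> x" "t \<longlonglongrightarrow> y" for s t x y
    unfolding G_def closure_sequential
    by (rule exI[of _ "\<lambda>n. (s n, t n)"]) (use that in \<open>auto intro: tendsto_Pair\<close>)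
  have G_add: "(x + x', y + y') \<in> G" if xy: "(x, y) \<in> G" "(x', y') \<in> G" for x y x' y'
  proof -
    obtain s t s' t' where "\<forall>n. (s n, t n) \<in> G0" "s \<longlonglongrightarrow> x" "t \<longlonglongrightarrow> y"
      "\<forall>n. (s' n, t' n) \<in> G0" "s' \<longlonglongrightarrow> x'" "t' \<longlonglongrightarrow> y'"
      using G_seq[OF xy(1)] G_seq[OF xy(2)] by blast
    then show ?thesis
      by (intro G_I[of "\<lambda>n. s n + s' n" "\<lambda>n. t n + t' n"]) (auto intro: G0_add tendsto_add)
  qed
  have G_scale: "(a *\<^sub>C x, a *\<^sub>C y) \<in> G" if xy: "(x, y) \<in> G" for a x y
  proof -
    obtain s t where "\<forall>n. (s n, t n) \<in> G0" "s \<longlonglongrightarrow> x" "t \<longlonglongrightarrow> y"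
      using G_seq[OF xy] by blast
    then show ?thesis
      by (intro G_I[of "\<lambda>n. a *\<^sub>C s n" "\<lambda>n. a *\<^sub>C t n"])
         (auto intro: G0_scale bounded_linear.tendsto[OF bounded_linear_scaleC])
  qed
  have G_bound: "norm y \<le> K * norm x" if xy: "(x, y) \<in> G" for x y
  proof -
    obtain s t where st: "\<forall>n. (s n, t n) \<in> G0" "s \<longlonglongrightarrow> x" "t \<longlonglongrightarrow> y"
      using G_seq[OF xy] by blast
    have "norm (t n) \<le> K * norm (s n)" for n
      using st(1)[rule_format, of n] bound by (auto simp: G0_def)
    then show ?thesis
      by (intro LIMSEQ_le[of "\<lambda>n. norm (t n)" _ "\<lambda>n. K * norm (s n)"])
         (auto intro!: tendsto_intros st)
  qed
  have G_diff: "(x - x', y - y') \<in> G" if xy: "(x, y) \<in> G" "(x', y') \<in> G" for x y x' y'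
    using G_add[OF xy(1) G_scale[OF xy(2), of "-1"]]
    by (simp add: scaleR_scaleC[of "-1", symmetric, simplified])
  \<comment> \<open>The difference of the two pairs has first component 0, where the bound forces
    the second component to be 0.\<close>
  have G_unique: "y = y'" if "(x, y) \<in> G" "(x, y') \<in> G" for x y y'
    using G_bound[OF G_diff[OF that]] by simp
  have G_I0: "(f p, g p) \<in> G" if "p \<in> I" for p
  proof -
    have "(f p, g p) \<in> G0" by (rule G0_I[of "{p}" _ "\<lambda>_. 1"]) (use that in auto)
    then show ?thesis unfolding G_def using closure_subset by blast
  qed
  have ex: "\<exists>y. (x, y) \<in> G" if "x \<in> M" for x
    using that unfolding M_def
  proof (rule closed_cspan_induct)
    show "closed_csubspace {x. \<exists>y. (x, y) \<in> G}"
    proof (rule closed_csubspaceI)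
      have "(0, 0) \<in> G0" by (rule G0_I[of "{}"]) auto
      then show "0 \<in> {x. \<exists>y. (x, y) \<in> G}" unfolding G_def using closure_subset by blast
      show "closed {x. \<exists>y. (x, y) \<in> G}"
        unfolding closed_sequential_limits
      proof (intro allI impI; elim conjE)
        fix s l assume s: "\<forall>n. s n \<in> {x. \<exists>y. (x, y) \<in> G}" "s \<longlonglongrightarrow> l"
        then have "\<forall>n. \<exists>y. (s n, y) \<in> G" by simp
        then obtain t where t: "\<And>n. (s n, t n) \<in> G" by metis
        have "Cauchy t"
        proof (rule metric_CauchyI)
          fix e :: real assume e: "e > 0"
          \<comment> \<open>The sign of \<open>K\<close> is unknown here; \<bar>K\<bar> + 1 is a
            positive substitute.\<close>
          have pos: "e / (\<bar>K\<bar> + 1) > 0" using e by (simp add: add_nonneg_pos)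
          obtain N where N: "\<forall>m\<ge>N. \<forall>n\<ge>N. dist (s m) (s n) < e / (\<bar>K\<bar> + 1)"
            using metric_CauchyD[OF LIMSEQ_imp_Cauchy[OF s(2)] pos] by blast
          have "dist (t m) (t n) < e" if "m \<ge> N" "n \<ge> N" for m n
          proof -
            have "norm (t m - t n) \<le> K * norm (s m - s n)" by (rule G_bound[OF G_diff[OF t t]])
            also have "\<dots> \<le> (\<bar>K\<bar> + 1) * norm (s m - s n)" by (intro mult_right_mono) auto
            also have "\<dots> < e" using N that by (simp add: dist_norm pos_less_divide_eq mult.commute)
            finally show ?thesis by (simp add: dist_norm)
          qed
          then show "\<exists>N. \<forall>m\<ge>N. \<forall>n\<ge>N. dist (t m) (t n) < e" by blast
        qed
        then obtain y where y: "t \<longlonglongrightarrow> y" using Cauchy_convergent_iff convergent_def by blast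
        have "(l, y) \<in> closure G"
          unfolding closure_sequential using t s(2) y
          by (intro exI[of _ "\<lambda>n. (s n, t n)"]) (auto intro: tendsto_Pair)
        then show "l \<in> {x. \<exists>y. (x, y) \<in> G}" by (auto simp: G_def)
      qed
    qed (use G_add G_scale in blast)+
  qed (use G_I0 in blast)
  \<comment> \<open>Going through \<open>proj M\<close> extends the operator by 0 on the orthogonal
    complement, as membership in \<open>bounded_ops M\<close> demands.\<close>
  define L where "L v = (THE y. (proj M v, y) \<in> G)" for v
  have L: "(proj M v, L v) \<in> G" for v
    unfolding L_def using theI'[of "\<lambda>y. (proj M v, y) \<in> G"] ex[OF proj_in[OF M]] G_unique by blast
  have Leq: "L v = y" if "(proj M v, y) \<in> G" for v y using G_unique[OF L that] .
  note pM = bounded_opsD[OF proj_bounded_ops[OF M]]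
  have G_M: "y \<in> M" if xy: "(x, y) \<in> G" for x y
  proof -
    obtain s t where st: "\<forall>n. (s n, t n) \<in> G0" "t \<longlonglongrightarrow> y"
      using G_seq[OF xy] by blast
    have "t n \<in> M" for n
    proof -
      obtain F c where F: "F \<subseteq> I" "t n = (\<Sum>p\<in>F. c p *\<^sub>C g p)"
        using st(1)[rule_format, of n] unfolding G0_def by auto
      show ?thesis unfolding F(2)
        using F(1) g by (intro closed_csubspace_sum[OF M] closed_csubspaceD(4)[OF M]) (auto simp: M_def)
    qed
    then show ?thesis using closed_csubspaceD(1)[OF M] st(2) closed_sequentially by blast
  qed
  have add: "L (u + v) = L u + L v" for u v
    by (rule Leq) (simp add: pM(5) G_add[OF L L])
  have sc: "L (c *\<^sub>C v) = c *\<^sub>C L v" for c v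
    by (rule Leq) (simp add: pM(2) G_scale[OF L])
  have "norm (L v) \<le> norm v * \<bar>K\<bar>" for v
  proof -
    have "norm (L v) \<le> K * norm (proj M v)" by (rule G_bound[OF L])
    also have "\<dots> \<le> \<bar>K\<bar> * norm v" using norm_proj_le[OF M] by (intro mult_mono) auto
    finally show ?thesis by (simp add: mult.commute)
  qed
  then have "bounded_linear L"
    by (intro bounded_linear_intro[where K = "\<bar>K\<bar>"]) (auto simp: add sc scaleR_scaleC)
  moreover have "L v = 0" if "\<forall>q\<in>M. cinner v q = 0" for v
  proof -
    have "proj M v = 0" using that by (intro proj_zero[OF M]) auto
    then have "norm (L v) \<le> 0" using G_bound[OF L, of v] by simp
    then show ?thesis by simp
  qed
  ultimately have "L \<in> bounded_ops M" using sc G_M[OF L] by (auto simp: bounded_ops_def)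
  moreover have "L (f p) = g p" if p: "p \<in> I" for p
  proof -
    have "f p \<in> M" unfolding M_def using p by (intro hull_inc) auto
    then show ?thesis using G_I0[OF p] by (intro Leq) (simp add: proj_id[OF M])
  qed
  ultimately show thesis using that unfolding M_def by blast
qed

lemma has_sum_sum_finite:
  fixes f :: "'i \<Rightarrow> 'b \<Rightarrow> 'c::topological_comm_monoid_add"
  assumes "finite F" "\<And>i. i \<in> F \<Longrightarrow> (f i has_sum s i) B"
  shows "((\<lambda>b. \<Sum>i\<in>F. f i b) has_sum (\<Sum>i\<in>F. s i)) B"
  using assms by (induction F) (auto intro: has_sum_add)

text \<open>Each squared norm is a quadratic form whose coefficients are the rank one matrix cinner
  (x p) b * cinner b (x q); by Parseval these matrices add up to the Gram matrix of
  \<open>x\<close>. This is the decomposition behind the Schur product theorem.\<close>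

lemma has_sum_cinner_quadratic:
  fixes x :: "'p \<Rightarrow> 'b::complex_hilbert" and y :: "'p \<Rightarrow> 'c::complex_hilbert"
  assumes B: "orthonormal B" and x: "\<And>p. p \<in> F \<Longrightarrow> x p \<in> closed_cspan B" and F: "finite F"
  shows "((\<lambda>b. (norm (\<Sum>p\<in>F. cinner (x p) b *\<^sub>C y p))\<^sup>2) has_sum
    Re (\<Sum>p\<in>F. \<Sum>q\<in>F. cinner (x p) (x q) * cinner (y p) (y q))) B"
proof -
  have "((\<lambda>b. \<Sum>p\<in>F. \<Sum>q\<in>F. (cinner (x p) b * cinner b (x q)) * cinner (y p) (y q)) has_sum
      (\<Sum>p\<in>F. \<Sum>q\<in>F. cinner (x p) (x q) * cinner (y p) (y q))) B"
    by (intro has_sum_sum_finite[OF F] has_sum_cmult_left parseval B x)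
  then have "((\<lambda>b. Re (\<Sum>p\<in>F. \<Sum>q\<in>F. (cinner (x p) b * cinner b (x q)) * cinner (y p) (y q))) has_sum
      Re (\<Sum>p\<in>F. \<Sum>q\<in>F. cinner (x p) (x q) * cinner (y p) (y q))) B"
    by (rule has_sum_Re)
  moreover have "Re (\<Sum>p\<in>F. \<Sum>q\<in>F. (cinner (x p) b * cinner b (x q)) * cinner (y p) (y q)) =
      (norm (\<Sum>p\<in>F. cinner (x p) b *\<^sub>C y p))\<^sup>2" for b
  proof -
    let ?s = "\<Sum>p\<in>F. cinner (x p) b *\<^sub>C y p"
    have r: "cinner v ?s = (\<Sum>q\<in>F. cinner b (x q) * cinner v (y q))" for v
      using F by (induction F) (simp_all add: cinner_add_right cinner_scaleC_right cinner_commute[of b])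
    have "of_real ((norm ?s)\<^sup>2) = cinner ?s ?s" by (simp add: cinner_self)
    also have "\<dots> = (\<Sum>p\<in>F. cinner (x p) b * cinner (y p) ?s)"
      by (simp only: cinner_sum_left[of "\<lambda>p. cinner (x p) b *\<^sub>C y p" F ?s] cinner_scaleC_left)
    also have "\<dots> = (\<Sum>p\<in>F. \<Sum>q\<in>F. (cinner (x p) b * cinner b (x q)) * cinner (y p) (y q))"
      unfolding r by (simp add: sum_distrib_left mult.assoc)
    finally show ?thesis by (metis Re_complex_of_real)
  qed
  ultimately show ?thesis by simp
qed

text \<open>The operator \<open>1 \<otimes> D\<close>, where \<open>f p\<close> plays the role of \<open>x p \<otimes> y p\<close>.  Boundedness is the Schur product
  theorem: expanding \<open>cinner (x p) (x q)\<close> in an orthonormal basis reduces it to the bound for \<open>D\<close>.\<close>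

lemma tensor_operator:
  fixes f g :: "'p \<Rightarrow> 'h::complex_hilbert" and x :: "'p \<Rightarrow> 'b::complex_hilbert"
    and y :: "'p \<Rightarrow> 'c::complex_hilbert"
  assumes D: "D \<in> bounded_ops UNIV"
    and f: "\<And>p q. p \<in> I \<Longrightarrow> q \<in> I \<Longrightarrow> cinner (f p) (f q) = cinner (x p) (x q) * cinner (y p) (y q)"
    and g: "\<And>p q. p \<in> I \<Longrightarrow> q \<in> I \<Longrightarrow> cinner (g p) (g q) = cinner (x p) (x q) * cinner (D (y p)) (D (y q))"
    and g_in: "\<And>p. p \<in> I \<Longrightarrow> g p \<in> closed_cspan (f ` I)"
  shows "\<exists>L\<in>bounded_ops (closed_cspan (f ` I)). \<forall>p\<in>I. L (f p) = g p"
proof -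
  obtain K where K: "\<And>v. norm (D v) \<le> K * norm v" "K \<ge> 0"
    using bounded_linear.nonneg_bounded[OF bounded_opsD(1)[OF D]] by (metis mult.commute)
  show ?thesis
  proof (rule bounded_operator_extension[of I g K f, OF _ g_in])
    show ?thesis if "L \<in> bounded_ops (closed_cspan (f ` I))" "\<And>p. p \<in> I \<Longrightarrow> L (f p) = g p" for L
      using that by blast
    fix F and c :: "'p \<Rightarrow> complex" assume F: "finite F" "F \<subseteq> I"
    \<comment> \<open>Only finitely many \<open>x p\<close> occur, and it suffices that
      \<open>B\<close> spans these, as Parseval is applied to them alone.\<close>
    obtain B where B: "orthonormal B" "closed_cspan B = closed_cspan (x ` F)"
      by (rule orthonormal_basis_exists[OF closed_csubspace_closed_cspan])
    have norm_k: "(norm (\<Sum>p\<in>F. c p *\<^sub>C k p))\<^sup>2 =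
        Re (\<Sum>p\<in>F. \<Sum>q\<in>F. cinner (x p) (x q) * cinner (c p *\<^sub>C z p) (c q *\<^sub>C z q))"
      if k: "\<And>p q. p \<in> F \<Longrightarrow> q \<in> F \<Longrightarrow> cinner (k p) (k q) = cinner (x p) (x q) * cinner (z p) (z q)"
      for k :: "'p \<Rightarrow> 'h" and z :: "'p \<Rightarrow> 'c"
    proof -
      have r: "cinner v (\<Sum>p\<in>F. c p *\<^sub>C k p) = (\<Sum>q\<in>F. cnj (c q) * cinner v (k q))" for v
        using F(1) by (induction F) (simp_all add: cinner_add_right cinner_scaleC_right)
      have "of_real ((norm (\<Sum>p\<in>F. c p *\<^sub>C k p))\<^sup>2) = (\<Sum>p\<in>F. c p * cinner (k p) (\<Sum>p\<in>F. c p *\<^sub>C k p))"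
        by (simp only: cinner_self[symmetric] cinner_sum_left[of "\<lambda>p. c p *\<^sub>C k p"] cinner_scaleC_left)
      also have "\<dots> = (\<Sum>p\<in>F. \<Sum>q\<in>F. cinner (x p) (x q) * cinner (c p *\<^sub>C z p) (c q *\<^sub>C z q))"
        unfolding r sum_distrib_left cinner_scaleC_left cinner_scaleC_right
        by (intro sum.cong refl) (simp add: k mult_ac)
      finally show ?thesis by (metis Re_complex_of_real)
    qed
    have g': "(norm (\<Sum>p\<in>F. c p *\<^sub>C g p))\<^sup>2 =
        Re (\<Sum>p\<in>F. \<Sum>q\<in>F. cinner (x p) (x q) * cinner (c p *\<^sub>C D (y p)) (c q *\<^sub>C D (y q)))"
      by (rule norm_k, rule g) (use F(2) in blast)+
    have f': "(norm (\<Sum>p\<in>F. c p *\<^sub>C f p))\<^sup>2 =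
        Re (\<Sum>p\<in>F. \<Sum>q\<in>F. cinner (x p) (x q) * cinner (c p *\<^sub>C y p) (c q *\<^sub>C y q))"
      by (rule norm_k, rule f) (use F(2) in blast)+
    have in_B: "x p \<in> closed_cspan B" if "p \<in> F" for p
      unfolding B(2) using that by (intro hull_inc) auto
    have "(norm (\<Sum>p\<in>F. c p *\<^sub>C g p))\<^sup>2 \<le> K\<^sup>2 * (norm (\<Sum>p\<in>F. c p *\<^sub>C f p))\<^sup>2"
    proof (rule has_sum_mono)
      show "((\<lambda>b. (norm (\<Sum>p\<in>F. cinner (x p) b *\<^sub>C c p *\<^sub>C D (y p)))\<^sup>2) has_sum
          (norm (\<Sum>p\<in>F. c p *\<^sub>C g p))\<^sup>2) B"
        unfolding g' by (rule has_sum_cinner_quadratic[OF B(1) in_B F(1)])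
      show "((\<lambda>b. K\<^sup>2 * (norm (\<Sum>p\<in>F. cinner (x p) b *\<^sub>C c p *\<^sub>C y p))\<^sup>2) has_sum
          K\<^sup>2 * (norm (\<Sum>p\<in>F. c p *\<^sub>C f p))\<^sup>2) B"
        unfolding f' by (rule has_sum_cmult_right[OF has_sum_cinner_quadratic[OF B(1) in_B F(1)]])
      \<comment> \<open>For fixed \<open>b\<close> the two terms are the squares of norm (D v) and K
        * norm v for one and the same vector v, so the operator bound for \<open>D\<close> compares
        them.\<close>
      fix b
      have "(\<Sum>p\<in>F. cinner (x p) b *\<^sub>C c p *\<^sub>C D (y p)) = D (\<Sum>p\<in>F. cinner (x p) b *\<^sub>C c p *\<^sub>C y p)"
        by (simp add: linear_sum[OF bounded_linear.linear[OF bounded_opsD(1)[OF D]]] bounded_opsD(2)[OF D])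
      then have "norm (\<Sum>p\<in>F. cinner (x p) b *\<^sub>C c p *\<^sub>C D (y p))
          \<le> K * norm (\<Sum>p\<in>F. cinner (x p) b *\<^sub>C c p *\<^sub>C y p)"
        using K(1) by metis
      then show "(norm (\<Sum>p\<in>F. cinner (x p) b *\<^sub>C c p *\<^sub>C D (y p)))\<^sup>2
          \<le> K\<^sup>2 * (norm (\<Sum>p\<in>F. cinner (x p) b *\<^sub>C c p *\<^sub>C y p))\<^sup>2"
        unfolding power_mult_distrib[symmetric] by (rule power_mono) (rule norm_ge_zero)
    qed
    then show "norm (\<Sum>p\<in>F. c p *\<^sub>C g p) \<le> K * norm (\<Sum>p\<in>F. c p *\<^sub>C f p)"
      unfolding power_mult_distrib[symmetric] by (rule power2_le_imp_le) (use K(2) in simp)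
  qed
qed

subsection \<open>Positive operators and their square roots\<close>

definition self_adjoint :: "('a::complex_hilbert \<Rightarrow> 'a) \<Rightarrow> bool" where
  "self_adjoint S \<longleftrightarrow> (\<forall>u v. cinner (S u) v = cinner u (S v))"

lemma positive_op_UNIV:
  "positive_op M S \<Longrightarrow> positive_op UNIV S"
  unfolding positive_op_def using bounded_opsD(8) by blast

lemma positive_op_Re:
  assumes "positive_op M S"
  shows "0 \<le> Re (cinner (S v) v)" "cinner (S v) v = of_real (Re (cinner (S v) v))"
  using assms by (auto simp: positive_op_def complex_nonneg_Reals_iff complex_eq_iff)

text \<open>Polarisation: reality of the form at u + v compares the imaginary parts of cinner (S u)
  v and cinner (S v) u, reality at u + \<i> v their real parts.\<close>

lemma positive_op_self_adjoint:
  assumes S: "positive_op M S"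
  shows "self_adjoint S"
proof -
  have S': "S \<in> bounded_ops M" using S by (simp add: positive_op_def)
  have im: "Im (cinner (S v) v) = 0" for v
    using positive_op_Re(2)[OF S, of v] by (metis Im_complex_of_real)
  have "cinner (S u) v = cinner u (S v)" for u v
  proof -
    have "Im (cinner (S u) v + cinner (S v) u) = 0"
      using im[of "u + v"] im[of u] im[of v]
      by (simp add: bounded_opsD(5)[OF S'] cinner_add_left cinner_add_right)
    moreover have "Im (- \<i> * cinner (S u) v + \<i> * cinner (S v) u) = 0"
      using im[of "u + \<i> *\<^sub>C v"] im[of u] im[of v]
      by (simp add: bounded_opsD(2,5)[OF S'] cinner_add_left cinner_add_right
          cinner_scaleC_left cinner_scaleC_right)
    ultimately have "cinner (S u) v = cnj (cinner (S v) u)"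
      by (simp add: complex_eq_iff)
    then show ?thesis using cinner_commute[of u "S v"] by simp
  qed
  then show ?thesis by (simp add: self_adjoint_def)
qed

text \<open>The form is evaluated at u - t z v with z = cinner (S u) v; the factor z makes the cross
  terms real, leaving a real quadratic in t, which is optimal at t = 1 / b.\<close>

lemma positive_op_Cauchy_Schwarz:
  assumes S: "positive_op M S"
  shows "(cmod (cinner (S u) v))\<^sup>2 \<le> Re (cinner (S u) u) * Re (cinner (S v) v)"
proof -
  have S': "S \<in> bounded_ops M" using S by (simp add: positive_op_def)
  have sa: "cinner (S x) y = cinner x (S y)" for x y
    using positive_op_self_adjoint[OF S] by (simp add: self_adjoint_def)
  define z where "z = cinner (S u) v"
  define a where "a = Re (cinner (S u) u)"
  define b where "b = Re (cinner (S v) v)"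
  have quad: "0 \<le> a - 2 * t * (cmod z)\<^sup>2 + t\<^sup>2 * (cmod z)\<^sup>2 * b" for t :: real
  proof -
    let ?c = "- of_real t * z"
    have vu: "cinner (S v) u = cnj z"
      unfolding z_def using sa[of v u] cinner_commute[of v "S u"] by simp
    have zz: "z * cnj z = of_real ((cmod z)\<^sup>2)" by (simp only: complex_norm_square)
    have "cinner (S (u + ?c *\<^sub>C v)) (u + ?c *\<^sub>C v) =
       cinner (S u) u + cnj ?c * z + ?c * cnj z + ?c * cnj ?c * cinner (S v) v"
      by (simp add: bounded_opsD(2,5)[OF S'] cinner_add_left cinner_add_right
          cinner_scaleC_left cinner_scaleC_right vu z_def algebra_simps)
    also have "\<dots> = of_real a - of_real (2 * t) * (z * cnj z) + of_real (t\<^sup>2) * (z * cnj z) * of_real b"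
      unfolding a_def b_def positive_op_Re(2)[OF S, symmetric] by (simp add: algebra_simps power2_eq_square)
    also have "\<dots> = of_real (a - 2 * t * (cmod z)\<^sup>2 + t\<^sup>2 * (cmod z)\<^sup>2 * b)"
      unfolding zz by simp
    finally show ?thesis using positive_op_Re(1)[OF S, of "u + ?c *\<^sub>C v"] by (metis Re_complex_of_real)
  qed
  have a: "0 \<le> a" "0 \<le> b" unfolding a_def b_def by (rule positive_op_Re[OF S])+
  show ?thesis
  proof (cases "b = 0")
    case True
    have "cmod z = 0"
    proof (rule ccontr)
      assume "cmod z \<noteq> 0"
      then have p: "(cmod z)\<^sup>2 > 0" by simp
      \<comment> \<open>For b = 0 the quadratic is affine in t, and this t gives it the value
        -1.\<close>
      have "0 \<le> a - 2 * ((a + 1) / (2 * (cmod z)\<^sup>2)) * (cmod z)\<^sup>2"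
        using quad[of "(a + 1) / (2 * (cmod z)\<^sup>2)"] True by simp
      also have "\<dots> = -1" using p by (simp add: field_simps)
      finally show False by simp
    qed
    then show ?thesis using a by (simp add: z_def[symmetric] a_def[symmetric] b_def[symmetric])
  next
    case False
    then have b: "b > 0" using a by simp
    have "0 \<le> a - 2 * (1 / b) * (cmod z)\<^sup>2 + (1 / b)\<^sup>2 * (cmod z)\<^sup>2 * b" by (rule quad)
    also have "\<dots> = a - (cmod z)\<^sup>2 / b" using b by (simp add: power2_eq_square field_simps)
    finally have "(cmod z)\<^sup>2 \<le> a * b" using b by (simp add: field_simps)
    then show ?thesis by (simp add: z_def a_def b_def)
  qed
qed

lemma positive_op_eq_zero:
  assumes S: "positive_op M S" and v: "cinner (S v) v = 0"
  shows "S v = 0"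
proof -
  have "(cmod (cinner (S v) (S v)))\<^sup>2 \<le> 0"
    using positive_op_Cauchy_Schwarz[OF S, of v "S v"] v by simp
  then show ?thesis by (simp add: cinner_self)
qed

text \<open>For y = S v - S' v the commutation gives S y + S' y = S (S v) - S' (S' v) = 0. Both
  forms are nonnegative, so both vanish at y, whence S y = S' y = 0 and cinner y y = cinner v (S y -
  S' y) = 0.\<close>

lemma positive_op_root_unique:
  assumes S: "positive_op UNIV S" and S': "positive_op UNIV S'"
    and sq: "S \<circ> S = S' \<circ> S'" and comm: "S \<circ> S' = S' \<circ> S"
  shows "S = S'"
proof
  fix v
  have bS: "S \<in> bounded_ops UNIV" "S' \<in> bounded_ops UNIV" using S S' by (auto simp: positive_op_def)
  define y where "y = S v - S' v"
  have "S y + S' y = 0"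
    using fun_cong[OF sq, of v] fun_cong[OF comm, of v]
    by (simp add: y_def bounded_opsD(6)[OF bS(1)] bounded_opsD(6)[OF bS(2)])
  then have z: "cinner (S y) y + cinner (S' y) y = 0"
    by (metis cinner_add_left cinner_zero_left)
  then have "Re (cinner (S y) y) + Re (cinner (S' y) y) = 0" by (metis plus_complex.sel(1) zero_complex.sel(1))
  then have "Re (cinner (S y) y) = 0" "Re (cinner (S' y) y) = 0"
    using positive_op_Re(1)[OF S, of y] positive_op_Re(1)[OF S', of y] by linarith+
  then have "cinner (S y) y = 0" "cinner (S' y) y = 0"
    using positive_op_Re(2)[OF S, of y] positive_op_Re(2)[OF S', of y] by simp_all
  then have Sy: "S y = 0" "S' y = 0" using positive_op_eq_zero S S' by blast+
  have "cinner y y = cinner v (S y) - cinner v (S' y)"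
    using positive_op_self_adjoint[OF S] positive_op_self_adjoint[OF S']
    by (simp add: y_def cinner_diff_left self_adjoint_def)
  then have "y = 0" by (simp add: Sy cinner_self)
  then show "S v = S' v" by (simp add: y_def)
qed

text \<open>\<open>poly_majorant B F r\<close>: the operator \<open>F\<close> is a polynomial in \<open>B\<close> with nonnegative
  coefficients whose value at \<open>1\<close> is \<open>r\<close>.\<close>

inductive poly_majorant :: "('a::complex_hilbert \<Rightarrow> 'a) \<Rightarrow> ('a \<Rightarrow> 'a) \<Rightarrow> real \<Rightarrow> bool" for B where
  zero: "poly_majorant B (\<lambda>v. 0) 0"
| base: "poly_majorant B B 1"
| add: "poly_majorant B F r \<Longrightarrow> poly_majorant B G s \<Longrightarrow> poly_majorant B (\<lambda>v. F v + G v) (r + s)"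
| comp: "poly_majorant B F r \<Longrightarrow> poly_majorant B G s \<Longrightarrow> poly_majorant B (F \<circ> G) (r * s)"
| scale: "poly_majorant B F r \<Longrightarrow> 0 \<le> t \<Longrightarrow> poly_majorant B (\<lambda>v. of_real t *\<^sub>C F v) (t * r)"

lemma poly_majorant_bounded_ops:
  "poly_majorant B F r \<Longrightarrow> B \<in> bounded_ops UNIV \<Longrightarrow> F \<in> bounded_ops UNIV"
  by (induction rule: poly_majorant.induct) (auto intro: bounded_ops_linear_intros bounded_ops_comp)

lemma poly_majorant_nonneg: "poly_majorant B F r \<Longrightarrow> 0 \<le> r"
  by (induction rule: poly_majorant.induct) auto

lemma poly_majorant_norm:
  assumes "poly_majorant B F r" and B: "\<And>v. norm (B v) \<le> norm v"
  shows "norm (F v) \<le> r * norm v"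
  using assms(1)
proof (induction arbitrary: v rule: poly_majorant.induct)
  case (add F r G s)
  show ?case using norm_triangle_ineq[of "F v" "G v"] add.IH(1)[of v] add.IH(2)[of v]
    by (simp add: algebra_simps)
next
  case (comp F r G s)
  have "norm (F (G v)) \<le> r * norm (G v)" by (rule comp.IH)
  also have "\<dots> \<le> r * (s * norm v)"
    using poly_majorant_nonneg[OF comp.hyps(1)] by (intro mult_left_mono comp.IH)
  finally show ?case by simp
next
  case (scale F r t)
  then show ?case using mult_left_mono[OF scale.IH[of v] scale.hyps(2)] by (simp add: norm_scaleC mult_ac)
qed (auto simp: B)

lemma poly_majorant_commute:
  assumes "poly_majorant B F r" and C: "C \<in> bounded_ops UNIV" "\<And>v. C (B v) = B (C v)"
  shows "C (F v) = F (C v)"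
  using assms(1)
  by (induction arbitrary: v rule: poly_majorant.induct) (simp_all add: bounded_opsD(2,5,7)[OF C(1)] C(2))

text \<open>A product of self-adjoint operators is self-adjoint once they commute, and polynomials
  in the same \<open>B\<close> do.\<close>

lemma poly_majorant_self_adjoint:
  assumes "poly_majorant B F r" and B: "B \<in> bounded_ops UNIV" "self_adjoint B"
  shows "self_adjoint F"
  using assms(1)
proof (induction rule: poly_majorant.induct)
  case (comp F r G s)
  have c: "G (F v) = F (G v)" for v
  proof (rule poly_majorant_commute[OF comp.hyps(1)])
    show "G \<in> bounded_ops UNIV" by (rule poly_majorant_bounded_ops[OF comp.hyps(2) B(1)])
    show "G (B v) = B (G v)" for v
      using poly_majorant_commute[OF comp.hyps(2) B(1), of v] by simp
  qed
  show ?case using comp.IH c by (simp add: self_adjoint_def)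
qed (use B in \<open>simp_all add: self_adjoint_def cinner_add_left cinner_add_right cinner_scaleC_left cinner_scaleC_right\<close>)

text \<open>The iteration \<open>Y\<^bsub>n+1\<^esub> = (B + Y\<^sub>n\<^sup>2) / 2\<close> converges to \<open>1 - sqrt (1 - B)\<close>: the increments are
  polynomials in \<open>B\<close> with nonnegative coefficients, so their norms are dominated by their
  values at \<open>1\<close>, which telescope.\<close>

lemma contraction_sqrt_exists:
  fixes B :: "'a::complex_hilbert \<Rightarrow> 'a"
  assumes B: "B \<in> bounded_ops UNIV" and B1: "\<And>v. norm (B v) \<le> norm v" and sa: "self_adjoint B"
  shows "\<exists>S. positive_op UNIV S \<and> (\<forall>v. S (S v) = v - B v) \<and>
    (\<forall>C\<in>bounded_ops UNIV. (\<forall>v. C (B v) = B (C v)) \<longrightarrow> (\<forall>v. C (S v) = S (C v)))"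
proof -
  define Y where "Y = rec_nat (\<lambda>v. 0) (\<lambda>n F v. of_real (1/2) *\<^sub>C (B v + F (F v)))"
  \<comment> \<open>The same iteration with the number 1 in place of \<open>B\<close>; it records
    the coefficient sums of \<open>Y\<close>.\<close>
  define y :: "nat \<Rightarrow> real" where "y = rec_nat 0 (\<lambda>n r. (1/2) * (1 + r * r))"
  have Y: "Y 0 = (\<lambda>v. 0)" "\<And>n v. Y (Suc n) v = of_real (1/2) *\<^sub>C (B v + Y n (Y n v))" by (auto simp: Y_def)
  have y: "y 0 = 0" "\<And>n. y (Suc n) = (1/2) * (1 + y n * y n)" by (auto simp: y_def)
  have maj: "poly_majorant B (Y n) (y n)" for n
  proof (induction n)
    case (Suc n)
    have "poly_majorant B (\<lambda>v. of_real (1/2) *\<^sub>C (B v + (Y n \<circ> Y n) v)) ((1/2) * (1 + y n * y n))"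
      by (intro poly_majorant.intros Suc.IH) auto
    then show ?case unfolding y using Y(2)[of n] by (metis (no_types, lifting) comp_apply ext)
  qed (simp add: Y y poly_majorant.zero)
  note bY = poly_majorant_bounded_ops[OF maj B]
  have comm: "Y m (Y n v) = Y n (Y m v)" for m n v
    by (rule poly_majorant_commute[OF maj bY]) (use poly_majorant_commute[OF maj B] in simp)
  have inc: "poly_majorant B (\<lambda>v. Y (Suc n) v - Y n v) (y (Suc n) - y n)" for n
  proof (induction n)
    case 0
    have "poly_majorant B (\<lambda>v. of_real (1/2) *\<^sub>C B v) ((1/2) * 1)" by (intro poly_majorant.intros) auto
    then show ?case using Y(2)[of 0] by (simp add: Y(1) y)
  next
    case (Suc n)
    let ?D = "\<lambda>v. Y (Suc n) v - Y n v"
    \<comment> \<open>Twice the next increment is a difference of squares. Factoring it, which uses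
      that the iterates commute, exhibits nonnegative coefficients; expanding it would not.\<close>
    have "poly_majorant B (\<lambda>v. of_real (1/2) *\<^sub>C (?D \<circ> (\<lambda>v. Y (Suc n) v + Y n v)) v)
        ((1/2) * ((y (Suc n) - y n) * (y (Suc n) + y n)))"
      by (intro poly_majorant.intros Suc.IH maj) auto
    moreover have "of_real (1/2) *\<^sub>C (?D \<circ> (\<lambda>v. Y (Suc n) v + Y n v)) v = Y (Suc (Suc n)) v - Y (Suc n) v" for v
    proof -
      have "Y (Suc (Suc n)) v - Y (Suc n) v = of_real (1/2) *\<^sub>C (Y (Suc n) (Y (Suc n) v) - Y n (Y n v))"
        unfolding Y(2)[of "Suc n"] Y(2)[of n v] scaleC_diff_right[symmetric] by simp
      also have "Y (Suc n) (Y (Suc n) v) - Y n (Y n v) = (?D \<circ> (\<lambda>v. Y (Suc n) v + Y n v)) v"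
        using comm[of "Suc n" n v] by (simp add: bounded_opsD(5)[OF bY])
      finally show ?thesis by simp
    qed
    moreover have "(1/2) * ((y (Suc n) - y n) * (y (Suc n) + y n)) = y (Suc (Suc n)) - y (Suc n)"
      unfolding y(2)[of "Suc n"] y(2)[of n] by (simp add: algebra_simps)
    ultimately show ?case by (simp only:)
  qed
  have y1: "y n \<le> 1" for n
  proof (induction n)
    case (Suc n)
    have "y n * y n \<le> 1" using Suc poly_majorant_nonneg[OF maj] by (simp add: mult_le_one)
    then show ?case by (simp add: y)
  qed (simp add: y)
  have ysum: "summable (\<lambda>n. y (Suc n) - y n)"
  proof (rule summableI_nonneg_bounded)
    show "0 \<le> y (Suc n) - y n" for n using poly_majorant_nonneg[OF inc] .
    show "(\<Sum>i<n. y (Suc i) - y i) \<le> 1" for n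
      unfolding sum_lessThan_telescope using y1[of n] by (simp add: y(1))
  qed
  define L where "L v = lim (\<lambda>n. Y n v)" for v
  have L: "(\<lambda>n. Y n v) \<longlonglongrightarrow> L v" for v
  proof -
    have "summable (\<lambda>n. Y (Suc n) v - Y n v)"
    proof (rule summable_comparison_test[OF _ summable_mult2[OF ysum, of "norm v"]], intro exI allI impI)
      show "norm (Y (Suc n) v - Y n v) \<le> (y (Suc n) - y n) * norm v" for n
        by (rule poly_majorant_norm[OF inc B1])
    qed
    then have "convergent (\<lambda>n. \<Sum>i<n. Y (Suc i) v - Y i v)" by (simp add: summable_iff_convergent)
    moreover have "(\<Sum>i<n. Y (Suc i) v - Y i v) = Y n v" for n
      using sum_lessThan_telescope[of "\<lambda>i. Y i v" n] unfolding Y(1) by simp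
    ultimately have "convergent (\<lambda>n. Y n v)" by simp
    then show ?thesis unfolding L_def by (simp add: convergent_LIMSEQ_iff)
  qed
  have Yn: "norm (Y n v) \<le> norm v" for n v
    using poly_majorant_norm[OF maj B1, of n v] mult_right_mono[OF y1[of n], of "norm v"] by simp
  have Ln: "norm (L v) \<le> norm v" for v
    by (rule LIMSEQ_le_const2[OF tendsto_norm[OF L]]) (use Yn in auto)
  have Ladd: "L (u + v) = L u + L v" for u v
    by (rule LIMSEQ_unique[OF L]) (simp add: bounded_opsD(5)[OF bY] tendsto_add[OF L L])
  have Lsc: "L (c *\<^sub>C v) = c *\<^sub>C L v" for c v
    by (rule LIMSEQ_unique[OF L])
       (simp add: bounded_opsD(2)[OF bY] bounded_linear.tendsto[OF bounded_linear_scaleC L])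
  have bL: "L \<in> bounded_ops UNIV"
    unfolding bounded_ops_UNIV using Lsc Ladd Ln
    by (auto intro!: bounded_linear_intro[where K = 1] simp: scaleR_scaleC)
  have LL: "(\<lambda>n. Y n (Y n v)) \<longlonglongrightarrow> L (L v)" for v
  proof (rule Lim_transform)
    show "(\<lambda>n. Y n (L v)) \<longlonglongrightarrow> L (L v)" by (rule L)
    have 0: "(\<lambda>n. norm (Y n v - L v)) \<longlonglongrightarrow> 0" using L[of v] tendsto_norm_zero LIM_zero by blast
    \<comment> \<open>Each \<open>Y n\<close> is a contraction, so replacing the inner
      \<open>Y n v\<close> by its limit costs at most the error of the inner one.\<close>
    have "norm (Y n (Y n v) - Y n (L v)) \<le> norm (Y n v - L v)" for n
      using Yn[of n "Y n v - L v"] by (simp add: bounded_opsD(6)[OF bY] norm_minus_commute)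
    then show "(\<lambda>n. Y n (Y n v) - Y n (L v)) \<longlonglongrightarrow> 0"
      by (intro Lim_null_comparison[OF _ 0]) auto
  qed
  have fixpt: "L v = of_real (1/2) *\<^sub>C (B v + L (L v))" for v
  proof (rule LIMSEQ_unique)
    show "(\<lambda>n. Y (Suc n) v) \<longlonglongrightarrow> L v" using LIMSEQ_Suc[OF L] .
    show "(\<lambda>n. Y (Suc n) v) \<longlonglongrightarrow> of_real (1/2) *\<^sub>C (B v + L (L v))"
      unfolding Y by (intro bounded_linear.tendsto[OF bounded_linear_scaleC] tendsto_add tendsto_const LL)
  qed
  have saL: "cinner (L u) v = cinner u (L v)" for u v
  proof (rule LIMSEQ_unique)
    show "(\<lambda>n. cinner (Y n u) v) \<longlonglongrightarrow> cinner (L u) v"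
      by (rule bounded_linear.tendsto[OF bounded_linear_cinner_left L])
    have "cinner (Y n u) v = cinner u (Y n v)" for n
      using poly_majorant_self_adjoint[OF maj B sa] by (simp add: self_adjoint_def)
    then show "(\<lambda>n. cinner (Y n u) v) \<longlonglongrightarrow> cinner u (L v)"
      by (simp add: bounded_linear.tendsto[OF bounded_linear_cinner_right L])
  qed
  define S where "S v = v - L v" for v
  have bS: "S \<in> bounded_ops UNIV"
    using bounded_ops_linear_intros(4)[OF bounded_ops_linear_intros(1) bL] by (simp add: S_def[abs_def])
  have "cinner (S v) v \<in> \<real>\<^sub>\<ge>\<^sub>0" for v
  proof -
    have "Im (cinner (L v) v) = 0"
      using saL[of v v] cinner_commute[of v "L v"] by (simp add: complex_eq_iff)
    moreover have "Re (cinner (L v) v) \<le> (norm v)\<^sup>2"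
    proof -
      have "Re (cinner (L v) v) \<le> norm (L v) * norm v"
        using complex_Re_le_cmod cmod_cinner_le order_trans by blast
      also have "\<dots> \<le> norm v * norm v" by (intro mult_right_mono Ln) simp
      finally show ?thesis by (simp add: power2_eq_square)
    qed
    ultimately show ?thesis
      by (simp add: S_def cinner_diff_left cinner_self complex_nonneg_Reals_iff)
  qed
  then have pos: "positive_op UNIV S" using bS by (simp add: positive_op_def)
  have sq: "S (S v) = v - B v" for v
  proof -
    \<comment> \<open>The fixed point equation reads 2 L = B + L L, hence (1 - L)(1 - L) = 1 - 2 L +
      L L = 1 - B.\<close>
    have "of_real 2 *\<^sub>C L v = B v + L (L v)"
      by (subst fixpt) (simp add: scaleC_scaleC)
    then have "L v + L v = B v + L (L v)" using scaleC_add_left[of 1 1 "L v"] by simp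
    then show ?thesis by (simp add: S_def bounded_opsD(6)[OF bL] algebra_simps)
  qed
  have "C (S v) = S (C v)" if C: "C \<in> bounded_ops UNIV" "\<And>v. C (B v) = B (C v)" for C v
  proof -
    have "C (L v) = L (C v)"
    proof (rule LIMSEQ_unique)
      show "(\<lambda>n. C (Y n v)) \<longlonglongrightarrow> C (L v)" by (rule bounded_linear.tendsto[OF bounded_opsD(1)[OF C(1)] L])
      show "(\<lambda>n. C (Y n v)) \<longlonglongrightarrow> L (C v)" using poly_majorant_commute[OF maj C] L by simp
    qed
    then show ?thesis by (simp add: S_def bounded_opsD(6)[OF C(1)])
  qed
  then show ?thesis using pos sq by (intro exI[of _ S]) simp
qed


text \<open>Rescaling: B = 1 - A / K is a self-adjoint contraction, and sqrt K times the root of 1 -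
  B is a root of \<open>A\<close>. It then remains to see that this root lives on
  \<open>M\<close>.\<close>

lemma positive_root_exists:
  assumes M: "closed_csubspace M" and A: "positive_op M A"
  shows "\<exists>S. positive_op M S \<and> S \<circ> S = A \<and>
    (\<forall>C\<in>bounded_ops UNIV. (\<forall>v. C (A v) = A (C v)) \<longrightarrow> (\<forall>v. C (S v) = S (C v)))"
proof -
  have bA: "A \<in> bounded_ops M" using A by (simp add: positive_op_def)
  obtain K where K: "\<And>v. norm (A v) \<le> norm v * K" "K > 0"
    using bounded_linear.pos_bounded[OF bounded_opsD(1)[OF bA]] by blast
  \<comment> \<open>This is A A \<le> K A in quadratic form, from Cauchy-Schwarz for the form of
    \<open>A\<close> at \<open>v\<close> and \<open>A v\<close>; it makes \<open>B\<close> a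
    contraction.\<close>
  have AK: "(norm (A v))\<^sup>2 \<le> K * Re (cinner (A v) v)" for v
  proof (cases "A v = 0")
    case False
    have "((norm (A v))\<^sup>2)\<^sup>2 \<le> Re (cinner (A v) v) * Re (cinner (A (A v)) (A v))"
      using positive_op_Cauchy_Schwarz[OF A, of v "A v"] by (simp add: cinner_self norm_power)
    also have "\<dots> \<le> Re (cinner (A v) v) * (K * (norm (A v))\<^sup>2)"
    proof (rule mult_left_mono)
      have "Re (cinner (A (A v)) (A v)) \<le> norm (A (A v)) * norm (A v)"
        using complex_Re_le_cmod cmod_cinner_le order_trans by blast
      also have "\<dots> \<le> (norm (A v) * K) * norm (A v)" by (intro mult_right_mono K) simp
      finally show "Re (cinner (A (A v)) (A v)) \<le> K * (norm (A v))\<^sup>2"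
        by (simp add: power2_eq_square mult_ac)
    qed (rule positive_op_Re[OF A])
    finally have "(norm (A v))\<^sup>2 * (norm (A v))\<^sup>2 \<le> (K * Re (cinner (A v) v)) * (norm (A v))\<^sup>2"
      by (simp add: power2_eq_square mult_ac)
    then show ?thesis by (rule mult_right_le_imp_le) (use False in simp)
  qed simp
  define B where "B v = v - of_real (1 / K) *\<^sub>C A v" for v
  have bB: "B \<in> bounded_ops UNIV"
    unfolding B_def[abs_def] by (intro bounded_ops_linear_intros bounded_opsD(8)[OF bA])
  have sA: "cinner (A u) v = cinner u (A v)" for u v
    using positive_op_self_adjoint[OF A] by (simp add: self_adjoint_def)
  have sB: "self_adjoint B"
    by (simp add: self_adjoint_def B_def cinner_diff_left cinner_diff_right cinner_scaleC_left
        cinner_scaleC_right sA)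
  have B1: "norm (B v) \<le> norm v" for v
  proof (rule power2_le_imp_le)
    have "(norm (B v))\<^sup>2 = (norm v)\<^sup>2 - 2 / K * Re (cinner (A v) v) + (norm (A v))\<^sup>2 / K\<^sup>2"
    proof -
      have "cinner (B v) (B v) = of_real ((norm v)\<^sup>2) - of_real (2 / K) * of_real (Re (cinner (A v) v))
          + of_real ((norm (A v))\<^sup>2 / K\<^sup>2)"
        unfolding positive_op_Re(2)[OF A, symmetric]
        using sA[of v v, symmetric]
        by (simp add: B_def cinner_diff_left cinner_diff_right cinner_scaleC_left
            cinner_scaleC_right cinner_self[of v] cinner_self[of "A v"] power2_eq_square diff_divide_distrib)
      then have "of_real ((norm (B v))\<^sup>2) = (of_real ((norm v)\<^sup>2 - 2 / K * Re (cinner (A v) v)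
          + (norm (A v))\<^sup>2 / K\<^sup>2) :: complex)"
        unfolding cinner_self by simp
      then show ?thesis by (simp only: of_real_eq_iff)
    qed
    also have "(norm (A v))\<^sup>2 / K\<^sup>2 \<le> 1 / K * Re (cinner (A v) v)"
      using AK[of v] K(2) by (simp add: field_simps power2_eq_square)
    then have "(norm v)\<^sup>2 - 2 / K * Re (cinner (A v) v) + (norm (A v))\<^sup>2 / K\<^sup>2 \<le>
        (norm v)\<^sup>2 - 1 / K * Re (cinner (A v) v)" by (simp add: field_simps)
    also have "\<dots> \<le> (norm v)\<^sup>2" using positive_op_Re(1)[OF A, of v] K(2) by simp
    finally show "(norm (B v))\<^sup>2 \<le> (norm v)\<^sup>2" .
  qed simp
  obtain S0 where S0: "positive_op UNIV S0" "\<And>v. S0 (S0 v) = v - B v"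
    "\<And>C v. C \<in> bounded_ops UNIV \<Longrightarrow> (\<And>v. C (B v) = B (C v)) \<Longrightarrow> C (S0 v) = S0 (C v)"
    using contraction_sqrt_exists[OF bB B1 sB] by (elim exE conjE) simp
  have bS0: "S0 \<in> bounded_ops UNIV" using S0(1) by (simp add: positive_op_def)
  define S where "S v = of_real (sqrt K) *\<^sub>C S0 v" for v
  have bS: "S \<in> bounded_ops UNIV"
    unfolding S_def[abs_def] by (intro bounded_ops_linear_intros bS0)
  have "cinner (S v) v = of_real (sqrt K * Re (cinner (S0 v) v))" for v
    unfolding S_def cinner_scaleC_left by (subst positive_op_Re(2)[OF S0(1)]) simp
  then have pS: "positive_op UNIV S"
    using bS positive_op_Re(1)[OF S0(1)] K(2) by (simp add: positive_op_def complex_nonneg_Reals_iff)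
  have sq: "S (S v) = A v" for v
  proof -
    have "S (S v) = of_real (sqrt K) *\<^sub>C of_real (sqrt K) *\<^sub>C (v - B v)"
      by (simp add: S_def bounded_opsD(2)[OF bS0] S0(2))
    also have "\<dots> = of_real (sqrt K * sqrt K) *\<^sub>C (v - B v)" by (simp only: scaleC_scaleC of_real_mult)
    also have "\<dots> = A v" using K(2) by (simp add: B_def scaleC_scaleC)
    finally show ?thesis .
  qed
  have comm: "C (S v) = S (C v)" if C: "C \<in> bounded_ops UNIV" "\<And>v. C (A v) = A (C v)" for C v
  proof -
    have "C (B v) = B (C v)" for v by (simp add: B_def bounded_opsD(2,6)[OF C(1)] C(2))
    then show ?thesis using S0(3)[OF C(1)] by (simp add: S_def bounded_opsD(2)[OF C(1)])
  qed
  \<comment> \<open>The squared norm of \<open>S v\<close> is cinner (A v) v, so \<open>S\<close>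
    vanishes wherever \<open>A\<close> does.\<close>
  have kill: "S v = 0" if "\<And>q. q \<in> M \<Longrightarrow> cinner v q = 0" for v
  proof -
    have "cinner (S v) (S v) = cinner (A v) v"
      using positive_op_self_adjoint[OF pS] by (simp add: self_adjoint_def sq[symmetric])
    then show ?thesis using bounded_opsD(4)[OF bA that] by (simp add: cinner_self)
  qed
  \<comment> \<open>\<open>proj M\<close> commutes with \<open>A\<close>, hence with
    \<open>S\<close>; as \<open>S\<close> kills the orthogonal complement, its range lies in
    \<open>M\<close>.\<close>
  have "S v \<in> M" for v
  proof -
    have "proj M (S v) = S (proj M v)"
      using proj_id[OF M bounded_opsD(3)[OF bA]] bounded_ops_proj_right[OF bA M]
      by (intro comm bounded_opsD(8)[OF proj_bounded_ops[OF M]]) simp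
    also have "\<dots> = S v"
      using kill[of "v - proj M v"] proj_ortho[OF M] by (simp add: bounded_opsD(6)[OF bS])
    finally show ?thesis using proj_in[OF M] by metis
  qed
  then have "S \<in> bounded_ops M"
    using bS kill unfolding bounded_ops_def by blast
  then have "positive_op M S" using pS by (simp add: positive_op_def)
  moreover have "S \<circ> S = A" using sq by (simp add: fun_eq_iff)
  ultimately show ?thesis using comm by (intro exI[of _ S]) simp
qed

text \<open>To evaluate the definite description, a competing root S' is compared with the
  constructed one: S' commutes with A = S' S', hence with S, and commuting positive roots
  coincide.\<close>

lemma
  assumes M: "closed_csubspace M" and A: "positive_op M A"
  shows positive_sqrt_op: "positive_op M (sqrt_op M A)"
    and sqrt_op_square: "sqrt_op M A (sqrt_op M A v) = A v"
    and sqrt_op_commute: "C \<in> bounded_ops UNIV \<Longrightarrow> (\<And>v. C (A v) = A (C v)) \<Longrightarrow>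
      C (sqrt_op M A v) = sqrt_op M A (C v)"
proof -
  obtain S where S: "positive_op M S" "S \<circ> S = A"
    "\<And>C v. C \<in> bounded_ops UNIV \<Longrightarrow> (\<And>v. C (A v) = A (C v)) \<Longrightarrow> C (S v) = S (C v)"
    using positive_root_exists[OF M A] by blast
  have "sqrt_op M A = S"
    unfolding sqrt_op_def
  proof (rule the_equality)
    fix S' assume S': "positive_op M S' \<and> S' \<circ> S' = A"
    then have b: "S' \<in> bounded_ops UNIV" using bounded_opsD(8) by (auto simp: positive_op_def)
    have "S' (S v) = S (S' v)" for v
    proof (rule S(3)[OF b])
      have "A = S' \<circ> S'" using S' by simp
      then show "S' (A v) = A (S' v)" for v by simp
    qed
    then have comm: "S' \<circ> S = S \<circ> S'" by (simp add: fun_eq_iff)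
    show "S' = S"
    proof (rule positive_op_root_unique[OF _ _ _ comm])
      show "positive_op UNIV S'" "positive_op UNIV S" using S(1) S' positive_op_UNIV by blast+
      show "S' \<circ> S' = S \<circ> S" using S(2) S' by simp
    qed
  qed (simp add: S(1,2))
  note eq = this
  show "positive_op M (sqrt_op M A)" unfolding eq by (rule S(1))
  show "sqrt_op M A (sqrt_op M A v) = A v" unfolding eq using fun_cong[OF S(2), of v] by simp
  show "C (sqrt_op M A v) = sqrt_op M A (C v)" if "C \<in> bounded_ops UNIV" "\<And>v. C (A v) = A (C v)"
    unfolding eq by (rule S(3)[OF that])
qed

text \<open>The vector w = S v - v satisfies S w = S (S v) - S v = v - S v = - w, and a positive
  operator has no eigenvalue -1.\<close>

lemma sqrt_op_fixed:
  assumes M: "closed_csubspace M" and A: "positive_op M A" and v: "A v = v"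
  shows "sqrt_op M A v = v"
proof -
  let ?S = "sqrt_op M A"
  have S: "positive_op M ?S" by (rule positive_sqrt_op[OF M A])
  then have bS: "?S \<in> bounded_ops M" by (simp add: positive_op_def)
  define w where "w = ?S v - v"
  have "?S w = - w"
    using sqrt_op_square[OF M A, of v] v by (simp add: w_def bounded_opsD(6)[OF bS])
  then have "cinner (?S w) w = - of_real ((norm w)\<^sup>2)" by (simp add: cinner_minus_left cinner_self)
  then have "(norm w)\<^sup>2 \<le> 0" using positive_op_Re(1)[OF S, of w] by simp
  then show ?thesis by (simp add: w_def)
qed

subsection \<open>Sums of operators on orthogonal blocks\<close>

lemma norm_sum_orthogonal:
  fixes f :: "'i \<Rightarrow> 'a::complex_hilbert"
  assumes "finite F" "\<And>i j. i \<in> F \<Longrightarrow> j \<in> F \<Longrightarrow> i \<noteq> j \<Longrightarrow> cinner (f i) (f j) = 0"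
  shows "(norm (sum f F))\<^sup>2 = (\<Sum>i\<in>F. (norm (f i))\<^sup>2)"
  using assms
proof (induction F)
  case (insert i F)
  have "cinner (sum f F) (f i) = 0"
    unfolding cinner_sum_left using insert by (intro sum.neutral) auto
  then have "inner (sum f F) (f i) = 0" by (simp add: inner_Re_cinner)
  then have "(norm (sum f (insert i F)))\<^sup>2 = (norm (f i))\<^sup>2 + (norm (sum f F))\<^sup>2"
    unfolding power2_norm_eq_inner sum.insert[OF insert.hyps]
    by (simp add: inner_add_left inner_add_right inner_commute)
  then show ?case using insert by simp
qed simp

text \<open>Orthogonal series converge without converging absolutely. By Pythagoras, a partial sum
  over a difference of index sets is controlled by the squares, so the net of finite partial sums is
  Cauchy.\<close>

lemma summable_on_orthogonal:
  fixes f :: "'i \<Rightarrow> 'a::complex_hilbert"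
  assumes orth: "\<And>i j. i \<in> A \<Longrightarrow> j \<in> A \<Longrightarrow> i \<noteq> j \<Longrightarrow> cinner (f i) (f j) = 0"
    and sq: "(\<lambda>i. (norm (f i))\<^sup>2) summable_on A"
  shows "f summable_on A"
proof -
  define b where "b = (\<lambda>i. (norm (f i))\<^sup>2)"
  define L where "L = infsum b A"
  have L: "(sum b \<longlongrightarrow> L) (finite_subsets_at_top A)"
    using has_sum_infsum[OF sq] by (simp add: b_def L_def has_sum_def)
  have "\<exists>P. eventually P (finite_subsets_at_top A) \<and>
      (\<forall>F F'. P F \<and> P F' \<longrightarrow> dist (sum f F) (sum f F') < e)" if e: "e > 0" for e
  proof -
    \<comment> \<open>Two deviations below this threshold add up to less than the square of e / 2,
      that is, to norm less than e / 2 for the vectors.\<close>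
    have "\<forall>\<^sub>F F in finite_subsets_at_top A. dist (sum b F) L < (e / 2)\<^sup>2 / 2"
      by (rule tendstoD[OF L]) (use e in simp)
    then obtain F0 where F0: "finite F0" "F0 \<subseteq> A"
      "\<And>F. finite F \<Longrightarrow> F0 \<subseteq> F \<Longrightarrow> F \<subseteq> A \<Longrightarrow> dist (sum b F) L < (e / 2)\<^sup>2 / 2"
      unfolding eventually_finite_subsets_at_top by metis
    have near: "dist (sum f F) (sum f F0) < e / 2" if F: "finite F" "F0 \<subseteq> F" "F \<subseteq> A" for F
    proof -
      have "dist (sum b F) (sum b F0) < (e / 2)\<^sup>2"
        using F0(3)[OF F] F0(3)[OF F0(1) order_refl F0(2)] dist_triangle2[of "sum b F" "sum b F0" L] by linarith
      then have "sum b (F - F0) < (e / 2)\<^sup>2"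
        using sum_diff[OF F(1,2), of b] by (simp add: dist_norm)
      moreover have "(norm (sum f (F - F0)))\<^sup>2 = sum b (F - F0)"
        unfolding b_def using F by (intro norm_sum_orthogonal orth) auto
      ultimately have "(norm (sum f (F - F0)))\<^sup>2 < (e / 2)\<^sup>2" by simp
      then have "norm (sum f (F - F0)) < e / 2"
        by (rule power_less_imp_less_base) (use e in simp)
      then show ?thesis using sum_diff[OF F(1,2), of f] by (simp add: dist_norm)
    qed
    show ?thesis
    proof (intro exI[of _ "\<lambda>F. finite F \<and> F0 \<subseteq> F \<and> F \<subseteq> A"] conjI allI impI)
      show "\<forall>\<^sub>F F in finite_subsets_at_top A. finite F \<and> F0 \<subseteq> F \<and> F \<subseteq> A"
        unfolding eventually_finite_subsets_at_top by (intro exI[of _ F0]) (use F0(1,2) in simp)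
      fix F F' assume "(finite F \<and> F0 \<subseteq> F \<and> F \<subseteq> A) \<and> finite F' \<and> F0 \<subseteq> F' \<and> F' \<subseteq> A"
      then show "dist (sum f F) (sum f F') < e"
        using near[of F] near[of F'] dist_triangle2[of "sum f F" "sum f F'" "sum f F0"] by linarith
    qed
  qed
  then have "cauchy_filter (filtermap (sum f) (finite_subsets_at_top A))"
    by (simp add: cauchy_filter_metric_filtermap)
  moreover have "complete (UNIV::'a set)"
    by (meson Cauchy_convergent UNIV_I complete_def convergent_def)
  ultimately obtain L' where "(sum f \<longlongrightarrow> L') (finite_subsets_at_top A)"
    using complete_uniform[where S = UNIV] by (force simp add: filterlim_def)
  then show ?thesis using summable_on_def has_sum_def by blast
qed

text \<open>The setting of the infinite sum in \<open>R_op\<close>: operators on mutually orthogonal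
  subspaces with one common bound \<open>K\<close>, whose sum converges strongly and is again
  bounded.\<close>

locale orthogonal_blocks =
  fixes M :: "'i \<Rightarrow> 'a::complex_hilbert set" and I :: "'i set" and x :: "'i \<Rightarrow> 'a \<Rightarrow> 'a" and K :: real
  assumes M: "\<And>i. i \<in> I \<Longrightarrow> closed_csubspace (M i)"
    and orth: "\<And>i j u v. i \<in> I \<Longrightarrow> j \<in> I \<Longrightarrow> i \<noteq> j \<Longrightarrow> u \<in> M i \<Longrightarrow> v \<in> M j \<Longrightarrow> cinner u v = 0"
    and x: "\<And>i. i \<in> I \<Longrightarrow> x i \<in> bounded_ops (M i)"
    and K: "\<And>i v. i \<in> I \<Longrightarrow> norm (x i v) \<le> K * norm v" "K \<ge> 0"
begin

lemma Bessel:
  assumes F: "finite F" "F \<subseteq> I"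
  shows "(\<Sum>i\<in>F. (norm (proj (M i) v))\<^sup>2) \<le> (norm v)\<^sup>2"
proof -
  define p where "p = (\<Sum>i\<in>F. proj (M i) v)"
  have pp: "(norm p)\<^sup>2 = (\<Sum>i\<in>F. (norm (proj (M i) v))\<^sup>2)"
    unfolding p_def
  proof (rule norm_sum_orthogonal[OF F(1)])
    fix i j assume ij: "i \<in> F" "j \<in> F" "i \<noteq> j"
    then have "i \<in> I" "j \<in> I" using F by auto
    then show "cinner (proj (M i) v) (proj (M j) v) = 0"
      using orth[OF _ _ ij(3)] proj_in M by blast
  qed
  have "cinner p v = (\<Sum>i\<in>F. cinner (proj (M i) v) (proj (M i) v))"
    unfolding p_def cinner_sum_left
  proof (intro sum.cong refl)
    fix i assume "i \<in> F"
    then have Mi: "closed_csubspace (M i)" using F M by auto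
    show "cinner (proj (M i) v) v = cinner (proj (M i) v) (proj (M i) v)"
      using cinner_proj[OF Mi, of v "proj (M i) v"] cinner_proj[OF Mi, of v v]
      by (simp add: proj_id[OF Mi proj_in[OF Mi]])
  qed
  then have "cinner p v = of_real ((norm p)\<^sup>2)" unfolding pp by (simp add: cinner_self)
  then have "inner p v = (norm p)\<^sup>2" by (metis inner_Re_cinner Re_complex_of_real)
  moreover have "0 \<le> (norm (v - p))\<^sup>2" by simp
  ultimately show ?thesis
    using pp unfolding power2_norm_eq_inner[of "v - p"] power2_norm_eq_inner[of v] power2_norm_eq_inner[of p]
    by (simp add: inner_diff_left inner_diff_right inner_commute[of v p])
qed

lemma block_norm_le: "i \<in> I \<Longrightarrow> norm (x i v) \<le> K * norm (proj (M i) v)"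
  using K(1)[of i "proj (M i) v"] bounded_ops_proj_right[OF x M] by simp

lemma finite_sum_norm_le:
  assumes F: "finite F" "F \<subseteq> I"
  shows "(\<Sum>i\<in>F. (norm (x i v))\<^sup>2) \<le> K\<^sup>2 * (norm v)\<^sup>2"
proof -
  have "(\<Sum>i\<in>F. (norm (x i v))\<^sup>2) \<le> (\<Sum>i\<in>F. K\<^sup>2 * (norm (proj (M i) v))\<^sup>2)"
    unfolding power_mult_distrib[symmetric] using F by (intro sum_mono power_mono block_norm_le) auto
  also have "\<dots> = K\<^sup>2 * (\<Sum>i\<in>F. (norm (proj (M i) v))\<^sup>2)" by (simp add: sum_distrib_left)
  also have "\<dots> \<le> K\<^sup>2 * (norm v)\<^sup>2" by (intro mult_left_mono Bessel F) simp
  finally show ?thesis .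
qed

lemma block_orth: "i \<in> I \<Longrightarrow> j \<in> I \<Longrightarrow> i \<noteq> j \<Longrightarrow> cinner (x i u) (x j v) = 0"
  using orth[of i j] bounded_opsD(3)[OF x] by blast

lemma block_summable: "(\<lambda>i. x i v) summable_on I"
proof (rule summable_on_orthogonal[OF block_orth])
  show "(\<lambda>i. (norm (x i v))\<^sup>2) summable_on I"
    using finite_sum_norm_le
    by (intro nonneg_bdd_above_summable_on bdd_aboveI[where M = "K\<^sup>2 * (norm v)\<^sup>2"]) auto
qed

definition block_sum :: "'a \<Rightarrow> 'a" where "block_sum v = (\<Sum>\<^sub>\<infinity>i\<in>I. x i v)"

lemma block_has_sum: "((\<lambda>i. x i v) has_sum block_sum v) I"
  unfolding block_sum_def by (rule has_sum_infsum[OF block_summable])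

lemma block_sum_bounded_ops: "block_sum \<in> bounded_ops UNIV"
proof -
  have add: "block_sum (u + v) = block_sum u + block_sum v" for u v
  proof -
    have "((\<lambda>i. x i u + x i v) has_sum (block_sum u + block_sum v)) I"
      by (intro has_sum_add block_has_sum)
    then have "((\<lambda>i. x i (u + v)) has_sum (block_sum u + block_sum v)) I"
      by (rule has_sum_cong[THEN iffD1, rotated]) (simp add: bounded_opsD(5)[OF x])
    then show ?thesis by (rule has_sum_unique[OF block_has_sum])
  qed
  have scale: "block_sum (c *\<^sub>C v) = c *\<^sub>C block_sum v" for c v
  proof -
    have "((\<lambda>i. c *\<^sub>C x i v) has_sum (c *\<^sub>C block_sum v)) I"
      by (rule has_sum_bounded_linear[OF bounded_linear_scaleC block_has_sum])
    then have "((\<lambda>i. x i (c *\<^sub>C v)) has_sum (c *\<^sub>C block_sum v)) I"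
      by (rule has_sum_cong[THEN iffD1, rotated]) (simp add: bounded_opsD(2)[OF x])
    then show ?thesis by (rule has_sum_unique[OF block_has_sum])
  qed
  have bound: "norm (block_sum v) \<le> norm v * K" for v
  proof (rule tendsto_upperbound)
    show "((\<lambda>F. norm (\<Sum>i\<in>F. x i v)) \<longlongrightarrow> norm (block_sum v)) (finite_subsets_at_top I)"
      using block_has_sum unfolding has_sum_def by (rule tendsto_norm)
    \<comment> \<open>Orthogonality of the ranges keeps the bound at \<open>K\<close>, however many
      blocks are added.\<close>
    have "norm (\<Sum>i\<in>F. x i v) \<le> norm v * K" if F: "finite F" "F \<subseteq> I" for F
    proof (rule power2_le_imp_le)
      have "(norm (\<Sum>i\<in>F. x i v))\<^sup>2 = (\<Sum>i\<in>F. (norm (x i v))\<^sup>2)"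
        using F by (intro norm_sum_orthogonal block_orth) auto
      then show "(norm (\<Sum>i\<in>F. x i v))\<^sup>2 \<le> (norm v * K)\<^sup>2"
        using finite_sum_norm_le[OF F, of v] by (simp add: power_mult_distrib mult.commute)
    qed (use K(2) in simp)
    then show "\<forall>\<^sub>F F in finite_subsets_at_top I. norm (\<Sum>i\<in>F. x i v) \<le> norm v * K"
      by (rule eventually_finite_subsets_at_top_weakI)
  qed simp
  show ?thesis
    unfolding bounded_ops_UNIV
    using scale by (auto intro!: bounded_linear_intro[where K = K] simp: add bound scaleR_scaleC)
qed

lemma block_sum_commute:
  assumes C: "C \<in> bounded_ops UNIV" and comm: "\<And>i v. i \<in> I \<Longrightarrow> C (x i v) = x i (C v)"
  shows "C (block_sum v) = block_sum (C v)"
proof -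
  have "((\<lambda>i. C (x i v)) has_sum C (block_sum v)) I"
    by (rule has_sum_bounded_linear[OF bounded_opsD(1)[OF C] block_has_sum])
  then have "((\<lambda>i. x i (C v)) has_sum C (block_sum v)) I"
    by (rule has_sum_cong[THEN iffD1, rotated]) (simp add: comm)
  then show ?thesis by (rule has_sum_unique) (rule block_has_sum)
qed

lemma cinner_block_sum_zero:
  assumes "\<And>i. i \<in> I \<Longrightarrow> cinner (x i v) u = 0"
  shows "cinner (block_sum v) u = 0"
proof -
  have "((\<lambda>i. cinner (x i v) u) has_sum cinner (block_sum v) u) I"
    by (rule has_sum_bounded_linear[OF bounded_linear_cinner_left block_has_sum])
  then have "((\<lambda>i. 0) has_sum cinner (block_sum v) u) I"
    by (rule has_sum_cong[THEN iffD1, rotated]) (simp add: assms)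
  then show ?thesis by (rule has_sum_unique) (rule has_sum_0, rule refl)
qed

lemma block_sum_zero: "(\<And>i. i \<in> I \<Longrightarrow> x i v = 0) \<Longrightarrow> block_sum v = 0"
  unfolding block_sum_def by (rule infsum_0)

text \<open>Adding and subtracting the block projections writes a partial sum as the positive
  operators x i + proj (M i), plus proj N minus the block projections. The latter is positive by
  Bessel's inequality for \<open>proj N v\<close>, and positivity survives the limit.\<close>

lemma positive_proj_plus_block_sum:
  assumes N: "closed_csubspace N" and sub: "\<And>i. i \<in> I \<Longrightarrow> M i \<subseteq> N"
    and pos: "\<And>i v. i \<in> I \<Longrightarrow> cinner (x i v + proj (M i) v) v \<in> \<real>\<^sub>\<ge>\<^sub>0"
  shows "cinner (proj N v + block_sum v) v \<in> \<real>\<^sub>\<ge>\<^sub>0"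
proof -
  have lim: "((\<lambda>F. cinner (proj N v + (\<Sum>i\<in>F. x i v)) v) \<longlongrightarrow> cinner (proj N v + block_sum v) v)
      (finite_subsets_at_top I)"
    using block_has_sum unfolding has_sum_def
    by (intro bounded_linear.tendsto[OF bounded_linear_cinner_left] tendsto_add tendsto_const)
  have self: "cinner (proj Q v) v = of_real ((norm (proj Q v))\<^sup>2)" if Q: "closed_csubspace Q" for Q
    using cinner_proj[OF Q, of v "proj Q v"] cinner_proj[OF Q, of v v] cinner_self[of "proj Q v"]
    by (simp add: proj_id[OF Q proj_in[OF Q]])
  have fin: "cinner (proj N v + (\<Sum>i\<in>F. x i v)) v \<in> \<real>\<^sub>\<ge>\<^sub>0" if F: "finite F" "F \<subseteq> I" for F
  proof -
    have "(\<Sum>i\<in>F. (norm (proj (M i) (proj N v)))\<^sup>2) \<le> (norm (proj N v))\<^sup>2" by (rule Bessel[OF F])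
    moreover have "proj (M i) (proj N v) = proj (M i) v" if "i \<in> F" for i
      using that F M N sub by (intro proj_proj_subset) auto
    ultimately have B: "(\<Sum>i\<in>F. (norm (proj (M i) v))\<^sup>2) \<le> (norm (proj N v))\<^sup>2" by simp
    have "cinner (proj N v + (\<Sum>i\<in>F. x i v)) v =
        (\<Sum>i\<in>F. cinner (x i v + proj (M i) v) v) +
        (cinner (proj N v) v - (\<Sum>i\<in>F. cinner (proj (M i) v) v))"
      by (simp add: cinner_add_left cinner_sum_left sum.distrib)
    also have "cinner (proj N v) v - (\<Sum>i\<in>F. cinner (proj (M i) v) v) =
        of_real ((norm (proj N v))\<^sup>2 - (\<Sum>i\<in>F. (norm (proj (M i) v))\<^sup>2))"
    proof -
      have "(\<Sum>i\<in>F. cinner (proj (M i) v) v) = (\<Sum>i\<in>F. of_real ((norm (proj (M i) v))\<^sup>2))"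
        using F M by (intro sum.cong self) auto
      then show ?thesis by (simp add: self[OF N])
    qed
    finally have eq: "cinner (proj N v + (\<Sum>i\<in>F. x i v)) v =
        (\<Sum>i\<in>F. cinner (x i v + proj (M i) v) v) +
        of_real ((norm (proj N v))\<^sup>2 - (\<Sum>i\<in>F. (norm (proj (M i) v))\<^sup>2))" .
    have "(\<Sum>i\<in>F. cinner (x i v + proj (M i) v) v) \<in> \<real>\<^sub>\<ge>\<^sub>0"
      using F
    proof (induction F)
      case (insert i F)
      then have "cinner (x i v + proj (M i) v) v \<in> \<real>\<^sub>\<ge>\<^sub>0" by (intro pos) auto
      then show ?case using insert unfolding sum.insert[OF insert.hyps] by (intro nonneg_Reals_add_I) auto
    qed simp
    moreover have "complex_of_real ((norm (proj N v))\<^sup>2 - (\<Sum>i\<in>F. (norm (proj (M i) v))\<^sup>2)) \<in> \<real>\<^sub>\<ge>\<^sub>0"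
      using B by (simp only: nonneg_Reals_of_real_iff diff_ge_0_iff_ge)
    ultimately show ?thesis unfolding eq by (rule nonneg_Reals_add_I)
  qed
  show ?thesis
  proof (rule Lim_in_closed_set[OF closed_nonneg_Reals_complex _ _ lim])
    show "\<forall>\<^sub>F F in finite_subsets_at_top I. cinner (proj N v + (\<Sum>i\<in>F. x i v)) v \<in> \<real>\<^sub>\<ge>\<^sub>0"
      by (rule eventually_finite_subsets_at_top_weakI) (rule fin)
  qed simp
qed

end

subsection \<open>Spaces spanned by words of given types\<close>

lemma bar_bar [simp]: "bar (bar \<iota>) = \<iota>"
  by (cases \<iota>) auto

lemma bar_neq [simp]: "bar \<iota> \<noteq> \<iota>" "\<iota> \<noteq> bar \<iota>"
  by (cases \<iota>; simp)+

lemma neq_iff_bar: "\<kappa> \<noteq> \<iota> \<longleftrightarrow> \<kappa> = bar \<iota>"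
  by (cases \<iota>; cases \<kappa>) auto

text \<open>The only alternating sequence of length \<open>n\<close> that does not start with
  \<iota>. Its uniqueness, due to there being two sides, turns each level into the space of a single
  type.\<close>

fun level_type :: "side \<Rightarrow> nat \<Rightarrow> side list" where
  "level_type \<iota> 0 = []"
| "level_type \<iota> (Suc n) = bar \<iota> # level_type (bar \<iota>) n"

lemma length_level_type [simp]: "length (level_type \<iota> n) = n"
  by (induction n arbitrary: \<iota>) auto

lemma level_type_iff:
  "\<tau> = level_type \<iota> n \<longleftrightarrow> distinct_adj \<tau> \<and> (\<tau> = [] \<or> hd \<tau> \<noteq> \<iota>) \<and> length \<tau> = n"
proof (induction n arbitrary: \<iota> \<tau>)
  case (Suc n)
  show ?case
  proof (cases \<tau>)
    case (Cons \<kappa> \<sigma>)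
    have "\<sigma> = level_type (bar \<iota>) n \<longleftrightarrow> distinct_adj \<sigma> \<and> (\<sigma> = [] \<or> hd \<sigma> \<noteq> bar \<iota>) \<and> length \<sigma> = n"
      by (rule Suc.IH)
    then show ?thesis using Cons neq_iff_bar[of \<kappa> \<iota>] by (cases \<sigma>) auto
  qed simp
qed auto

lemma closed_cspan_mono: "S \<subseteq> S' \<Longrightarrow> closed_cspan S \<subseteq> closed_cspan S'"
  by (rule hull_mono)

lemma closed_cspan_Union: "closed_cspan (\<Union>i\<in>I. closed_cspan (S i)) = closed_cspan (\<Union>i\<in>I. S i)"
proof (rule antisym)
  show "closed_cspan (\<Union>i\<in>I. closed_cspan (S i)) \<subseteq> closed_cspan (\<Union>i\<in>I. S i)"
    by (rule closed_cspan_subset[OF _ closed_csubspace_closed_cspan], rule UN_least,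
        rule closed_cspan_mono) auto
  show "closed_cspan (\<Union>i\<in>I. S i) \<subseteq> closed_cspan (\<Union>i\<in>I. closed_cspan (S i))"
    by (rule closed_cspan_mono, rule UN_mono[OF order_refl], rule hull_subset)
qed

lemma bounded_ops_mono:
  assumes S: "S \<in> bounded_ops M" and "M \<subseteq> N"
  shows "S \<in> bounded_ops N"
  unfolding bounded_ops_def
proof (intro CollectI conjI allI impI)
  show "S v \<in> N" for v using bounded_opsD(3)[OF S] assms(2) by blast
  show "S v = 0" if "\<forall>q\<in>N. cinner v q = 0" for v
    by (rule bounded_opsD(4)[OF S]) (use that assms(2) in blast)
qed (rule bounded_opsD[OF S])+

lemma prod_lessThan_add: "prod f {..<a + b} = prod f {..<a} * (\<Prod>k<b. f (a + k))"
  for f :: "nat \<Rightarrow> 'c::comm_monoid_mult"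
  by (induction b) (simp_all add: mult.assoc)

context free_product
begin

definition type_space :: "side list set \<Rightarrow> 'h set" where
  "type_space A = closed_cspan (T ` {w \<in> words H \<xi>. map fst w \<in> A})"

lemma closed_type_space: "closed_csubspace (type_space A)"
  unfolding type_space_def by (rule closed_csubspace_closed_cspan)

lemma type_space_mono: "A \<subseteq> B \<Longrightarrow> type_space A \<subseteq> type_space B"
  unfolding type_space_def by (rule closed_cspan_mono) auto

lemma T_in_type_space: "w \<in> words H \<xi> \<Longrightarrow> map fst w \<in> A \<Longrightarrow> T w \<in> type_space A"
  unfolding type_space_def by (rule hull_inc) auto

lemma type_space_orthogonal:
  assumes "A \<inter> B = {}" "u \<in> type_space A" "v \<in> type_space B"
  shows "cinner u v = 0"
proof (rule closed_cspan_ortho)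
  show "u \<in> closed_cspan (T ` {w \<in> words H \<xi>. map fst w \<in> A})"
    "v \<in> closed_cspan (T ` {w \<in> words H \<xi>. map fst w \<in> B})"
    using assms by (simp_all add: type_space_def)
  fix s s' assume "s \<in> T ` {w \<in> words H \<xi>. map fst w \<in> A}" "s' \<in> T ` {w \<in> words H \<xi>. map fst w \<in> B}"
  then obtain w w' where w: "w \<in> words H \<xi>" "map fst w \<in> A" "s = T w"
    "w' \<in> words H \<xi>" "map fst w' \<in> B" "s' = T w'" by blast
  then have "map fst w \<noteq> map fst w'" using assms(1) by auto
  then show "cinner s s' = 0" using w by (simp add: cinner_T)
qed

lemma type_space_induct:
  assumes "v \<in> type_space A" "closed_csubspace {v. Q v}"
    "\<And>w. w \<in> words H \<xi> \<Longrightarrow> map fst w \<in> A \<Longrightarrow> Q (T w)"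
  shows "Q v"
  using assms(1) unfolding type_space_def
  by (rule closed_cspan_induct[OF _ assms(2)]) (use assms(3) in auto)

lemma type_space_UN: "closed_cspan (\<Union>i\<in>I. type_space (A i)) = type_space (\<Union>i\<in>I. A i)"
proof -
  have "T ` {w \<in> words H \<xi>. map fst w \<in> (\<Union>i\<in>I. A i)} = (\<Union>i\<in>I. T ` {w \<in> words H \<xi>. map fst w \<in> A i})"
    by auto
  then show ?thesis unfolding type_space_def by (simp only: closed_cspan_Union)
qed

lemma total_eq: "total = type_space UNIV"
  by (simp add: total_def type_space_def)

lemma level_eq: "level \<iota> n = type_space {level_type \<iota> n}"
proof -
  have "{w \<in> words_avoiding \<iota>. length w = n} = {w \<in> words H \<xi>. map fst w \<in> {level_type \<iota> n}}"
    by (auto simp: words_avoiding_def level_type_iff words_def hd_map)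
  then show ?thesis by (simp add: level_def type_space_def)
qed

text \<open>Indexing by \<open>Suc n\<close> avoids the predecessor. The second type is
  \<open>level_type (bar \<iota>) (Suc n)\<close>, displayed as the first one with a factor from
  \<iota> in front.\<close>

lemma summand_eq: "summand \<iota> (Suc n) = type_space {level_type \<iota> n, \<iota> # level_type \<iota> n}"
  using type_space_UN[of "\<lambda>i. {i}" "{level_type \<iota> n, \<iota> # level_type \<iota> n}"]
  by (simp add: summand_def level_eq insert_commute)

lemma closed_summand: "closed_csubspace (summand \<iota> n)"
  unfolding summand_def by (rule closed_csubspace_closed_cspan)

text \<open>As a type space, the s-free Fock space falls under the results on projections onto type
  spaces. The union runs over odd \<open>n\<close>, so n - 1 is the true predecessor.\<close>

lemma space_of_eq:
  "space_of \<iota> m = type_space (\<Union>n\<in>{n. odd n}. {level_type (if odd m then \<iota> else bar \<iota>) (n - 1),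
     (if odd m then \<iota> else bar \<iota>) # level_type (if odd m then \<iota> else bar \<iota>) (n - 1)})"
proof -
  have *: "sfree_space \<kappa> = type_space (\<Union>n\<in>{n. odd n}. {level_type \<kappa> (n - 1), \<kappa> # level_type \<kappa> (n - 1)})" for \<kappa>
  proof -
    have "summand \<kappa> n = type_space {level_type \<kappa> (n - 1), \<kappa> # level_type \<kappa> (n - 1)}" if "odd n" for n
      using that summand_eq[of \<kappa> "n - 1"] by (cases n) auto
    then show ?thesis unfolding sfree_space_def type_space_UN[symmetric] by simp
  qed
  show ?thesis by (simp add: space_of_def *)
qed

lemma closed_space_of: "closed_csubspace (space_of \<iota> m)"
  unfolding space_of_eq by (rule closed_type_space)

lemma space_of_Suc: "space_of (bar \<iota>) (Suc m) = space_of \<iota> m" "space_of \<iota> (Suc (Suc m)) = space_of \<iota> m"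
  by (auto simp: space_of_def)

lemma summand_subset_space_of: "1 \<le> m \<Longrightarrow> summand \<iota> m \<subseteq> space_of \<iota> m"
proof -
  assume "1 \<le> m"
  then obtain n where n: "m = Suc n" by (cases m) auto
  show ?thesis
  proof (cases "odd m")
    case True
    then have "{level_type \<iota> (m - 1), \<iota> # level_type \<iota> (m - 1)} \<subseteq>
        (\<Union>k\<in>{n. odd n}. {level_type \<iota> (k - 1), \<iota> # level_type \<iota> (k - 1)})"
      by (intro UN_upper) simp
    then have "type_space {level_type \<iota> (m - 1), \<iota> # level_type \<iota> (m - 1)} \<subseteq> space_of \<iota> m"
      unfolding space_of_eq if_P[OF True] by (rule type_space_mono)
    then show ?thesis by (simp add: n summand_eq)
  next
    case False
    then obtain k where k: "n = Suc k" using n by (cases n) auto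
    \<comment> \<open>For even \<open>m\<close> the summand of \<iota> straddles two summands of
      \<open>bar \<iota>\<close>: its shorter words are the longer ones of index \<open>n\<close>,
      its longer words the shorter ones of index \<open>Suc m\<close>, and both indices are
      odd.\<close>
    let ?f = "\<lambda>k. {level_type (bar \<iota>) (k - 1), bar \<iota> # level_type (bar \<iota>) (k - 1)}"
    have "?f n \<union> ?f (Suc m) \<subseteq> (\<Union>k\<in>{n. odd n}. ?f k)"
      using False n by (intro Un_least UN_upper) auto
    moreover have "{level_type \<iota> n, \<iota> # level_type \<iota> n} \<subseteq> ?f n \<union> ?f (Suc m)"
      by (simp add: k n)
    ultimately have "type_space {level_type \<iota> n, \<iota> # level_type \<iota> n} \<subseteq> space_of \<iota> m"
      unfolding space_of_eq if_not_P[OF False] by (intro type_space_mono) (rule order_trans)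
    then show ?thesis by (simp add: n summand_eq)
  qed
qed

lemma proj_type_space_T:
  assumes "w \<in> words H \<xi>"
  shows "proj (type_space A) (T w) = (if map fst w \<in> A then T w else 0)"
proof (cases "map fst w \<in> A")
  case True
  then show ?thesis using proj_id[OF closed_type_space T_in_type_space[OF assms True]] by simp
next
  case False
  have "proj (type_space A) (T w) = 0"
  proof (rule proj_zero[OF closed_type_space])
    fix q assume "q \<in> type_space A"
    then show "cinner (T w) q = 0"
      by (intro type_space_orthogonal[of "{map fst w}" A] T_in_type_space[OF assms]) (use False in auto)
  qed
  then show ?thesis using False by simp
qed

lemma bounded_ops_type_space_total: "S \<in> bounded_ops (type_space A) \<Longrightarrow> S \<in> bounded_ops total"
proof -
  assume S: "S \<in> bounded_ops (type_space A)"
  show ?thesis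
    by (rule bounded_ops_mono[OF S]) (unfold total_eq, rule type_space_mono, simp)
qed

lemma total_ops_eqI:
  assumes F: "F \<in> bounded_ops UNIV" "\<And>v. F (proj total v) = F v"
    and G: "G \<in> bounded_ops UNIV" "\<And>v. G (proj total v) = G v"
    and T: "\<And>w. w \<in> words H \<xi> \<Longrightarrow> F (T w) = G (T w)"
  shows "F v = G v"
proof -
  have "F (proj total v) = G (proj total v)"
    using proj_in[OF closed_type_space, of UNIV v] unfolding total_eq
    by (rule type_space_induct[OF _ closed_csubspace_equalizer[OF F(1) G(1)]]) (rule T)
  then show ?thesis by (simp add: F(2) G(2))
qed

lemma words_same_typesI:
  assumes "w \<in> words H \<xi>" "map fst w' = map fst w" "\<And>p. p \<in> set w' \<Longrightarrow> snd p \<in> centered H \<xi> (fst p)"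
  shows "w' \<in> words H \<xi>"
  using assms by (auto simp: words_def)

lemma words_append:
  assumes "s @ t \<in> words H \<xi>"
  shows "s \<in> words H \<xi>" "t \<in> words H \<xi>"
  using assms by (auto simp: words_def distinct_adj_append_iff)

lemma words_replace_tail:
  assumes "s @ t \<in> words H \<xi>" "t' \<in> words H \<xi>" "map fst t' = map fst t"
  shows "s @ t' \<in> words H \<xi>"
  using assms by (intro words_same_typesI[OF assms(1)]) (auto simp: words_def)

text \<open>This lets \<open>T (s @ t)\<close> play the role of T s (x) T t. Equal tail types align
  the two cuts: if the head types agree too, the product of inner products splits there, otherwise
  both sides are 0.\<close>

lemma cinner_T_append:
  assumes "s @ t \<in> words H \<xi>" "s' @ t' \<in> words H \<xi>" "map fst t = map fst t'"
  shows "cinner (T (s @ t)) (T (s' @ t')) = cinner (T s) (T s') * cinner (T t) (T t')"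
proof (cases "map fst s = map fst s'")
  case True
  then have len: "length s = length s'" "length t = length t'"
    using assms(3) map_eq_imp_length_eq by blast+
  have "(\<Prod>k<length (s @ t). cinner (snd ((s @ t) ! k)) (snd ((s' @ t') ! k))) =
    (\<Prod>k<length s. cinner (snd ((s @ t) ! k)) (snd ((s' @ t') ! k))) *
    (\<Prod>k<length t. cinner (snd ((s @ t) ! (length s + k))) (snd ((s' @ t') ! (length s + k))))"
    by (simp add: prod_lessThan_add)
  also have "\<dots> = (\<Prod>k<length s. cinner (snd (s ! k)) (snd (s' ! k))) * (\<Prod>k<length t. cinner (snd (t ! k)) (snd (t' ! k)))"
    by (rule arg_cong2[where f = "(*)"]; rule prod.cong) (use len in \<open>auto simp: nth_append\<close>)
  finally show ?thesis
    using assms True words_append[OF assms(1)] words_append[OF assms(2)] by (simp add: cinner_T)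
next
  case False
  then show ?thesis using assms words_append[OF assms(1)] words_append[OF assms(2)] by (simp add: cinner_T)
qed

text \<open>Linearity of \<open>T\<close> in the entries is no axiom; that the tensor vanishes is
  read off from its norm.\<close>

lemma T_Cons_zero: "(\<iota>, 0) # w \<in> words H \<xi> \<Longrightarrow> T ((\<iota>, 0) # w) = 0"
proof -
  assume w: "(\<iota>, 0) # w \<in> words H \<xi>"
  have "cinner (T ((\<iota>, 0) # w)) (T ((\<iota>, 0) # w)) = 0"
    unfolding cinner_T[OF w w] by (auto intro!: bexI[of _ 0])
  then show ?thesis by (simp add: cinner_self)
qed

end

lemma bounded_ops_rank_one: "(\<lambda>v. cinner v p *\<^sub>C q) \<in> bounded_ops UNIV"
proof -
  have "norm (cinner v p *\<^sub>C q) \<le> norm v * (norm p * norm q)" for v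
    using mult_right_mono[OF cmod_cinner_le norm_ge_zero] by (simp add: norm_scaleC mult.assoc[symmetric])
  then show ?thesis
    unfolding bounded_ops_UNIV
    by (auto intro!: bounded_linear_intro[where K = "norm p * norm q"]
        simp: cinner_add_left cinner_scaleC_left scaleC_add_left scaleC_scaleC scaleR_scaleC)
qed

subsection \<open>The free product representation\<close>

context free_product
begin

lemma closed_total: "closed_csubspace total"
  unfolding total_eq by (rule closed_type_space)

lemma cinner_\<xi>: "cinner (\<xi> \<iota>) (\<xi> \<iota>) = 1"
  by (simp add: cinner_self norm_\<xi>)

lemma centered_part:
  assumes "h \<in> H \<iota>"
  shows "h - cinner h (\<xi> \<iota>) *\<^sub>C \<xi> \<iota> \<in> centered H \<xi> \<iota>"
proof -
  have "h - cinner h (\<xi> \<iota>) *\<^sub>C \<xi> \<iota> \<in> H \<iota>"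
    by (rule closed_csubspaceD(5)[OF closed_csubspace_H assms closed_csubspaceD(4)[OF closed_csubspace_H \<xi>_in_H]])
  then show ?thesis
    by (simp add: centered_def cinner_diff_left cinner_scaleC_left cinner_\<xi>)
qed

lemma words_avoiding_Cons:
  assumes "w \<in> words_avoiding \<iota>" "h \<in> centered H \<xi> \<iota>"
  shows "(\<iota>, h) # w \<in> words H \<xi>"
  using assms by (cases w) (auto simp: words_avoiding_def words_def)

lemma words_ConsD:
  assumes "(\<iota>, h) # w \<in> words H \<xi>"
  shows "w \<in> words_avoiding \<iota>" "h \<in> centered H \<xi> \<iota>"
  using assms by (cases w; auto simp: words_avoiding_def words_def)+

lemma words_avoiding_words: "w \<in> words_avoiding \<iota> \<Longrightarrow> w \<in> words H \<xi>"
  by (simp add: words_avoiding_def)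

lemma cinner_T_Cons:
  assumes "(\<iota>, h) # w \<in> words H \<xi>" "(\<iota>, h') # w' \<in> words H \<xi>"
  shows "cinner (T ((\<iota>, h) # w)) (T ((\<iota>, h') # w')) = cinner h h' * cinner (T w) (T w')"
  using assms words_avoiding_words[OF words_ConsD(1)[OF assms(1)]] words_avoiding_words[OF words_ConsD(1)[OF assms(2)]]
  by (simp add: cinner_T prod.lessThan_Suc_shift del: prod.lessThan_Suc)

lemma cinner_T_avoiding_Cons:
  assumes "w \<in> words_avoiding \<iota>" "(\<iota>, h) # w' \<in> words H \<xi>"
  shows "cinner (T w) (T ((\<iota>, h) # w')) = 0" "cinner (T ((\<iota>, h) # w')) (T w) = 0"
proof -
  have "map fst w \<noteq> map fst ((\<iota>, h) # w')" using assms(1) by (cases w) (auto simp: words_avoiding_def)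
  then show "cinner (T w) (T ((\<iota>, h) # w')) = 0"
    using assms words_avoiding_words[OF assms(1)] by (simp only: cinner_T if_False)
  then show "cinner (T ((\<iota>, h) # w')) (T w) = 0" by (simp only: cinner_eq_zero_commute)
qed

text \<open>The natural map H \<iota> (x) (words avoiding \<iota>) is isometric: the two parts of a
  join are orthogonal, and the component along \<xi> restores what centering removes. This is the
  Gram identity required by \<open>tensor_operator\<close>.\<close>

lemma cinner_join:
  assumes "h \<in> H \<iota>" "h' \<in> H \<iota>" "w \<in> words_avoiding \<iota>" "w' \<in> words_avoiding \<iota>"
  shows "cinner (join \<iota> h w) (join \<iota> h' w') = cinner (T w) (T w') * cinner h h'"
proof -
  let ?k = "h - cinner h (\<xi> \<iota>) *\<^sub>C \<xi> \<iota>" and ?k' = "h' - cinner h' (\<xi> \<iota>) *\<^sub>C \<xi> \<iota>"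
  have w: "(\<iota>, ?k) # w \<in> words H \<xi>" "(\<iota>, ?k') # w' \<in> words H \<xi>"
    using assms centered_part words_avoiding_Cons by simp_all
  have kk: "cinner ?k ?k' = cinner h h' - cinner h (\<xi> \<iota>) * cnj (cinner h' (\<xi> \<iota>))"
    by (simp add: cinner_diff_left cinner_diff_right cinner_scaleC_left cinner_scaleC_right cinner_\<xi>
        cinner_commute[of "\<xi> \<iota>" h'])
  show ?thesis
    unfolding join_def kk cinner_add_left cinner_add_right cinner_scaleC_left cinner_scaleC_right
      cinner_T_Cons[OF w] cinner_T_avoiding_Cons[OF assms(3) w(2)] cinner_T_avoiding_Cons[OF assms(4) w(1)] kk
    by (simp add: algebra_simps)
qed

lemma join_\<xi>: "w \<in> words_avoiding \<iota> \<Longrightarrow> join \<iota> (\<xi> \<iota>) w = T w"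
proof -
  assume w: "w \<in> words_avoiding \<iota>"
  have "(\<iota>, 0) # w \<in> words H \<xi>"
    using words_avoiding_Cons[OF w centered_part[OF \<xi>_in_H]] by (simp add: cinner_\<xi>)
  then show ?thesis by (simp add: join_def cinner_\<xi> T_Cons_zero)
qed

lemma join_centered: "h \<in> centered H \<xi> \<iota> \<Longrightarrow> join \<iota> h w = T ((\<iota>, h) # w)"
  by (simp add: join_def centered_def)

lemma join_in_total: "h \<in> H \<iota> \<Longrightarrow> w \<in> words_avoiding \<iota> \<Longrightarrow> join \<iota> h w \<in> total"
  unfolding total_eq join_def
  by (intro closed_csubspaceD[OF closed_type_space] T_in_type_space words_avoiding_words words_avoiding_Cons
      centered_part UNIV_I)

text \<open>A word either avoids \<iota>, and is joined with \<xi>, or its first letter is split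
  off. Hence joins span everything; the final disjunction lets the type of the remainder be
  recovered later.\<close>

lemma T_as_join:
  assumes "w \<in> words H \<xi>"
  obtains h w' where "h \<in> H \<iota>" "w' \<in> words_avoiding \<iota>" "T w = join \<iota> h w'" "w' = w \<or> w = (\<iota>, h) # w'"
proof (cases "w \<in> words_avoiding \<iota>")
  case True
  then show thesis using that[of "\<xi> \<iota>" w] by (simp add: \<xi>_in_H join_\<xi>)
next
  case False
  then obtain p w' where p: "w = p # w'" "fst p = \<iota>"
    using assms by (cases w) (auto simp: words_avoiding_def)
  obtain h where w: "w = (\<iota>, h) # w'" using p by (cases p) auto
  have c: "w' \<in> words_avoiding \<iota>" "h \<in> centered H \<xi> \<iota>" using words_ConsD assms w by auto
  then show thesis using that[of h w'] w by (simp add: join_centered centered_def)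
qed

lemma closed_cspan_joins:
  "closed_cspan ((\<lambda>(h, w). join \<iota> h w) ` (H \<iota> \<times> words_avoiding \<iota>)) = total" (is "closed_cspan ?S = _")
proof (rule antisym)
  show "closed_cspan ?S \<subseteq> total"
    by (rule closed_cspan_subset[OF _ closed_total]) (auto simp: join_in_total)
  show "total \<subseteq> closed_cspan ?S"
    unfolding total_def
  proof (rule closed_cspan_subset[OF _ closed_csubspace_closed_cspan], rule image_subsetI)
    fix w assume "w \<in> words H \<xi>"
    then obtain h w' where h: "h \<in> H \<iota>" "w' \<in> words_avoiding \<iota>" "T w = join \<iota> h w'"
      by (rule T_as_join)
    show "T w \<in> closed_cspan ?S" unfolding h(3) by (rule hull_inc) (use h in auto)
  qed
qed

lemma rep_unique_exists:
  assumes b: "b \<in> bounded_ops (H \<iota>)"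
  shows "\<exists>!L. L \<in> bounded_ops total \<and>
     (\<forall>h\<in>H \<iota>. \<forall>w\<in>words_avoiding \<iota>. L (join \<iota> h w) = join \<iota> (b h) w)"
proof (rule ex_ex1I)
  let ?I = "H \<iota> \<times> words_avoiding \<iota>" and ?f = "\<lambda>(h, w). join \<iota> h w" and ?g = "\<lambda>(h, w). join \<iota> (b h) w"
  have "\<exists>L\<in>bounded_ops (closed_cspan (?f ` ?I)). \<forall>p\<in>?I. L (?f p) = ?g p"
  \<comment> \<open>The tensor of the remaining word is the inert factor, and \<open>b\<close> acts
    on the other one.\<close>
  proof (rule tensor_operator[of b ?I ?f "\<lambda>p. T (snd p)" fst ?g])
    show "b \<in> bounded_ops UNIV" by (rule bounded_opsD(8)[OF b])
    show "cinner (?f p) (?f q) = cinner (T (snd p)) (T (snd q)) * cinner (fst p) (fst q)"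
      if "p \<in> ?I" "q \<in> ?I" for p q
      using that by (auto simp: cinner_join)
    show "cinner (?g p) (?g q) = cinner (T (snd p)) (T (snd q)) * cinner (b (fst p)) (b (fst q))"
      if "p \<in> ?I" "q \<in> ?I" for p q
      using that bounded_opsD(3)[OF b] by (auto simp: cinner_join)
    show "?g p \<in> closed_cspan (?f ` ?I)" if "p \<in> ?I" for p
      unfolding closed_cspan_joins using that bounded_opsD(3)[OF b] by (auto simp: join_in_total)
  qed
  then obtain L where L: "L \<in> bounded_ops (closed_cspan (?f ` ?I))" "\<forall>p\<in>?I. L (?f p) = ?g p" by blast
  show "\<exists>L. L \<in> bounded_ops total \<and> (\<forall>h\<in>H \<iota>. \<forall>w\<in>words_avoiding \<iota>. L (join \<iota> h w) = join \<iota> (b h) w)"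
    using L unfolding closed_cspan_joins by (intro exI[of _ L]) auto
  fix L L'
  assume L: "L \<in> bounded_ops total \<and> (\<forall>h\<in>H \<iota>. \<forall>w\<in>words_avoiding \<iota>. L (join \<iota> h w) = join \<iota> (b h) w)"
    and L': "L' \<in> bounded_ops total \<and> (\<forall>h\<in>H \<iota>. \<forall>w\<in>words_avoiding \<iota>. L' (join \<iota> h w) = join \<iota> (b h) w)"
  show "L = L'"
  proof
    fix v
    show "L v = L' v"
    proof (rule total_ops_eqI[of L L'])
      show "L \<in> bounded_ops UNIV" "L' \<in> bounded_ops UNIV" using L L' bounded_opsD(8) by blast+
      show "L (proj total v) = L v" "L' (proj total v) = L' v" for v
        using L L' bounded_ops_proj_right[OF _ closed_total] by blast+
      fix w assume "w \<in> words H \<xi>"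
      then obtain h w' where h: "h \<in> H \<iota>" "w' \<in> words_avoiding \<iota>" "T w = join \<iota> h w'"
        by (rule T_as_join)
      show "L (T w) = L' (T w)" unfolding h(3) using L L' h(1,2) by simp
    qed
  qed
qed

lemma
  assumes b: "b \<in> bounded_ops (H \<iota>)"
  shows rep_bounded_ops: "rep \<iota> b \<in> bounded_ops total"
    and rep_join: "h \<in> H \<iota> \<Longrightarrow> w \<in> words_avoiding \<iota> \<Longrightarrow> rep \<iota> b (join \<iota> h w) = join \<iota> (b h) w"
  using theI'[OF rep_unique_exists[OF b]] unfolding rep_def[symmetric] by blast+

subsection \<open>Operators acting on the last tensor factors\<close>

text \<open>\<open>E\<close> is \<open>1 \<otimes> D\<close> on the words ending in a word of type \<open>\<tau>\<close>, where \<open>D\<close> is the rank one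
  operator sending \<open>T t\<^sub>0\<close> to \<open>T t\<^sub>1\<close>.  An operator commuting with all of these acts only on the
  factors in front of the last ones.\<close>

definition tail_op :: "side list \<Rightarrow> (side \<times> 'a) list \<Rightarrow> (side \<times> 'a) list \<Rightarrow> ('h \<Rightarrow> 'h) \<Rightarrow> bool" where
  "tail_op \<tau> t\<^sub>0 t\<^sub>1 E \<longleftrightarrow> t\<^sub>0 \<in> words H \<xi> \<and> map fst t\<^sub>0 = \<tau> \<and> t\<^sub>1 \<in> words H \<xi> \<and> map fst t\<^sub>1 = \<tau> \<and>
     E \<in> bounded_ops (type_space {\<sigma> @ \<tau> | \<sigma>. True}) \<and>
     (\<forall>s t. s @ t \<in> words H \<xi> \<longrightarrow> map fst t = \<tau> \<longrightarrow> E (T (s @ t)) = cinner (T t) (T t\<^sub>0) *\<^sub>C T (s @ t\<^sub>1))"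

lemma tail_op_exists:
  assumes t: "t\<^sub>0 \<in> words H \<xi>" "map fst t\<^sub>0 = \<tau>" "t\<^sub>1 \<in> words H \<xi>" "map fst t\<^sub>1 = \<tau>"
  shows "\<exists>E. tail_op \<tau> t\<^sub>0 t\<^sub>1 E"
proof -
  \<comment> \<open>The index is the cut word, not its tensor: different words may have the same
    tensor, and consistency follows from the norm bound inside
    \<open>tensor_operator\<close>.\<close>
  let ?I = "{(s, t). s @ t \<in> words H \<xi> \<and> map fst t = \<tau>}"
  let ?f = "\<lambda>(s, t). T (s @ t)" and ?g = "\<lambda>(s, t). cinner (T t) (T t\<^sub>0) *\<^sub>C T (s @ t\<^sub>1)"
  let ?D = "\<lambda>v. cinner v (T t\<^sub>0) *\<^sub>C T t\<^sub>1"
  have D: "?D \<in> bounded_ops UNIV" by (rule bounded_ops_rank_one)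
  have ts: "type_space {\<sigma> @ \<tau> | \<sigma>. True} = closed_cspan (?f ` ?I)"
  proof -
    have "T ` {w \<in> words H \<xi>. map fst w \<in> {\<sigma> @ \<tau> | \<sigma>. True}} = ?f ` ?I"
    proof (rule antisym; rule image_subsetI)
      fix w assume w: "w \<in> {w \<in> words H \<xi>. map fst w \<in> {\<sigma> @ \<tau> | \<sigma>. True}}"
      then obtain \<sigma> where "map fst w = \<sigma> @ \<tau>" by auto
      then obtain s t where "w = s @ t" "map fst t = \<tau>" by (auto simp: map_eq_append_conv)
      then show "T w \<in> ?f ` ?I" using w by (intro image_eqI[of _ _ "(s, t)"]) auto
    next
      fix p assume "p \<in> ?I"
      then show "?f p \<in> T ` {w \<in> words H \<xi>. map fst w \<in> {\<sigma> @ \<tau> | \<sigma>. True}}"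
        by (cases p) auto
    qed
    then show ?thesis by (simp only: type_space_def)
  qed
  have s1: "s @ t\<^sub>1 \<in> words H \<xi>" if "s @ t \<in> words H \<xi>" "map fst t = \<tau>" for s t
    using words_replace_tail[OF that(1) t(3)] that(2) t(4) by simp
  have "\<exists>E\<in>bounded_ops (closed_cspan (?f ` ?I)). \<forall>p\<in>?I. E (?f p) = ?g p"
  proof (rule tensor_operator[of ?D ?I ?f "\<lambda>p. T (fst p)" "\<lambda>p. T (snd p)" ?g, OF D])
    show "cinner (?f p) (?f q) = cinner (T (fst p)) (T (fst q)) * cinner (T (snd p)) (T (snd q))"
      if "p \<in> ?I" "q \<in> ?I" for p q
      using that by (cases p; cases q) (simp add: cinner_T_append)
    show "cinner (?g p) (?g q) = cinner (T (fst p)) (T (fst q)) * cinner (?D (T (snd p))) (?D (T (snd q)))"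
      if "p \<in> ?I" "q \<in> ?I" for p q
    proof -
      obtain s r s' r' where p: "p = (s, r)" "q = (s', r')" by (cases p; cases q) auto
      then have "cinner (T (s @ t\<^sub>1)) (T (s' @ t\<^sub>1)) = cinner (T s) (T s') * cinner (T t\<^sub>1) (T t\<^sub>1)"
        using that by (intro cinner_T_append s1[of s r] s1[of s' r'] refl) auto
      then show ?thesis by (simp add: p cinner_scaleC_left cinner_scaleC_right)
    qed
    show "?g p \<in> closed_cspan (?f ` ?I)" if "p \<in> ?I" for p
    proof -
      obtain s r where p: "p = (s, r)" by (cases p)
      have "T (s @ t\<^sub>1) \<in> type_space {\<sigma> @ \<tau> | \<sigma>. True}"
        using that t(4) s1[of s r] by (intro T_in_type_space) (auto simp: p)
      then show ?thesis
        unfolding ts[symmetric] p prod.case by (rule closed_csubspaceD(4)[OF closed_type_space])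
    qed
  qed
  then obtain E where E: "E \<in> bounded_ops (closed_cspan (?f ` ?I))" "\<forall>p\<in>?I. E (?f p) = ?g p" by blast
  have "E (T (s @ r)) = cinner (T r) (T t\<^sub>0) *\<^sub>C T (s @ t\<^sub>1)" if "s @ r \<in> words H \<xi>" "map fst r = \<tau>" for s r
    using bspec[OF E(2), of "(s, r)"] that by simp
  then have "tail_op \<tau> t\<^sub>0 t\<^sub>1 E" using E(1) t unfolding tail_op_def ts[symmetric] by blast
  then show ?thesis by blast
qed

lemma tail_opD:
  assumes "tail_op \<tau> t\<^sub>0 t\<^sub>1 E"
  shows "E \<in> bounded_ops UNIV" "E (proj total v) = E v"
    "s @ t \<in> words H \<xi> \<Longrightarrow> map fst t = \<tau> \<Longrightarrow> E (T (s @ t)) = cinner (T t) (T t\<^sub>0) *\<^sub>C T (s @ t\<^sub>1)"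
    "t\<^sub>0 \<in> words H \<xi>" "map fst t\<^sub>0 = \<tau>" "t\<^sub>1 \<in> words H \<xi>" "map fst t\<^sub>1 = \<tau>"
proof -
  have E: "E \<in> bounded_ops (type_space {\<sigma> @ \<tau> | \<sigma>. True})" using assms by (simp add: tail_op_def)
  show "E \<in> bounded_ops UNIV" by (rule bounded_opsD(8)[OF E])
  show "E (proj total v) = E v"
    by (rule bounded_ops_proj_right[OF bounded_ops_type_space_total[OF E] closed_total])
qed (use assms in \<open>simp_all add: tail_op_def\<close>)

lemma tail_op_T_zero:
  assumes E: "tail_op \<tau> t\<^sub>0 t\<^sub>1 E" and w: "w \<in> words H \<xi>" "\<nexists>\<sigma>. map fst w = \<sigma> @ \<tau>"
  shows "E (T w) = 0"
proof (rule bounded_opsD(4)[of E])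
  show "E \<in> bounded_ops (type_space {\<sigma> @ \<tau> | \<sigma>. True})" using E by (simp add: tail_op_def)
  fix q assume "q \<in> type_space {\<sigma> @ \<tau> | \<sigma>. True}"
  then show "cinner (T w) q = 0"
    by (rule type_space_orthogonal[of "{map fst w}", rotated 2]) (use w T_in_type_space in auto)
qed

text \<open>The commutant of the matrix units on the last factors. It is stable under algebra
  operations, and the sums \<open>R_op\<close> and the square roots inherit it, so the tensor
  structure is examined only for projections and for \<open>x_op\<close>.\<close>

definition tail_commuting :: "side list \<Rightarrow> ('h \<Rightarrow> 'h) \<Rightarrow> bool" where
  "tail_commuting \<tau> c \<longleftrightarrow> c \<in> bounded_ops UNIV \<and>
     (\<forall>t\<^sub>0 t\<^sub>1 E v. tail_op \<tau> t\<^sub>0 t\<^sub>1 E \<longrightarrow> E (c v) = c (E v))"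

lemma tail_commutingI:
  assumes "c \<in> bounded_ops UNIV" "\<And>t\<^sub>0 t\<^sub>1 E v. tail_op \<tau> t\<^sub>0 t\<^sub>1 E \<Longrightarrow> E (c v) = c (E v)"
  shows "tail_commuting \<tau> c"
  using assms unfolding tail_commuting_def by blast

lemma tail_commutingD:
  assumes "tail_commuting \<tau> c"
  shows "c \<in> bounded_ops UNIV" "tail_op \<tau> t\<^sub>0 t\<^sub>1 E \<Longrightarrow> E (c v) = c (E v)"
  using assms unfolding tail_commuting_def by blast+

lemma tail_commuting_comp:
  assumes c: "tail_commuting \<tau> c" and d: "tail_commuting \<tau> d"
  shows "tail_commuting \<tau> (c \<circ> d)"
proof (rule tail_commutingI)
  show "c \<circ> d \<in> bounded_ops UNIV" by (rule bounded_ops_comp[OF tail_commutingD(1)[OF c] tail_commutingD(1)[OF d]])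
  fix t\<^sub>0 t\<^sub>1 E v assume E: "tail_op \<tau> t\<^sub>0 t\<^sub>1 E"
  show "E ((c \<circ> d) v) = (c \<circ> d) (E v)" by (simp add: tail_commutingD(2)[OF c E] tail_commutingD(2)[OF d E])
qed

lemma tail_commuting_zero: "tail_commuting \<tau> (\<lambda>v. 0)"
  by (rule tail_commutingI[OF bounded_ops_linear_intros(2)]) (simp add: bounded_opsD(7)[OF tail_opD(1)])

lemma tail_commuting_add:
  assumes c: "tail_commuting \<tau> c" and d: "tail_commuting \<tau> d"
  shows "tail_commuting \<tau> (\<lambda>v. c v + d v)"
proof (rule tail_commutingI)
  show "(\<lambda>v. c v + d v) \<in> bounded_ops UNIV"
    by (rule bounded_ops_linear_intros(3)[OF tail_commutingD(1)[OF c] tail_commutingD(1)[OF d]])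
  fix t\<^sub>0 t\<^sub>1 E v assume E: "tail_op \<tau> t\<^sub>0 t\<^sub>1 E"
  show "E (c v + d v) = c (E v) + d (E v)"
    by (simp add: bounded_opsD(5)[OF tail_opD(1)[OF E]] tail_commutingD(2)[OF c E] tail_commutingD(2)[OF d E])
qed

lemma tail_commuting_scale:
  assumes c: "tail_commuting \<tau> c"
  shows "tail_commuting \<tau> (\<lambda>v. r *\<^sub>C c v)"
proof (rule tail_commutingI)
  show "(\<lambda>v. r *\<^sub>C c v) \<in> bounded_ops UNIV"
    by (rule bounded_ops_linear_intros(5)[OF tail_commutingD(1)[OF c]])
  fix t\<^sub>0 t\<^sub>1 E v assume E: "tail_op \<tau> t\<^sub>0 t\<^sub>1 E"
  show "E (r *\<^sub>C c v) = r *\<^sub>C c (E v)"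
    by (simp add: bounded_opsD(2)[OF tail_opD(1)[OF E]] tail_commutingD(2)[OF c E])
qed

lemma tail_commuting_diff:
  assumes c: "tail_commuting \<tau> c" and d: "tail_commuting \<tau> d"
  shows "tail_commuting \<tau> (\<lambda>v. c v - d v)"
proof (rule tail_commutingI)
  show "(\<lambda>v. c v - d v) \<in> bounded_ops UNIV"
    by (rule bounded_ops_linear_intros(4)[OF tail_commutingD(1)[OF c] tail_commutingD(1)[OF d]])
  fix t\<^sub>0 t\<^sub>1 E v assume E: "tail_op \<tau> t\<^sub>0 t\<^sub>1 E"
  show "E (c v - d v) = c (E v) - d (E v)"
    by (simp add: bounded_opsD(6)[OF tail_opD(1)[OF E]] tail_commutingD(2)[OF c E] tail_commutingD(2)[OF d E])
qed

lemma tail_commuting_gen_alg: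
  assumes c: "c \<in> gen_alg S" and S: "\<And>s. s \<in> S \<Longrightarrow> tail_commuting \<tau> s"
  shows "tail_commuting \<tau> c"
  using c
  by (induction rule: gen_alg.induct)
     (assumption | rule S tail_commuting_zero tail_commuting_add tail_commuting_scale tail_commuting_comp)+

text \<open>A tail operator exchanges entries of a word but keeps its type, and projections onto
  type spaces only look at the type.\<close>

lemma tail_commuting_proj: "tail_commuting \<tau> (proj (type_space A))"
proof (rule tail_commutingI)
  let ?P = "proj (type_space A)"
  show P: "?P \<in> bounded_ops UNIV" by (rule bounded_opsD(8)[OF proj_bounded_ops[OF closed_type_space]])
  fix t\<^sub>0 t\<^sub>1 E v assume E: "tail_op \<tau> t\<^sub>0 t\<^sub>1 E"
  have sub: "type_space A \<subseteq> total" unfolding total_eq by (rule type_space_mono) simp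
  have "(E \<circ> ?P) v = (?P \<circ> E) v"
  proof (rule total_ops_eqI[of "E \<circ> ?P" "?P \<circ> E"])
    show "E \<circ> ?P \<in> bounded_ops UNIV" "?P \<circ> E \<in> bounded_ops UNIV"
      using P tail_opD(1)[OF E] by (simp_all add: bounded_ops_comp)
    show "(E \<circ> ?P) (proj total v) = (E \<circ> ?P) v" for v
      by (simp add: proj_proj_subset(1)[OF closed_type_space closed_total sub])
    show "(?P \<circ> E) (proj total v) = (?P \<circ> E) v" for v
      by (simp add: tail_opD(2)[OF E])
    fix w assume w: "w \<in> words H \<xi>"
    show "(E \<circ> ?P) (T w) = (?P \<circ> E) (T w)"
    proof (cases "\<exists>\<sigma>. map fst w = \<sigma> @ \<tau>")
      case True
      then obtain s t where st: "w = s @ t" "map fst t = \<tau>" by (auto simp: map_eq_append_conv)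
      have w': "s @ t\<^sub>1 \<in> words H \<xi>"
        using w st tail_opD(6,7)[OF E] by (intro words_replace_tail[of s t t\<^sub>1]) auto
      have "map fst (s @ t\<^sub>1) = map fst (s @ t)" using st tail_opD(7)[OF E] by simp
      then show ?thesis
        using proj_type_space_T[OF w, of A] proj_type_space_T[OF w', of A] tail_opD(3)[OF E, of s t] w st
        by (simp add: bounded_opsD(2,7)[OF P] bounded_opsD(7)[OF tail_opD(1)[OF E]])
    next
      case False
      then show ?thesis
        using tail_op_T_zero[OF E w] proj_type_space_T[OF w, of A]
        by (simp add: bounded_opsD(7)[OF P] bounded_opsD(7)[OF tail_opD(1)[OF E]])
    qed
  qed
  then show "E (?P v) = ?P (E v)" by simp
qed

lemma tail_op_rank_one:
  assumes E: "tail_op \<tau> t\<^sub>0 t\<^sub>1 E" and v: "v \<in> type_space {\<tau>}"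
  shows "E v = cinner v (T t\<^sub>0) *\<^sub>C T t\<^sub>1"
  using v
proof (rule type_space_induct)
  show "closed_csubspace {v. E v = cinner v (T t\<^sub>0) *\<^sub>C T t\<^sub>1}"
    by (rule closed_csubspace_equalizer[OF tail_opD(1)[OF E] bounded_ops_rank_one])
  fix w assume w: "w \<in> words H \<xi>" "map fst w \<in> {\<tau>}"
  show "E (T w) = cinner (T w) (T t\<^sub>0) *\<^sub>C T t\<^sub>1"
    using tail_opD(3)[OF E, of "[]" w] w by simp
qed

text \<open>Schur's lemma, the operators of \<^const>\<open>tail_op\<close> being matrix units on the last factors.\<close>

lemma tail_commuting_scalar:
  assumes c: "tail_commuting \<tau> c" and \<zeta>: "\<zeta> \<in> type_space {\<tau>}" "norm \<zeta> = 1" and q: "q \<in> type_space {\<tau>}"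
  shows "proj (type_space {\<tau>}) (c q) = cinner (c \<zeta>) \<zeta> *\<^sub>C q"
proof -
  let ?V = "type_space {\<tau>}"
  define c0 where "c0 = proj ?V \<circ> c"
  have c0: "tail_commuting \<tau> c0"
    unfolding c0_def by (rule tail_commuting_comp[OF tail_commuting_proj c])
  note b0 = tail_commutingD(1)[OF c0]
  have V: "closed_csubspace ?V" by (rule closed_type_space)
  have c0V: "c0 v \<in> ?V" for v unfolding c0_def using proj_in[OF V] by simp
  \<comment> \<open>Both sides are the value of E c0 = c0 E at \<zeta>, where E sends T t0 direction
    to T t1, computed in the two orders.\<close>
  have TT: "cinner \<zeta> (T t\<^sub>0) *\<^sub>C c0 (T t\<^sub>1) = cinner (c0 \<zeta>) (T t\<^sub>0) *\<^sub>C T t\<^sub>1"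
    if t: "t\<^sub>0 \<in> words H \<xi>" "map fst t\<^sub>0 = \<tau>" "t\<^sub>1 \<in> words H \<xi>" "map fst t\<^sub>1 = \<tau>" for t\<^sub>0 t\<^sub>1
  proof -
    obtain E where E: "tail_op \<tau> t\<^sub>0 t\<^sub>1 E" using tail_op_exists[OF t] by blast
    have "E (c0 \<zeta>) = c0 (E \<zeta>)" by (rule tail_commutingD(2)[OF c0 E])
    then show ?thesis
      by (simp add: tail_op_rank_one[OF E c0V] tail_op_rank_one[OF E \<zeta>(1)] bounded_opsD(2)[OF b0])
  qed
  have Tq: "cinner \<zeta> (T t\<^sub>0) *\<^sub>C c0 q = cinner (c0 \<zeta>) (T t\<^sub>0) *\<^sub>C q"
    if t: "t\<^sub>0 \<in> words H \<xi>" "map fst t\<^sub>0 = \<tau>" for t\<^sub>0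
    using q
  proof (rule type_space_induct)
    show "closed_csubspace {q. cinner \<zeta> (T t\<^sub>0) *\<^sub>C c0 q = cinner (c0 \<zeta>) (T t\<^sub>0) *\<^sub>C q}"
      by (intro closed_csubspace_equalizer bounded_ops_linear_intros b0)
  qed (use TT t in auto)
  have eq: "cinner (c0 q) u = cinner (c0 \<zeta>) \<zeta> * cinner q u" for u
  proof -
    \<comment> \<open>The preceding identity, paired with \<open>u\<close>, says that this vector is
      orthogonal to every elementary tensor of the level. Hence it is orthogonal to \<zeta> itself,
      and norm \<zeta> = 1 isolates the scalar.\<close>
    let ?z = "cinner (c0 q) u *\<^sub>C \<zeta> - cinner q u *\<^sub>C c0 \<zeta>"
    have "\<forall>z\<in>{?z}. cinner \<zeta> z = 0"
      using \<zeta>(1)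
    proof (rule type_space_induct[OF _ closed_csubspace_ortho])
      fix w assume w: "w \<in> words H \<xi>" "map fst w \<in> {\<tau>}"
      have "cinner (cinner \<zeta> (T w) *\<^sub>C c0 q) u = cinner (cinner (c0 \<zeta>) (T w) *\<^sub>C q) u"
        using Tq[of w] w by simp
      then have "cinner ?z (T w) = 0"
        by (simp add: cinner_diff_left cinner_scaleC_left mult.commute)
      then show "\<forall>z\<in>{?z}. cinner (T w) z = 0" using cinner_eq_zero_commute by blast
    qed
    then have "cinner ?z \<zeta> = 0" using cinner_eq_zero_commute by blast
    then show ?thesis
      by (simp add: cinner_diff_left cinner_scaleC_left cinner_self[of \<zeta>] \<zeta>(2) mult.commute)
  qed
  have "cinner (c0 \<zeta>) \<zeta> = cinner (c \<zeta>) \<zeta>"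
    unfolding c0_def using cinner_proj_left[OF V \<zeta>(1)] by simp
  then have "cinner (c0 q - cinner (c \<zeta>) \<zeta> *\<^sub>C q) u = 0" for u
    using eq[of u] by (simp add: cinner_diff_left cinner_scaleC_left)
  from this[of "c0 q - cinner (c \<zeta>) \<zeta> *\<^sub>C q"] have "c0 q - cinner (c \<zeta>) \<zeta> *\<^sub>C q = 0"
    by (simp only: cinner_self) simp
  then show ?thesis by (simp add: c0_def)
qed

end

section \<open>The compressed operators on the summands, their strong sums, and their
  relations\<close>

lemma level_type_add: "\<exists>\<sigma>. level_type \<kappa> (n + 2 * k) = \<sigma> @ level_type \<kappa> n"
proof (induction k)
  case (Suc k)
  then obtain \<sigma> where "level_type \<kappa> (n + 2 * k) = \<sigma> @ level_type \<kappa> n" by blast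
  then have "level_type \<kappa> (n + 2 * Suc k) = (bar \<kappa> # \<kappa> # \<sigma>) @ level_type \<kappa> n" by simp
  then show ?case by blast
qed simp

locale free_product_operators = free_product H \<xi> T
  for H :: "side \<Rightarrow> 'a::complex_hilbert set" and \<xi> :: "side \<Rightarrow> 'a"
    and T :: "(side \<times> 'a) list \<Rightarrow> 'h::complex_hilbert" +
  fixes a :: "side \<Rightarrow> 'a \<Rightarrow> 'a"
  assumes a: "a \<kappa> \<in> bounded_ops (H \<kappa>)"
begin

lemma X_free_bounded_ops: "X_free a \<kappa> \<in> bounded_ops total"
  unfolding X_free_def by (rule rep_bounded_ops[OF a])

lemma P_bounded_ops: "P \<kappa> j \<in> bounded_ops (summand \<kappa> j)"
  unfolding P_def by (rule proj_bounded_ops[OF closed_summand])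

lemma x_op_bounded_ops: "x_op a \<kappa> j \<in> bounded_ops (summand \<kappa> j)"
proof -
  note P = bounded_opsD[OF P_bounded_ops[of \<kappa> j]] and X = bounded_opsD[OF X_free_bounded_ops[of \<kappa>]]
  have "X_op a \<kappa> j \<in> bounded_ops UNIV" unfolding X_op_def by (intro bounded_ops_comp P(8) X(8))
  then have "x_op a \<kappa> j \<in> bounded_ops UNIV"
    unfolding x_op_def by (rule bounded_ops_linear_intros(4)[OF _ P(8)])
  moreover have "x_op a \<kappa> j v \<in> summand \<kappa> j" for v
    unfolding x_op_def X_op_def comp_apply by (rule closed_csubspaceD(5)[OF closed_summand P(3) P(3)])
  moreover have "x_op a \<kappa> j v = 0" if "\<forall>q\<in>summand \<kappa> j. cinner v q = 0" for v
  proof -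
    have "P \<kappa> j v = 0" by (rule P(4)) (use that in blast)
    then show ?thesis by (simp add: x_op_def X_op_def P(7) X(7))
  qed
  ultimately show ?thesis unfolding bounded_ops_def by blast
qed

text \<open>The bound is uniform in \<open>j\<close>, because compressing by projections does not
  increase norms; the infinite sum depends on this.\<close>

lemma x_op_norm_bound: "\<exists>K\<ge>0. \<forall>j v. norm (x_op a \<kappa> j v) \<le> K * norm v"
proof -
  obtain K where K: "\<And>v. norm (X_free a \<kappa> v) \<le> norm v * K" "K \<ge> 0"
    using bounded_linear.nonneg_bounded[OF bounded_opsD(1)[OF X_free_bounded_ops]] by blast
  have "norm (x_op a \<kappa> j v) \<le> (K + 1) * norm v" for j v
  proof -
    have P1: "norm (P \<kappa> j u) \<le> norm u" for u
      unfolding P_def by (rule norm_proj_le[OF closed_summand])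
    have "norm (X_op a \<kappa> j v) \<le> norm (X_free a \<kappa> (P \<kappa> j v))"
      unfolding X_op_def comp_apply by (rule P1)
    also have "\<dots> \<le> norm (P \<kappa> j v) * K" by (rule K)
    also have "\<dots> \<le> norm v * K" by (rule mult_right_mono[OF P1 K(2)])
    finally have "norm (X_op a \<kappa> j v) \<le> norm v * K" .
    moreover have "norm (x_op a \<kappa> j v) \<le> norm (X_op a \<kappa> j v) + norm (P \<kappa> j v)"
      unfolding x_op_def by (rule norm_triangle_ineq4)
    ultimately show ?thesis using P1[of v] by (simp add: algebra_simps)
  qed
  then show ?thesis using K(2) by (intro exI[of _ "K + 1"]) simp
qed

text \<open>On this summand every word is a join of a vector of H \<kappa> with a word of type
  \<open>level_type \<kappa> n\<close>, and \<tau> is a suffix of that type. So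
  \<open>X_free\<close> acts in front of the factors on which \<open>E\<close> acts. On shorter
  words the two could meet in one factor, hence the restriction on \<open>u\<close>.\<close>

lemma X_free_tail_commute:
  assumes E: "tail_op \<tau> t\<^sub>0 t\<^sub>1 E" and \<tau>: "level_type \<kappa> n = \<sigma> @ \<tau>" and u: "u \<in> summand \<kappa> (Suc n)"
  shows "E (X_free a \<kappa> u) = X_free a \<kappa> (E u)"
proof -
  note bE = tail_opD(1)[OF E]
  have bX: "X_free a \<kappa> \<in> bounded_ops UNIV" by (rule bounded_opsD(8)[OF X_free_bounded_ops])
  have X_join: "X_free a \<kappa> (join \<kappa> h w) = join \<kappa> (a \<kappa> h) w" if "h \<in> H \<kappa>" "w \<in> words_avoiding \<kappa>" for h w
    unfolding X_free_def by (rule rep_join[OF a that])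
  have E_join: "E (join \<kappa> h (s @ t)) = cinner (T t) (T t\<^sub>0) *\<^sub>C join \<kappa> h (s @ t\<^sub>1)"
    if "h \<in> H \<kappa>" "s @ t \<in> words_avoiding \<kappa>" "map fst t = \<tau>" for h s t
  proof -
    let ?k = "h - cinner h (\<xi> \<kappa>) *\<^sub>C \<xi> \<kappa>"
    have "((\<kappa>, ?k) # s) @ t \<in> words H \<xi>"
      using words_avoiding_Cons[OF that(2) centered_part[OF that(1)]] by simp
    from tail_opD(3)[OF E this that(3)]
    have "E (T ((\<kappa>, ?k) # s @ t)) = cinner (T t) (T t\<^sub>0) *\<^sub>C T ((\<kappa>, ?k) # s @ t\<^sub>1)" by simp
    moreover have "E (T (s @ t)) = cinner (T t) (T t\<^sub>0) *\<^sub>C T (s @ t\<^sub>1)"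
      by (rule tail_opD(3)[OF E words_avoiding_words[OF that(2)] that(3)])
    ultimately show ?thesis
      unfolding join_def by (simp add: bounded_opsD(2,5)[OF bE] scaleC_add_right scaleC_scaleC mult.commute)
  qed
  have "(E \<circ> X_free a \<kappa>) u = (X_free a \<kappa> \<circ> E) u"
    using u unfolding summand_eq
  proof (rule type_space_induct)
    show "closed_csubspace {u. (E \<circ> X_free a \<kappa>) u = (X_free a \<kappa> \<circ> E) u}"
      by (rule closed_csubspace_equalizer[OF bounded_ops_comp[OF bE bX] bounded_ops_comp[OF bX bE]])
    fix w assume w: "w \<in> words H \<xi>" "map fst w \<in> {level_type \<kappa> n, \<kappa> # level_type \<kappa> n}"
    obtain h w' where h: "h \<in> H \<kappa>" "w' \<in> words_avoiding \<kappa>" "T w = join \<kappa> h w'" "w' = w \<or> w = (\<kappa>, h) # w'"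
      by (rule T_as_join[OF w(1)])
    \<comment> \<open>A word of the shorter type cannot begin with a letter of side \<kappa>, so a
      split-off first letter forces the longer type.\<close>
    have avoid: "level_type \<kappa> n \<noteq> \<kappa> # \<rho>" for \<rho> using level_type_iff[of "\<kappa> # \<rho>" \<kappa> n] by auto
    have "map fst w' = level_type \<kappa> n"
    proof (rule disjE[OF h(4)])
      assume "w' = w"
      moreover have "map fst w' \<noteq> \<kappa> # level_type \<kappa> n"
        using h(2) by (cases w') (auto simp: words_avoiding_def)
      ultimately show ?thesis using w(2) by simp
    next
      assume "w = (\<kappa>, h) # w'"
      then show ?thesis using w(2) avoid by (metis empty_iff fst_conv insert_iff list.inject list.simps(9))
    qed
    then have "map fst w' = \<sigma> @ \<tau>" using \<tau> by simp
    then obtain s t where st: "w' = s @ t" "map fst t = \<tau>" by (auto simp: map_eq_append_conv)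
    have s1: "s @ t\<^sub>1 \<in> words_avoiding \<kappa>"
    proof -
      have "s @ t\<^sub>1 \<in> words H \<xi>"
        using words_avoiding_words[OF h(2)] st tail_opD(6,7)[OF E] by (intro words_replace_tail[of s t t\<^sub>1]) auto
      moreover have "map fst (s @ t\<^sub>1) = level_type \<kappa> n"
        using tail_opD(7)[OF E] st \<open>map fst w' = level_type \<kappa> n\<close> by simp
      then have "s @ t\<^sub>1 = [] \<or> fst (hd (s @ t\<^sub>1)) \<noteq> \<kappa>"
        using level_type_iff[of "map fst (s @ t\<^sub>1)" \<kappa> n] by (metis hd_map map_is_Nil_conv)
      ultimately show ?thesis by (simp add: words_avoiding_def)
    qed
    have ah: "a \<kappa> h \<in> H \<kappa>" by (rule bounded_opsD(3)[OF a])
    have w2: "s @ t \<in> words_avoiding \<kappa>" using h(2) st by simp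
    show "(E \<circ> X_free a \<kappa>) (T w) = (X_free a \<kappa> \<circ> E) (T w)"
      unfolding comp_apply h(3) st(1) X_join[OF h(1) w2] E_join[OF h(1) w2 st(2)] E_join[OF ah w2 st(2)]
        bounded_opsD(2)[OF bX] X_join[OF h(1) s1] ..
  qed
  then show ?thesis by simp
qed

lemma tail_commuting_x_op:
  assumes \<tau>: "level_type \<kappa> n = \<sigma> @ \<tau>"
  shows "tail_commuting \<tau> (x_op a \<kappa> (Suc n))"
proof (rule tail_commutingI)
  show "x_op a \<kappa> (Suc n) \<in> bounded_ops UNIV" by (rule bounded_opsD(8)[OF x_op_bounded_ops])
  fix t\<^sub>0 t\<^sub>1 E v assume E: "tail_op \<tau> t\<^sub>0 t\<^sub>1 E"
  have "tail_commuting \<tau> (P \<kappa> (Suc n))"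
    unfolding P_def summand_eq by (rule tail_commuting_proj)
  then have P: "E (P \<kappa> (Suc n) v) = P \<kappa> (Suc n) (E v)" for v using tail_commutingD(2) E by blast
  have "P \<kappa> (Suc n) v \<in> summand \<kappa> (Suc n)" by (rule bounded_opsD(3)[OF P_bounded_ops])
  from X_free_tail_commute[OF E \<tau> this]
  show "E (x_op a \<kappa> (Suc n) v) = x_op a \<kappa> (Suc n) (E v)"
    by (simp add: x_op_def X_op_def bounded_opsD(6)[OF tail_opD(1)[OF E]] P)
qed

lemma x_op_orthogonal_range:
  assumes "\<And>q. q \<in> summand \<kappa> j \<Longrightarrow> cinner u q = 0"
  shows "x_op a \<kappa> j u = 0" "cinner (x_op a \<kappa> j v) u = 0"
proof -
  show "x_op a \<kappa> j u = 0" by (rule bounded_opsD(4)[OF x_op_bounded_ops assms])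
  show "cinner (x_op a \<kappa> j v) u = 0"
    using assms[OF bounded_opsD(3)[OF x_op_bounded_ops]] cinner_eq_zero_commute by blast
qed

lemma summand_orthogonal_short:
  assumes "u \<in> type_space {\<rho>}" "length \<rho> + 1 < j" "q \<in> summand \<kappa> j"
  shows "cinner u q = 0"
proof -
  obtain n where n: "j = Suc n" using assms(2) by (cases j) auto
  have "{\<rho>} \<inter> {level_type \<kappa> n, \<kappa> # level_type \<kappa> n} = {}" using assms(2) n by auto
  then show ?thesis using assms(1,3) unfolding n summand_eq by (rule type_space_orthogonal)
qed

text \<open>Words of the i-th summand have length i - 1 or i, so a gap of two between the indices
  separates the summands by length. Different elements of \<open>J m\<close> have such a
  gap.\<close>

lemma summand_orthogonal:
  assumes "1 \<le> i" "i + 1 < j" "u \<in> summand \<kappa> i" "v \<in> summand \<kappa> j"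
  shows "cinner u v = 0"
proof -
  obtain n k where n: "i = Suc n" "j = Suc k" using assms(1,2) by (cases i; cases j) auto
  have "{level_type \<kappa> n, \<kappa> # level_type \<kappa> n} \<inter> {level_type \<kappa> k, \<kappa> # level_type \<kappa> k} = {}"
  proof -
    have "length \<rho> \<noteq> length \<rho>'" if "\<rho> \<in> {level_type \<kappa> n, \<kappa> # level_type \<kappa> n}"
      "\<rho>' \<in> {level_type \<kappa> k, \<kappa> # level_type \<kappa> k}" for \<rho> \<rho>'
      using that assms(2) n by auto
    then show ?thesis by blast
  qed
  then show ?thesis using assms(3,4) unfolding n summand_eq by (rule type_space_orthogonal)
qed

lemma J_gap: "i \<in> J m \<Longrightarrow> j \<in> J m \<Longrightarrow> i < j \<Longrightarrow> i + 1 < j"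
  by (auto simp: J_def)

lemma J_ge: "i \<in> J m \<Longrightarrow> m \<le> i"
  by (auto simp: J_def)

lemma orthogonal_blocks_x_op:
  assumes m: "1 \<le> m"
  shows "\<exists>K. orthogonal_blocks (summand \<kappa>) (J m) (x_op a \<kappa>) K"
proof -
  obtain K where K: "K \<ge> 0" "\<forall>j v. norm (x_op a \<kappa> j v) \<le> K * norm v" using x_op_norm_bound by blast
  have "orthogonal_blocks (summand \<kappa>) (J m) (x_op a \<kappa>) K"
  proof
    fix i j u v assume ij: "i \<in> J m" "j \<in> J m" "i \<noteq> j" "u \<in> summand \<kappa> i" "v \<in> summand \<kappa> j"
    have "1 \<le> i" "1 \<le> j" using J_ge ij m order_trans by blast+
    show "cinner u v = 0"
    proof (cases "i < j")
      case True
      show ?thesis by (rule summand_orthogonal[OF \<open>1 \<le> i\<close> J_gap[OF ij(1,2) True] ij(4,5)])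
    next
      case False
      then have "j < i" using ij(3) by simp
      then have "cinner v u = 0" by (rule summand_orthogonal[OF \<open>1 \<le> j\<close> J_gap[OF ij(2,1)] ij(5,4)])
      then show ?thesis using cinner_eq_zero_commute by blast
    qed
  qed (use K closed_summand x_op_bounded_ops in auto)
  then show ?thesis by blast
qed

lemma space_of_add: "space_of \<kappa> (m + 2 * k) = space_of \<kappa> m"
  by (induction k) (simp_all add: space_of_Suc)

lemma summand_subset_space_of_J:
  assumes "1 \<le> m" "i \<in> J m"
  shows "summand \<kappa> i \<subseteq> space_of \<kappa> m"
proof -
  obtain k where k: "i = m + 2 * k" using assms(2) by (auto simp: J_def)
  show ?thesis using summand_subset_space_of[of i \<kappa>] assms(1) unfolding k by (simp add: space_of_add)
qed

lemma unit_x_op: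
  assumes "1 \<le> m" "i \<in> J m"
  shows "unit_of \<kappa> m (x_op a \<kappa> i v) = x_op a \<kappa> i v" "x_op a \<kappa> i (unit_of \<kappa> m v) = x_op a \<kappa> i v"
proof -
  have sub: "summand \<kappa> i \<subseteq> space_of \<kappa> m" by (rule summand_subset_space_of_J[OF assms])
  show "unit_of \<kappa> m (x_op a \<kappa> i v) = x_op a \<kappa> i v"
    unfolding unit_of_def using sub bounded_opsD(3)[OF x_op_bounded_ops]
    by (intro proj_id[OF closed_space_of]) blast
  show "x_op a \<kappa> i (unit_of \<kappa> m v) = x_op a \<kappa> i v"
    unfolding unit_of_def
    by (rule bounded_ops_proj_right[OF bounded_ops_mono[OF x_op_bounded_ops sub] closed_space_of])
qed

lemma unit_bounded_ops: "unit_of \<kappa> m \<in> bounded_ops (space_of \<kappa> m)"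
  unfolding unit_of_def by (rule proj_bounded_ops[OF closed_space_of])

lemma R_op_bounded_ops:
  assumes m: "1 \<le> m"
  shows "R_op a \<kappa> m \<in> bounded_ops (space_of \<kappa> m)"
proof -
  obtain K where "orthogonal_blocks (summand \<kappa>) (J m) (x_op a \<kappa>) K" using orthogonal_blocks_x_op[OF m] ..
  then interpret B: orthogonal_blocks "summand \<kappa>" "J m" "x_op a \<kappa>" K .
  note e = bounded_opsD[OF unit_bounded_ops[of \<kappa> m]]
  have R: "R_op a \<kappa> m v = unit_of \<kappa> m v + B.block_sum v" for v
    by (simp add: R_op_def B.block_sum_def)
  have sum_unit: "B.block_sum (unit_of \<kappa> m v) = B.block_sum v" for v
    unfolding B.block_sum_def by (rule infsum_cong) (rule unit_x_op(2)[OF m])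
  have unit_sum: "unit_of \<kappa> m (B.block_sum v) = B.block_sum v" for v
    using B.block_sum_commute[OF e(8), of v] by (simp add: unit_x_op[OF m] sum_unit)
  have "R_op a \<kappa> m \<in> bounded_ops UNIV"
    using bounded_ops_linear_intros(3)[OF e(8) B.block_sum_bounded_ops] by (simp add: R_op_def B.block_sum_def)
  moreover have "R_op a \<kappa> m v \<in> space_of \<kappa> m" for v
  proof -
    have "R_op a \<kappa> m v = unit_of \<kappa> m v + unit_of \<kappa> m (B.block_sum v)" by (simp add: R unit_sum)
    then show ?thesis using closed_csubspaceD(3)[OF closed_space_of e(3) e(3)] by simp
  qed
  moreover have "R_op a \<kappa> m v = 0" if "\<forall>q\<in>space_of \<kappa> m. cinner v q = 0" for v
  proof -
    have 0: "unit_of \<kappa> m v = 0" by (rule e(4)) (use that in blast)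
    then have "B.block_sum v = 0"
      using sum_unit[of v] bounded_opsD(7)[OF B.block_sum_bounded_ops] by simp
    then show ?thesis by (simp add: R 0)
  qed
  ultimately show ?thesis unfolding bounded_ops_def by blast
qed

lemma R_op_commute:
  assumes m: "1 \<le> m" and C: "C \<in> bounded_ops UNIV"
    and unit: "\<And>v. C (unit_of \<kappa> m v) = unit_of \<kappa> m (C v)"
    and x: "\<And>i v. i \<in> J m \<Longrightarrow> C (x_op a \<kappa> i v) = x_op a \<kappa> i (C v)"
  shows "C (R_op a \<kappa> m v) = R_op a \<kappa> m (C v)"
proof -
  obtain K where "orthogonal_blocks (summand \<kappa>) (J m) (x_op a \<kappa>) K" using orthogonal_blocks_x_op[OF m] ..
  then interpret B: orthogonal_blocks "summand \<kappa>" "J m" "x_op a \<kappa>" K .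
  have "C (B.block_sum v) = B.block_sum (C v)" by (rule B.block_sum_commute[OF C x])
  then show ?thesis by (simp add: R_op_def B.block_sum_def[symmetric] bounded_opsD(5)[OF C] unit)
qed

lemma tail_commuting_unit: "tail_commuting \<tau> (unit_of \<kappa> m)"
  unfolding unit_of_def space_of_eq by (rule tail_commuting_proj)

text \<open>Raising the level by an even number only prepends letters, by
  \<open>level_type_add\<close>. Hence \<tau> is a suffix for all summands indexed by
  \<open>J m\<close>, and one family of tail operators commutes with every term of the sum.\<close>

lemma tail_commuting_R_op:
  assumes m: "1 \<le> m" and \<tau>: "level_type \<kappa> (m - 1) = \<sigma> @ \<tau>"
  shows "tail_commuting \<tau> (R_op a \<kappa> m)"
proof (rule tail_commutingI)
  show "R_op a \<kappa> m \<in> bounded_ops UNIV" by (rule bounded_opsD(8)[OF R_op_bounded_ops[OF m]])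
  fix t\<^sub>0 t\<^sub>1 E v assume E: "tail_op \<tau> t\<^sub>0 t\<^sub>1 E"
  show "E (R_op a \<kappa> m v) = R_op a \<kappa> m (E v)"
  proof (rule R_op_commute[OF m tail_opD(1)[OF E] tail_commutingD(2)[OF tail_commuting_unit E]])
    fix i v assume "i \<in> J m"
    then obtain k where k: "i = m + 2 * k" by (auto simp: J_def)
    obtain \<rho> where "level_type \<kappa> (m - 1 + 2 * k) = \<rho> @ level_type \<kappa> (m - 1)" using level_type_add by blast
    then have "level_type \<kappa> (m - 1 + 2 * k) = (\<rho> @ \<sigma>) @ \<tau>" using \<tau> by simp
    then have "tail_commuting \<tau> (x_op a \<kappa> (Suc (m - 1 + 2 * k)))" by (rule tail_commuting_x_op)
    moreover have "Suc (m - 1 + 2 * k) = i" using k m by simp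
    ultimately show "E (x_op a \<kappa> i v) = x_op a \<kappa> i (E v)" using tail_commutingD(2) E by metis
  qed
qed

text \<open>Words of summands with index at least \<open>m\<close> have length at least m - 1, so
  \<open>u\<close> is orthogonal to all of them and only the unit acts. The second claim is the
  statement about the adjoint, phrased without adjoints.\<close>

lemma R_op_short:
  assumes m: "1 \<le> m" and u: "u \<in> type_space {\<rho>}" "u \<in> space_of \<kappa> m" and \<rho>: "length \<rho> + 1 < m"
  shows "R_op a \<kappa> m u = u" "cinner (R_op a \<kappa> m v) u = cinner v u"
proof -
  obtain K where "orthogonal_blocks (summand \<kappa>) (J m) (x_op a \<kappa>) K" using orthogonal_blocks_x_op[OF m] ..
  then interpret B: orthogonal_blocks "summand \<kappa>" "J m" "x_op a \<kappa>" K .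
  have orth: "cinner u q = 0" if "i \<in> J m" "q \<in> summand \<kappa> i" for i q
    by (rule summand_orthogonal_short[OF u(1) _ that(2)]) (use \<rho> J_ge[OF that(1)] in simp)
  have "B.block_sum u = 0" by (rule B.block_sum_zero) (rule x_op_orthogonal_range(1)[OF orth])
  moreover have "unit_of \<kappa> m u = u" unfolding unit_of_def by (rule proj_id[OF closed_space_of u(2)])
  ultimately show "R_op a \<kappa> m u = u" by (simp add: R_op_def B.block_sum_def)
  have "cinner (B.block_sum v) u = 0"
    by (rule B.cinner_block_sum_zero) (rule x_op_orthogonal_range(2)[OF orth])
  moreover have "cinner (unit_of \<kappa> m v) u = cinner v u"
    unfolding unit_of_def by (rule cinner_proj_left[OF closed_space_of u(2)])
  ultimately show "cinner (R_op a \<kappa> m v) u = cinner v u"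
    by (simp add: R_op_def B.block_sum_def cinner_add_left)
qed

lemma x_op_x_op:
  assumes "1 \<le> i" "1 \<le> j" "i + 1 < j \<or> j + 1 < i"
  shows "x_op a \<kappa> i (x_op a \<kappa> j v) = 0"
proof (rule x_op_orthogonal_range(1))
  fix q assume q: "q \<in> summand \<kappa> i"
  have "x_op a \<kappa> j v \<in> summand \<kappa> j" by (rule bounded_opsD(3)[OF x_op_bounded_ops])
  then show "cinner (x_op a \<kappa> j v) q = 0"
    using assms summand_orthogonal q cinner_eq_zero_commute by metis
qed

lemma Z_op_bounded_ops:
  assumes m: "1 \<le> m"
  shows "Z_op a \<kappa> m \<in> bounded_ops UNIV"
  unfolding Z_op_def
  by (rule bounded_ops_linear_intros(3)[OF bounded_opsD(8)[OF unit_bounded_ops] bounded_opsD(8)[OF x_op_bounded_ops]])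

text \<open>Let x be the term of index \<open>m\<close> and s the sum of the others. They live on
  orthogonal blocks, so s x = x s = 0 and (1 + s)(1 + x) = (1 + x)(1 + s) = 1 + x + s.\<close>

lemma R_op_Z_op:
  assumes m: "1 \<le> m"
  shows "R_op a \<kappa> m v = R_op a \<kappa> (m + 2) (Z_op a \<kappa> m v)"
    "Z_op a \<kappa> m (R_op a \<kappa> (m + 2) v) = R_op a \<kappa> (m + 2) (Z_op a \<kappa> m v)"
proof -
  have m2: "1 \<le> m + 2" and mJ: "m \<in> J m" by (auto simp: J_def)
  have sp: "unit_of \<kappa> (m + 2) = unit_of \<kappa> m" using space_of_add[of \<kappa> m 1] by (simp add: unit_of_def)
  obtain K where "orthogonal_blocks (summand \<kappa>) (J (m + 2)) (x_op a \<kappa>) K" using orthogonal_blocks_x_op[OF m2] ..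
  then interpret B: orthogonal_blocks "summand \<kappa>" "J (m + 2)" "x_op a \<kappa>" K .
  have ge: "m + 1 < i" "1 \<le> i" if "i \<in> J (m + 2)" for i using J_ge[OF that] by auto
  note e = bounded_opsD[OF unit_bounded_ops[of \<kappa> m]]
  have ee: "unit_of \<kappa> m (unit_of \<kappa> m v) = unit_of \<kappa> m v" for v
    unfolding unit_of_def by (rule proj_id[OF closed_space_of proj_in[OF closed_space_of]])
  have xe: "x_op a \<kappa> i (unit_of \<kappa> m v) = x_op a \<kappa> i v" "unit_of \<kappa> m (x_op a \<kappa> i v) = x_op a \<kappa> i v"
    if "i \<in> J (m + 2)" for i v
    unfolding sp[symmetric] by (rule unit_x_op[OF m2 that])+
  have "J m = insert m (J (m + 2))"
  proof (rule set_eqI)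
    fix i
    have "(\<exists>k. i = m + 2 * k) \<longleftrightarrow> i = m \<or> (\<exists>k. i = m + 2 + 2 * k)"
    proof
      assume "\<exists>k. i = m + 2 * k"
      then obtain k where "i = m + 2 * k" ..
      then show "i = m \<or> (\<exists>k. i = m + 2 + 2 * k)" by (cases k) auto
    next
      assume "i = m \<or> (\<exists>k. i = m + 2 + 2 * k)"
      then show "\<exists>k. i = m + 2 * k" by (elim disjE exE) (auto intro: exI[of _ 0] exI[of _ "Suc _"])
    qed
    then show "i \<in> J m \<longleftrightarrow> i \<in> insert m (J (m + 2))" by (simp add: J_def)
  qed
  moreover have "m \<notin> J (m + 2)" using ge(1) by blast
  ultimately have "((\<lambda>i. x_op a \<kappa> i v) has_sum (x_op a \<kappa> m v + B.block_sum v)) (J m)"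
    using has_sum_insert[OF _ B.block_has_sum[of v], of m] by simp
  then have Rm: "R_op a \<kappa> m v = unit_of \<kappa> m v + (x_op a \<kappa> m v + B.block_sum v)"
    by (simp add: R_op_def infsumI)
  have R2: "R_op a \<kappa> (m + 2) v = unit_of \<kappa> m v + B.block_sum v" for v
    by (simp only: R_op_def B.block_sum_def sp)
  have "B.block_sum (x_op a \<kappa> m v) = 0"
    by (rule B.block_sum_zero) (rule x_op_x_op, use ge m in auto)
  moreover have "B.block_sum (unit_of \<kappa> m v) = B.block_sum v"
    unfolding B.block_sum_def by (rule infsum_cong) (rule xe(1))
  ultimately show "R_op a \<kappa> m v = R_op a \<kappa> (m + 2) (Z_op a \<kappa> m v)"
    unfolding Rm R2 Z_op_def
    by (simp only: bounded_opsD(5)[OF B.block_sum_bounded_ops] e(5) ee unit_x_op(1)[OF m mJ] add.assoc add_0_right)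
  show "Z_op a \<kappa> m (R_op a \<kappa> (m + 2) v) = R_op a \<kappa> (m + 2) (Z_op a \<kappa> m v)"
  proof (rule R_op_commute[OF m2 Z_op_bounded_ops[OF m]])
    show "Z_op a \<kappa> m (unit_of \<kappa> (m + 2) v) = unit_of \<kappa> (m + 2) (Z_op a \<kappa> m v)" for v
      unfolding sp Z_op_def by (simp add: e(5) unit_x_op[OF m mJ])
    fix i v assume i: "i \<in> J (m + 2)"
    have "x_op a \<kappa> i (x_op a \<kappa> m v) = 0" "x_op a \<kappa> m (x_op a \<kappa> i v) = 0"
      using ge[OF i] m by (auto intro!: x_op_x_op)
    then show "Z_op a \<kappa> m (x_op a \<kappa> i v) = x_op a \<kappa> i (Z_op a \<kappa> m v)"
      unfolding Z_op_def by (simp add: xe[OF i] bounded_opsD(5)[OF x_op_bounded_ops])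
  qed
qed

text \<open>The terms \<open>x_op\<close> need not be positive, but adding the block projection
  yields the compression P X P, and the unit supplies all these projections.\<close>

lemma positive_R_op:
  assumes m: "1 \<le> m" and pos: "positive_op total (X_free a \<kappa>)"
  shows "positive_op (space_of \<kappa> m) (R_op a \<kappa> m)"
proof -
  obtain K where "orthogonal_blocks (summand \<kappa>) (J m) (x_op a \<kappa>) K" using orthogonal_blocks_x_op[OF m] ..
  then interpret B: orthogonal_blocks "summand \<kappa>" "J m" "x_op a \<kappa>" K .
  have "cinner (R_op a \<kappa> m v) v \<in> \<real>\<^sub>\<ge>\<^sub>0" for v
  proof -
    have "cinner (proj (space_of \<kappa> m) v + B.block_sum v) v \<in> \<real>\<^sub>\<ge>\<^sub>0"
    proof (rule B.positive_proj_plus_block_sum[OF closed_space_of summand_subset_space_of_J[OF m]])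
      fix i v
      have "x_op a \<kappa> i v + proj (summand \<kappa> i) v = proj (summand \<kappa> i) (X_free a \<kappa> (proj (summand \<kappa> i) v))"
        by (simp add: x_op_def X_op_def P_def)
      then have "cinner (x_op a \<kappa> i v + proj (summand \<kappa> i) v) v =
          cinner (X_free a \<kappa> (proj (summand \<kappa> i) v)) (proj (summand \<kappa> i) v)"
        using cinner_proj[OF closed_summand] by simp
      then show "cinner (x_op a \<kappa> i v + proj (summand \<kappa> i) v) v \<in> \<real>\<^sub>\<ge>\<^sub>0"
        using pos by (simp add: positive_op_def)
    qed
    then show ?thesis by (simp add: R_op_def B.block_sum_def unit_of_def)
  qed
  then show ?thesis using R_op_bounded_ops[OF m] by (simp add: positive_op_def)
qed

end

subsection \<open>Equality of distributions\<close>

lemma distribution_vector_state: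
  "distribution e (vector_state \<zeta>) c n = cinner ((c ^^ n) (e \<zeta>)) \<zeta>"
proof -
  have "((\<circ>) c ^^ n) e = (c ^^ n) \<circ> e" by (induction n) auto
  then show ?thesis by (simp add: distribution_def vector_state_def)
qed

text \<open>(F G)^n F = F (G F)^n: the \<open>F\<close> on the right is absorbed by \<zeta>, the one
  on the left by the inner product with \<zeta>.\<close>

lemma distribution_swap:
  assumes F: "F \<zeta> = \<zeta>" "\<And>v. cinner (F v) \<zeta> = cinner v \<zeta>" and e: "e \<zeta> = \<zeta>"
  shows "distribution e (vector_state \<zeta>) (F \<circ> G) = distribution e (vector_state \<zeta>) (G \<circ> F)"
proof
  fix n
  have swap: "((F \<circ> G) ^^ n) (F v) = F (((G \<circ> F) ^^ n) v)" for v
    by (induction n) auto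
  show "distribution e (vector_state \<zeta>) (F \<circ> G) n = distribution e (vector_state \<zeta>) (G \<circ> F) n"
  proof -
    have "cinner (((F \<circ> G) ^^ n) \<zeta>) \<zeta> = cinner (((F \<circ> G) ^^ n) (F \<zeta>)) \<zeta>" by (simp add: F(1))
    also have "\<dots> = cinner (((G \<circ> F) ^^ n) \<zeta>) \<zeta>" by (simp add: swap F(2))
    finally show ?thesis by (simp add: distribution_vector_state e)
  qed
qed

lemma cinner_sqrt_op_fixed:
  assumes M: "closed_csubspace M" and A: "positive_op M A" and u: "A u = u"
  shows "cinner (sqrt_op M A v) u = cinner v u"
proof -
  have "cinner (sqrt_op M A v) u = cinner v (sqrt_op M A u)"
    using positive_op_self_adjoint[OF positive_sqrt_op[OF M A]] unfolding self_adjoint_def by blast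
  then show ?thesis by (simp only: sqrt_op_fixed[OF M A u])
qed

subsection \<open>Orthogonality\<close>

lemma bounded_opsI:
  assumes "S \<in> bounded_ops UNIV" "\<And>v. S v \<in> M"
    "\<And>v. (\<And>q. q \<in> M \<Longrightarrow> cinner v q = 0) \<Longrightarrow> S v = 0"
  shows "S \<in> bounded_ops M"
  using assms unfolding bounded_ops_def by blast

lemma gen_alg_bounded_ops:
  assumes c: "c \<in> gen_alg S" and S: "\<And>s. s \<in> S \<Longrightarrow> s \<in> bounded_ops M" and M: "closed_csubspace M"
  shows "c \<in> bounded_ops M"
  using c
proof (induction rule: gen_alg.induct)
  case (base s)
  then show ?case by (rule S)
next
  case zero
  show ?case
    using bounded_ops_linear_intros(2) closed_csubspaceD(2)[OF M] unfolding bounded_ops_def by auto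
next
  case (add c d)
  have "(\<lambda>v. c v + d v) \<in> bounded_ops UNIV"
    by (rule bounded_ops_linear_intros(3)[OF bounded_opsD(8)[OF add.IH(1)] bounded_opsD(8)[OF add.IH(2)]])
  then show ?case
    using add.IH closed_csubspaceD(3)[OF M] unfolding bounded_ops_def by simp
next
  case (scale c r)
  have "(\<lambda>v. r *\<^sub>C c v) \<in> bounded_ops UNIV"
    by (rule bounded_ops_linear_intros(5)[OF bounded_opsD(8)[OF scale.IH]])
  then show ?case
    using scale.IH closed_csubspaceD(4)[OF M] unfolding bounded_ops_def by simp
next
  case (mult c d)
  have "c \<circ> d \<in> bounded_ops UNIV"
    by (rule bounded_ops_comp[OF bounded_opsD(8)[OF mult.IH(1)] bounded_opsD(8)[OF mult.IH(2)]])
  then show ?case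
  proof (rule bounded_opsI)
    show "(c \<circ> d) v \<in> M" for v using bounded_opsD(3)[OF mult.IH(1)] by simp
    show "(c \<circ> d) v = 0" if "\<And>q. q \<in> M \<Longrightarrow> cinner v q = 0" for v
      using bounded_opsD(4)[OF mult.IH(2) that] bounded_opsD(7)[OF mult.IH(1)] by simp
  qed
qed

text \<open>The generated algebra is non-unital, so every monomial has a \<open>b\<close> at both
  ends: the rightmost one annihilates \<open>u\<close>, the leftmost one puts the range into the
  complement of \<open>u\<close>.\<close>

lemma gen_alg_kill:
  assumes b': "b' \<in> gen_alg {b}" and b: "b \<in> bounded_ops UNIV" "b u = 0" "\<And>v. cinner (b v) u = 0"
  shows "b' u = 0" "cinner (b' v) u = 0"
proof -
  have "b' \<in> bounded_ops UNIV \<and> b' u = 0 \<and> (\<forall>v. cinner (b' v) u = 0)"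
    using b'
  proof (induction rule: gen_alg.induct)
    case (mult c d)
    then have cd: "c \<in> bounded_ops UNIV" "d \<in> bounded_ops UNIV" "d u = 0" "\<And>v. cinner (c v) u = 0" by auto
    show ?case
    proof (intro conjI allI)
      show "c \<circ> d \<in> bounded_ops UNIV" by (rule bounded_ops_comp[OF cd(1,2)])
    qed (simp_all add: cd(3,4) bounded_opsD(7)[OF cd(1)])
  qed (use b in \<open>simp_all add: bounded_ops_linear_intros cinner_add_left cinner_scaleC_left\<close>)
  then show "b' u = 0" "cinner (b' v) u = 0" by auto
qed

context free_product
begin

text \<open>The root commutes with every bounded operator commuting with \<open>A\<close>, which
  includes matrix units that are not self-adjoint.\<close>

lemma tail_commuting_sqrt_op:
  assumes "closed_csubspace N" "positive_op N A" "tail_commuting \<tau> A"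
  shows "tail_commuting \<tau> (sqrt_op N A)"
proof (rule tail_commutingI)
  show "sqrt_op N A \<in> bounded_ops UNIV"
    using positive_sqrt_op[OF assms(1,2)] bounded_opsD(8) unfolding positive_op_def by blast
  fix t\<^sub>0 t\<^sub>1 E v assume E: "tail_op \<tau> t\<^sub>0 t\<^sub>1 E"
  show "E (sqrt_op N A v) = sqrt_op N A (E v)"
    by (rule sqrt_op_commute[OF assms(1,2) tail_opD(1)[OF E] tail_commutingD(2)[OF assms(3) E]])
qed

lemma type_space_pair_diff_proj:
  assumes "\<tau>\<^sub>0 \<noteq> \<tau>\<^sub>1" "v \<in> type_space {\<tau>\<^sub>0, \<tau>\<^sub>1}"
  shows "v - proj (type_space {\<tau>\<^sub>0}) v \<in> type_space {\<tau>\<^sub>1}"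
  using assms(2)
proof (rule type_space_induct)
  have "(\<lambda>v. v - proj (type_space {\<tau>\<^sub>0}) v) \<in> bounded_ops UNIV"
    by (rule bounded_ops_linear_intros(4)[OF bounded_ops_linear_intros(1)
          bounded_opsD(8)[OF proj_bounded_ops[OF closed_type_space]]])
  then show "closed_csubspace {v. v - proj (type_space {\<tau>\<^sub>0}) v \<in> type_space {\<tau>\<^sub>1}}"
    by (rule closed_csubspace_vimage[OF _ closed_type_space])
  fix w assume w: "w \<in> words H \<xi>" "map fst w \<in> {\<tau>\<^sub>0, \<tau>\<^sub>1}"
  show "T w - proj (type_space {\<tau>\<^sub>0}) (T w) \<in> type_space {\<tau>\<^sub>1}"
  proof (cases "map fst w = \<tau>\<^sub>0")
    case True
    then show ?thesis
      using closed_csubspaceD(2)[OF closed_type_space] by (simp add: proj_type_space_T[OF w(1)])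
  next
    case False
    then show ?thesis
      using w by (simp add: proj_type_space_T[OF w(1)] T_in_type_space)
  qed
qed

lemma type_space_pair_orthogonal:
  assumes "\<And>q. q \<in> type_space {\<tau>\<^sub>0} \<Longrightarrow> cinner r q = 0" "\<And>q. q \<in> type_space {\<tau>\<^sub>1} \<Longrightarrow> cinner r q = 0"
    and q: "q \<in> type_space {\<tau>\<^sub>0, \<tau>\<^sub>1}"
  shows "cinner r q = 0"
proof -
  have "\<forall>z\<in>{r}. cinner q z = 0"
    using q
  proof (rule type_space_induct[OF _ closed_csubspace_ortho])
    fix w assume w: "w \<in> words H \<xi>" "map fst w \<in> {\<tau>\<^sub>0, \<tau>\<^sub>1}"
    then have "cinner r (T w) = 0"
      using assms(1)[of "T w"] assms(2)[of "T w"] T_in_type_space[OF w(1)] by blast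
    then show "\<forall>z\<in>{r}. cinner (T w) z = 0" using cinner_eq_zero_commute by blast
  qed
  then show ?thesis using cinner_eq_zero_commute by blast
qed

text \<open>Modulo multiples of \<zeta>, which b' annihilates, the vector a2 w2 \<zeta> lies in the
  space of \<tau>1. There b' acts as the scalar \<psi>(b') up to a remainder orthogonal to both
  spaces, which a1 annihilates. So inserting b' multiplies by \<psi>(b') after removing the \<zeta>
  component, and this removal is the subtracted product in the formula.\<close>

lemma orthogonal_pairI:
  assumes neq: "\<tau>\<^sub>0 \<noteq> \<tau>\<^sub>1"
    and \<zeta>: "\<zeta> \<in> type_space {\<tau>\<^sub>0}" "norm \<zeta> = 1" and \<zeta>': "\<zeta>' \<in> type_space {\<tau>\<^sub>1}" "norm \<zeta>' = 1"
    and x: "x \<in> bounded_ops (type_space {\<tau>\<^sub>0, \<tau>\<^sub>1})" "tail_commuting \<tau>\<^sub>0 x"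
    and b: "tail_commuting \<tau>\<^sub>0 b" "tail_commuting \<tau>\<^sub>1 b"
    and kill: "\<And>u. u \<in> type_space {\<tau>\<^sub>0} \<Longrightarrow> b u = 0"
      "\<And>u v. u \<in> type_space {\<tau>\<^sub>0} \<Longrightarrow> cinner (b v) u = 0"
    and e: "tail_commuting \<tau>\<^sub>0 e"
  shows "orthogonal_pair e (vector_state \<zeta>) (vector_state \<zeta>') x b"
proof -
  let ?W = "gen_alg (insert e (gen_alg {x} \<union> gen_alg {b}))"
  let ?La = "type_space {\<tau>\<^sub>0}" and ?Lb = "type_space {\<tau>\<^sub>1}" and ?S = "type_space {\<tau>\<^sub>0, \<tau>\<^sub>1}"
  have tA: "tail_commuting \<tau>\<^sub>0 c" if "c \<in> gen_alg {x}" for c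
    by (rule tail_commuting_gen_alg[OF that]) (use x in auto)
  have tB: "tail_commuting \<tau>\<^sub>0 c" "tail_commuting \<tau>\<^sub>1 c" if "c \<in> gen_alg {b}" for c
    by (rule tail_commuting_gen_alg[OF that]; use b in auto)+
  have tW: "tail_commuting \<tau>\<^sub>0 w" if "w \<in> ?W" for w
    by (rule tail_commuting_gen_alg[OF that]) (use e tA tB(1) in blast)
  have A: "c \<in> bounded_ops ?S" if "c \<in> gen_alg {x}" for c
    by (rule gen_alg_bounded_ops[OF that _ closed_type_space]) (use x(1) in simp)
  have B: "c u = 0" "cinner (c v) u = 0" if "c \<in> gen_alg {b}" "u \<in> ?La" for c u v
    by (rule gen_alg_kill[OF that(1) tail_commutingD(1)[OF b(1)] kill(1)[OF that(2)] kill(2)[OF that(2)]])+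
  have one: "vector_state \<zeta> (b' \<circ> w\<^sub>2) = 0" if "b' \<in> gen_alg {b}" for b' w\<^sub>2
    unfolding vector_state_def comp_apply by (rule B(2)[OF that \<zeta>(1)])
  have two: "vector_state \<zeta> (w\<^sub>1 \<circ> b') = 0" if "b' \<in> gen_alg {b}" "w\<^sub>1 \<in> ?W" for b' w\<^sub>1
    by (simp add: vector_state_def B(1)[OF that(1) \<zeta>(1)] bounded_opsD(7)[OF tail_commutingD(1)[OF tW[OF that(2)]]])
  have three: "vector_state \<zeta> (w\<^sub>1 \<circ> a\<^sub>1 \<circ> b' \<circ> a\<^sub>2 \<circ> w\<^sub>2) = vector_state \<zeta>' b' *
      (vector_state \<zeta> (w\<^sub>1 \<circ> a\<^sub>1 \<circ> a\<^sub>2 \<circ> w\<^sub>2) - vector_state \<zeta> (w\<^sub>1 \<circ> a\<^sub>1) * vector_state \<zeta> (a\<^sub>2 \<circ> w\<^sub>2))"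
    if a: "a\<^sub>1 \<in> gen_alg {x}" "a\<^sub>2 \<in> gen_alg {x}" and b': "b' \<in> gen_alg {b}" and w: "w\<^sub>1 \<in> ?W" "w\<^sub>2 \<in> ?W"
    for a\<^sub>1 a\<^sub>2 b' w\<^sub>1 w\<^sub>2
  proof -
    note a1 = bounded_opsD[OF A[OF a(1)]]
    note bb = bounded_opsD[OF tail_commutingD(1)[OF tB(1)[OF b']]]
    note w1 = bounded_opsD[OF tail_commutingD(1)[OF tW[OF w(1)]]]
    define v where "v = a\<^sub>2 (w\<^sub>2 \<zeta>)"
    define v1 where "v1 = v - cinner v \<zeta> *\<^sub>C \<zeta>"
    define p where "p = cinner (b' \<zeta>') \<zeta>'"
    have "proj ?La ((a\<^sub>2 \<circ> w\<^sub>2) \<zeta>) = cinner ((a\<^sub>2 \<circ> w\<^sub>2) \<zeta>) \<zeta> *\<^sub>C \<zeta>"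
      by (rule tail_commuting_scalar[OF tail_commuting_comp[OF tA[OF a(2)] tW[OF w(2)]] \<zeta> \<zeta>(1)])
    then have "proj ?La v = cinner v \<zeta> *\<^sub>C \<zeta>" by (simp add: v_def)
    then have v1: "v1 \<in> ?Lb"
      using type_space_pair_diff_proj[OF neq, of v] bounded_opsD(3)[OF A[OF a(2)]] by (simp add: v1_def v_def)
    have "b' \<zeta> = 0" by (rule B(1)[OF b' \<zeta>(1)])
    then have bv: "b' v = b' v1" by (simp add: v1_def bb(2,6))
    define r where "r = b' v1 - p *\<^sub>C v1"
    have pr: "proj ?Lb (b' v1) = p *\<^sub>C v1"
      unfolding p_def by (rule tail_commuting_scalar[OF tB(2)[OF b'] \<zeta>' v1])
    \<comment> \<open>The remainder is orthogonal to the second space by the choice of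
      \<open>p\<close>, and to the first because the range of \<open>b'\<close> and
      \<open>v1\<close> both are.\<close>
    have "a\<^sub>1 r = 0"
    proof (rule a1(4), rule type_space_pair_orthogonal[of \<tau>\<^sub>0 _ \<tau>\<^sub>1])
      show "cinner r q = 0" if "q \<in> ?Lb" for q
        using proj_ortho[OF closed_type_space that, of "b' v1"] by (simp add: r_def pr)
      show "cinner r q = 0" if q: "q \<in> ?La" for q
      proof -
        have "cinner v1 q = 0" by (rule type_space_orthogonal[OF _ v1 q]) (use neq in simp)
        then show ?thesis using B(2)[OF b' q, of v1] by (simp add: r_def cinner_diff_left cinner_scaleC_left)
      qed
    qed
    then have "a\<^sub>1 (b' v1) = p *\<^sub>C a\<^sub>1 v1" by (simp add: r_def a1(2,6))
    then have "a\<^sub>1 (b' v) = p *\<^sub>C (a\<^sub>1 v - cinner v \<zeta> *\<^sub>C a\<^sub>1 \<zeta>)"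
      by (simp add: bv v1_def a1(2,6))
    then have "cinner (w\<^sub>1 (a\<^sub>1 (b' v))) \<zeta> =
        p * (cinner (w\<^sub>1 (a\<^sub>1 v)) \<zeta> - cinner v \<zeta> * cinner (w\<^sub>1 (a\<^sub>1 \<zeta>)) \<zeta>)"
      by (simp add: w1(2,6) cinner_diff_left cinner_scaleC_left)
    then show ?thesis by (simp add: vector_state_def p_def v_def mult.commute)
  qed
  show ?thesis
    unfolding orthogonal_pair_def Let_def
  proof (intro conjI ballI)
    fix b' w\<^sub>1 w\<^sub>2 assume w: "b' \<in> gen_alg {b}" "w\<^sub>1 \<in> ?W" "w\<^sub>2 \<in> ?W"
    show "vector_state \<zeta> (b' \<circ> w\<^sub>2) = 0" by (rule one[OF w(1)])
    show "vector_state \<zeta> (w\<^sub>1 \<circ> b') = 0" by (rule two[OF w(1,2)])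
  next
    fix a\<^sub>1 a\<^sub>2 b' w\<^sub>1 w\<^sub>2
    assume w: "a\<^sub>1 \<in> gen_alg {x}" "a\<^sub>2 \<in> gen_alg {x}" "b' \<in> gen_alg {b}" "w\<^sub>1 \<in> ?W" "w\<^sub>2 \<in> ?W"
    show "vector_state \<zeta> (w\<^sub>1 \<circ> a\<^sub>1 \<circ> b' \<circ> a\<^sub>2 \<circ> w\<^sub>2) = vector_state \<zeta>' b' *
      (vector_state \<zeta> (w\<^sub>1 \<circ> a\<^sub>1 \<circ> a\<^sub>2 \<circ> w\<^sub>2) - vector_state \<zeta> (w\<^sub>1 \<circ> a\<^sub>1) * vector_state \<zeta> (a\<^sub>2 \<circ> w\<^sub>2))"
      by (rule three[OF w])
  qed
qed

end

section \<open>Specialisation to a fixed side and index\<close>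

context free_product_operators
begin

context
  fixes \<iota> :: side and m :: nat
  assumes m: "1 \<le> m"
begin

lemma level_types_m:
  "level_type \<iota> (m - 1) \<noteq> level_type (bar \<iota>) m"
  "summand \<iota> m = type_space {level_type \<iota> (m - 1), level_type (bar \<iota>) m}"
  "level_type (bar \<iota>) m = [\<iota>] @ level_type \<iota> (m - 1)"
  "level_type \<iota> (m + 1) = [bar \<iota>] @ level_type (bar \<iota>) m"
proof -
  obtain n where n: "m = Suc n" using m by (cases m) auto
  show "level_type (bar \<iota>) m = [\<iota>] @ level_type \<iota> (m - 1)" by (simp add: n)
  then show "level_type \<iota> (m - 1) \<noteq> level_type (bar \<iota>) m" by simp
  show "summand \<iota> m = type_space {level_type \<iota> (m - 1), level_type (bar \<iota>) m}"
    by (simp add: n summand_eq)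
  show "level_type \<iota> (m + 1) = [bar \<iota>] @ level_type (bar \<iota>) m" by simp
qed

lemma spaces_m: "space_of (bar \<iota>) (m + 1) = space_of \<iota> m" "space_of \<iota> (m + 2) = space_of \<iota> m"
  "unit_of (bar \<iota>) (m + 1) = unit_of \<iota> m"
  using space_of_Suc[of \<iota> m] by (simp_all add: unit_of_def)

lemma level_subset_space_of:
  assumes "u \<in> type_space {level_type \<iota> (m - 1)}"
  shows "u \<in> space_of \<iota> m"
proof -
  have "type_space {level_type \<iota> (m - 1)} \<subseteq> summand \<iota> m"
    unfolding level_types_m(2) by (rule type_space_mono) simp
  then show ?thesis using assms summand_subset_space_of[OF m] by blast
qed

lemma unit_of_level:
  assumes "u \<in> type_space {level_type \<iota> (m - 1)}"
  shows "unit_of \<iota> m u = u" "cinner (unit_of \<iota> m v) u = cinner v u"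
  unfolding unit_of_def
  by (rule proj_id[OF closed_space_of level_subset_space_of[OF assms]])
     (rule cinner_proj_left[OF closed_space_of level_subset_space_of[OF assms]])

lemma R_op_level:
  assumes u: "u \<in> type_space {level_type \<iota> (m - 1)}"
  shows "R_op a (bar \<iota>) (m + 1) u = u" "cinner (R_op a (bar \<iota>) (m + 1) v) u = cinner v u"
    "R_op a \<iota> (m + 2) u = u" "cinner (R_op a \<iota> (m + 2) v) u = cinner v u"
proof -
  have 1: "u \<in> space_of (bar \<iota>) (m + 1)" "u \<in> space_of \<iota> (m + 2)"
    unfolding spaces_m by (rule level_subset_space_of[OF u])+
  have 2: "1 \<le> m + 1" "1 \<le> m + 2" "length (level_type \<iota> (m - 1)) + 1 < m + 1"
    "length (level_type \<iota> (m - 1)) + 1 < m + 2" using m by simp_all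
  show "R_op a (bar \<iota>) (m + 1) u = u" "cinner (R_op a (bar \<iota>) (m + 1) v) u = cinner v u"
    by (rule R_op_short[OF 2(1) u 1(1) 2(3)])+
  show "R_op a \<iota> (m + 2) u = u" "cinner (R_op a \<iota> (m + 2) v) u = cinner v u"
    by (rule R_op_short[OF 2(2) u 1(2) 2(4)])+
qed

lemma distribution_U_op:
  assumes \<zeta>: "\<zeta> \<in> type_space {level_type \<iota> (m - 1)}"
  shows "distribution (unit_of \<iota> m) (vector_state \<zeta>) (U_op a \<iota> m) =
    distribution (unit_of \<iota> m) (vector_state \<zeta>) (Z_op a \<iota> m \<circ> U_op a (bar \<iota>) (m + 1))"
proof -
  let ?A = "R_op a \<iota> (m + 2)" and ?B = "R_op a (bar \<iota>) (m + 1)"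
  have "R_op a \<iota> m = ?A \<circ> Z_op a \<iota> m" by (rule ext) (simp only: R_op_Z_op(1)[OF m] comp_apply)
  then have "U_op a \<iota> m = ?A \<circ> (Z_op a \<iota> m \<circ> ?B)" by (simp only: U_op_def comp_assoc)
  moreover have "Z_op a \<iota> m \<circ> U_op a (bar \<iota>) (m + 1) = (Z_op a \<iota> m \<circ> ?B) \<circ> ?A"
    by (simp add: U_op_def comp_assoc)
  moreover have "distribution (unit_of \<iota> m) (vector_state \<zeta>) (?A \<circ> (Z_op a \<iota> m \<circ> ?B)) =
      distribution (unit_of \<iota> m) (vector_state \<zeta>) ((Z_op a \<iota> m \<circ> ?B) \<circ> ?A)"
    by (rule distribution_swap) (rule R_op_level(3,4)[OF \<zeta>] unit_of_level(1)[OF \<zeta>])+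
  ultimately show ?thesis by (simp only:)
qed

text \<open>These operators act in front of the last \<open>m\<close> factors and so commute with
  both families of tail operators. \<open>x_op a \<iota> m\<close> acts on the m-th factor from the
  end; for it only the shorter tails are used. This asymmetry separates the two members of the
  orthogonal pair.\<close>

lemma tail_commuting_R_ops:
  "tail_commuting (level_type \<iota> (m - 1)) (R_op a (bar \<iota>) (m + 1))"
  "tail_commuting (level_type (bar \<iota>) m) (R_op a (bar \<iota>) (m + 1))"
  "tail_commuting (level_type \<iota> (m - 1)) (R_op a \<iota> (m + 2))"
  "tail_commuting (level_type (bar \<iota>) m) (R_op a \<iota> (m + 2))"
proof -
  show "tail_commuting (level_type \<iota> (m - 1)) (R_op a (bar \<iota>) (m + 1))"
    by (rule tail_commuting_R_op[of _ _ "[\<iota>]"]) (simp_all add: level_types_m(3))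
  show "tail_commuting (level_type (bar \<iota>) m) (R_op a (bar \<iota>) (m + 1))"
    by (rule tail_commuting_R_op[of _ _ "[]"]) simp_all
  show "tail_commuting (level_type \<iota> (m - 1)) (R_op a \<iota> (m + 2))"
    by (rule tail_commuting_R_op[of _ _ "[bar \<iota>, \<iota>]"]) (simp_all add: level_types_m(3))
  show "tail_commuting (level_type (bar \<iota>) m) (R_op a \<iota> (m + 2))"
    by (rule tail_commuting_R_op[of _ _ "[bar \<iota>]"]) simp_all
qed

text \<open>Common to both orthogonality claims: the second operator is c - 1, where
  \<open>c\<close> fixes the lower level and leaves inner products with it unchanged, so the
  difference vanishes there and has range orthogonal to it.\<close>

lemma orthogonal_pair_x_op:
  assumes \<zeta>: "\<zeta> \<in> type_space {level_type \<iota> (m - 1)}" "norm \<zeta> = 1"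
    and \<zeta>': "\<zeta>' \<in> type_space {level_type (bar \<iota>) m}" "norm \<zeta>' = 1"
    and c: "tail_commuting (level_type \<iota> (m - 1)) c" "tail_commuting (level_type (bar \<iota>) m) c"
      "\<And>u. u \<in> type_space {level_type \<iota> (m - 1)} \<Longrightarrow> c u = u"
      "\<And>u v. u \<in> type_space {level_type \<iota> (m - 1)} \<Longrightarrow> cinner (c v) u = cinner v u"
  shows "orthogonal_pair (unit_of \<iota> m) (vector_state \<zeta>) (vector_state \<zeta>') (x_op a \<iota> m)
    (\<lambda>v. c v - unit_of (bar \<iota>) (m + 1) v)"
  unfolding spaces_m(3)
proof (rule orthogonal_pairI[OF level_types_m(1) \<zeta> \<zeta>'])
  show "x_op a \<iota> m \<in> bounded_ops (type_space {level_type \<iota> (m - 1), level_type (bar \<iota>) m})"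
    using x_op_bounded_ops[of \<iota> m] by (simp only: level_types_m(2))
  have "tail_commuting (level_type \<iota> (m - 1)) (x_op a \<iota> (Suc (m - 1)))"
    by (rule tail_commuting_x_op[of _ _ "[]"]) simp
  then show "tail_commuting (level_type \<iota> (m - 1)) (x_op a \<iota> m)" using m by simp
  show "tail_commuting (level_type \<iota> (m - 1)) (\<lambda>v. c v - unit_of \<iota> m v)"
    "tail_commuting (level_type (bar \<iota>) m) (\<lambda>v. c v - unit_of \<iota> m v)"
    by (rule tail_commuting_diff[OF c(1) tail_commuting_unit], rule tail_commuting_diff[OF c(2) tail_commuting_unit])
  show "c u - unit_of \<iota> m u = 0" "cinner (c v - unit_of \<iota> m v) u = 0"
    if "u \<in> type_space {level_type \<iota> (m - 1)}" for u v
    using c(3,4)[OF that] unit_of_level[OF that] by (simp_all add: cinner_diff_left)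
qed (rule tail_commuting_unit)

lemma orthogonal_pair_u_op:
  assumes \<zeta>: "\<zeta> \<in> type_space {level_type \<iota> (m - 1)}" "norm \<zeta> = 1"
    and \<zeta>': "\<zeta>' \<in> type_space {level_type (bar \<iota>) m}" "norm \<zeta>' = 1"
  shows "orthogonal_pair (unit_of \<iota> m) (vector_state \<zeta>) (vector_state \<zeta>') (x_op a \<iota> m) (u_op a (bar \<iota>) (m + 1))"
  unfolding u_op_def
proof (rule orthogonal_pair_x_op[OF \<zeta> \<zeta>'])
  have U: "U_op a (bar \<iota>) (m + 1) = R_op a (bar \<iota>) (m + 1) \<circ> R_op a \<iota> (m + 2)" by (simp add: U_op_def)
  show "tail_commuting (level_type \<iota> (m - 1)) (U_op a (bar \<iota>) (m + 1))"
    "tail_commuting (level_type (bar \<iota>) m) (U_op a (bar \<iota>) (m + 1))"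
    unfolding U by (rule tail_commuting_comp[OF tail_commuting_R_ops(1,3)],
        rule tail_commuting_comp[OF tail_commuting_R_ops(2,4)])
  show "U_op a (bar \<iota>) (m + 1) u = u" "cinner (U_op a (bar \<iota>) (m + 1) v) u = cinner v u"
    if "u \<in> type_space {level_type \<iota> (m - 1)}" for u v
    unfolding U comp_apply by (simp_all only: R_op_level[OF that])
qed

context
  assumes pos: "\<And>\<kappa>. positive_op total (X_free a \<kappa>)"
begin

lemma positive_R_ops:
  "positive_op (space_of \<iota> m) (R_op a (bar \<iota>) (m + 1))" "positive_op (space_of \<iota> m) (R_op a \<iota> (m + 2))"
  using positive_R_op[of "m + 1" "bar \<iota>", OF _ pos] positive_R_op[of "m + 2" \<iota>, OF _ pos]
  unfolding spaces_m by simp_all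

lemma Y_op_bar: "Y_op a (bar \<iota>) (m + 1) = sqrt_op (space_of \<iota> m) (R_op a \<iota> (m + 2)) \<circ>
    R_op a (bar \<iota>) (m + 1) \<circ> sqrt_op (space_of \<iota> m) (R_op a \<iota> (m + 2))"
proof -
  have "m + 1 + 1 = m + 2" by simp
  then show ?thesis by (simp only: Y_op_def Let_def spaces_m bar_bar)
qed

lemma distribution_Y_op:
  assumes \<zeta>: "\<zeta> \<in> type_space {level_type \<iota> (m - 1)}"
  shows "distribution (unit_of \<iota> m) (vector_state \<zeta>) (Y_op a \<iota> m) =
    distribution (unit_of \<iota> m) (vector_state \<zeta>) (Z_op a \<iota> m \<circ> Y_op a (bar \<iota>) (m + 1))"
proof -
  define SA where "SA = sqrt_op (space_of \<iota> m) (R_op a \<iota> (m + 2))"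
  define SB where "SB = sqrt_op (space_of \<iota> m) (R_op a (bar \<iota>) (m + 1))"
  note A = closed_space_of positive_R_ops(2) and B = closed_space_of positive_R_ops(1)
  have r: "SA (SA v) = R_op a \<iota> (m + 2) v" "SB (SB v) = R_op a (bar \<iota>) (m + 1) v" for v
    unfolding SA_def SB_def by (rule sqrt_op_square[OF A], rule sqrt_op_square[OF B])
  let ?Z = "Z_op a \<iota> m"
  \<comment> \<open>\<open>Z_op\<close> commutes with \<open>R_op a \<iota> (m + 2)\<close>, hence
    with its root. Half of that operator can thus be moved across \<open>Z_op\<close>, giving both
    products the factors SA Z SB and SB SA in opposite orders.\<close>
  have ZA: "?Z (SA v) = SA (?Z v)" for v
    unfolding SA_def proof (rule sqrt_op_commute[OF A, where C = ?Z])
    show "?Z \<in> bounded_ops UNIV" by (rule Z_op_bounded_ops[OF m])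
    show "?Z (R_op a \<iota> (m + 2) v) = R_op a \<iota> (m + 2) (?Z v)" for v by (rule R_op_Z_op(2)[OF m])
  qed
  have Y: "Y_op a \<iota> m = (SB \<circ> SA) \<circ> (SA \<circ> ?Z \<circ> SB)"
  proof
    fix v
    have "Y_op a \<iota> m v = SB (R_op a \<iota> m (SB v))" by (simp add: Y_op_def Let_def SB_def)
    also have "\<dots> = SB (SA (SA (?Z (SB v))))" by (subst R_op_Z_op(1)[OF m]) (simp only: r(1))
    finally show "Y_op a \<iota> m v = ((SB \<circ> SA) \<circ> (SA \<circ> ?Z \<circ> SB)) v" by simp
  qed
  have ZY: "?Z \<circ> Y_op a (bar \<iota>) (m + 1) = (SA \<circ> ?Z \<circ> SB) \<circ> (SB \<circ> SA)"
    unfolding Y_op_bar SA_def[symmetric] by (rule ext) (simp add: r(2) ZA)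
  have "distribution (unit_of \<iota> m) (vector_state \<zeta>) ((SB \<circ> SA) \<circ> (SA \<circ> ?Z \<circ> SB)) =
      distribution (unit_of \<iota> m) (vector_state \<zeta>) ((SA \<circ> ?Z \<circ> SB) \<circ> (SB \<circ> SA))"
  proof (rule distribution_swap)
    show "(SB \<circ> SA) \<zeta> = \<zeta>"
      using sqrt_op_fixed[OF A R_op_level(3)[OF \<zeta>]] sqrt_op_fixed[OF B R_op_level(1)[OF \<zeta>]]
      by (simp add: SA_def SB_def)
    show "cinner ((SB \<circ> SA) v) \<zeta> = cinner v \<zeta>" for v
      using cinner_sqrt_op_fixed[OF A R_op_level(3)[OF \<zeta>], of v]
        cinner_sqrt_op_fixed[OF B R_op_level(1)[OF \<zeta>], of "SA v"]
      by (simp add: SA_def SB_def)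
  qed (rule unit_of_level(1)[OF \<zeta>])
  then show ?thesis by (simp only: Y ZY)
qed

lemma orthogonal_pair_y_op:
  assumes \<zeta>: "\<zeta> \<in> type_space {level_type \<iota> (m - 1)}" "norm \<zeta> = 1"
    and \<zeta>': "\<zeta>' \<in> type_space {level_type (bar \<iota>) m}" "norm \<zeta>' = 1"
  shows "orthogonal_pair (unit_of \<iota> m) (vector_state \<zeta>) (vector_state \<zeta>') (x_op a \<iota> m) (y_op a (bar \<iota>) (m + 1))"
  unfolding y_op_def
proof (rule orthogonal_pair_x_op[OF \<zeta> \<zeta>'])
  note A = closed_space_of positive_R_ops(2)
  have sA: "tail_commuting (level_type \<iota> (m - 1)) (sqrt_op (space_of \<iota> m) (R_op a \<iota> (m + 2)))"
    "tail_commuting (level_type (bar \<iota>) m) (sqrt_op (space_of \<iota> m) (R_op a \<iota> (m + 2)))"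
    by (rule tail_commuting_sqrt_op[OF A tail_commuting_R_ops(3)],
        rule tail_commuting_sqrt_op[OF A tail_commuting_R_ops(4)])
  show "tail_commuting (level_type \<iota> (m - 1)) (Y_op a (bar \<iota>) (m + 1))"
    "tail_commuting (level_type (bar \<iota>) m) (Y_op a (bar \<iota>) (m + 1))"
    unfolding Y_op_bar
    by (rule tail_commuting_comp[OF tail_commuting_comp[OF sA(1) tail_commuting_R_ops(1)] sA(1)],
        rule tail_commuting_comp[OF tail_commuting_comp[OF sA(2) tail_commuting_R_ops(2)] sA(2)])
  fix u v assume u: "u \<in> type_space {level_type \<iota> (m - 1)}"
  note fixed = R_op_level[OF u] sqrt_op_fixed[OF A R_op_level(3)[OF u]] cinner_sqrt_op_fixed[OF A R_op_level(3)[OF u]]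
  show "Y_op a (bar \<iota>) (m + 1) u = u" "cinner (Y_op a (bar \<iota>) (m + 1) v) u = cinner v u"
    unfolding Y_op_bar comp_apply fixed by (rule refl)+
qed

end

end

end

theorem theorem8p1:
  fixes H :: "side \<Rightarrow> 'a::complex_hilbert set"
    and \<xi> :: "side \<Rightarrow> 'a"
    and T :: "(side \<times> 'a) list \<Rightarrow> 'h::complex_hilbert"
    and a :: "side \<Rightarrow> 'a \<Rightarrow> 'a"
    and \<iota> :: side and m :: nat and \<zeta> \<zeta>' :: 'h
  assumes "free_product H \<xi> T"
    and "\<And>\<kappa>. a \<kappa> \<in> bounded_ops (H \<kappa>)"
    and "m \<ge> 1"
    and "\<zeta> \<in> free_product.level H \<xi> T \<iota> (m - 1)" and "norm \<zeta> = 1"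
    and "\<zeta>' \<in> free_product.level H \<xi> T (bar \<iota>) m" and "norm \<zeta>' = 1"
  shows
    "(let e = free_product.unit_of H \<xi> T \<iota> m;
          \<phi> = vector_state \<zeta>;
          \<psi> = vector_state \<zeta>';
          U = free_product.U_op H \<xi> T a;
          u = free_product.u_op H \<xi> T a;
          Y = free_product.Y_op H \<xi> T a;
          y = free_product.y_op H \<xi> T a;
          Z = free_product.Z_op H \<xi> T a;
          x = free_product.x_op H \<xi> T a;
          positive = (\<forall>\<kappa>. positive_op (free_product.total H \<xi> T) (free_product.X_free H \<xi> T a \<kappa>))
      in
        distribution e \<phi> (U \<iota> m) = distribution e \<phi> (Z \<iota> m \<circ> U (bar \<iota>) (m + 1)) \<and>
        (positive \<longrightarrow>
          distribution e \<phi> (Y \<iota> m) = distribution e \<phi> (Z \<iota> m \<circ> Y (bar \<iota>) (m + 1))) \<and>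
        orthogonal_pair e \<phi> \<psi> (x \<iota> m) (u (bar \<iota>) (m + 1)) \<and>
        (positive \<longrightarrow>
          orthogonal_pair e \<phi> \<psi> (x \<iota> m) (y (bar \<iota>) (m + 1))))"
proof -
  interpret free_product_operators H \<xi> T a
    using assms(1,2) by (simp add: free_product_operators_def free_product_operators_axioms_def)
  note \<zeta> = assms(4)[unfolded level_eq] assms(5) and \<zeta>' = assms(6)[unfolded level_eq] assms(7)
  show ?thesis
    unfolding Let_def
  proof (intro conjI impI)
    show "distribution (unit_of \<iota> m) (vector_state \<zeta>) (U_op a \<iota> m) =
        distribution (unit_of \<iota> m) (vector_state \<zeta>) (Z_op a \<iota> m \<circ> U_op a (bar \<iota>) (m + 1))"
      by (rule distribution_U_op[OF assms(3) \<zeta>(1)])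
    show "orthogonal_pair (unit_of \<iota> m) (vector_state \<zeta>) (vector_state \<zeta>') (x_op a \<iota> m) (u_op a (bar \<iota>) (m + 1))"
      by (rule orthogonal_pair_u_op[OF assms(3) \<zeta> \<zeta>'])
    assume pos: "\<forall>\<kappa>. positive_op total (X_free a \<kappa>)"
    show "distribution (unit_of \<iota> m) (vector_state \<zeta>) (Y_op a \<iota> m) =
        distribution (unit_of \<iota> m) (vector_state \<zeta>) (Z_op a \<iota> m \<circ> Y_op a (bar \<iota>) (m + 1))"
      by (rule distribution_Y_op[OF assms(3) spec[OF pos] \<zeta>(1)])
    show "orthogonal_pair (unit_of \<iota> m) (vector_state \<zeta>) (vector_state \<zeta>') (x_op a \<iota> m) (y_op a (bar \<iota>) (m + 1))"
      by (rule orthogonal_pair_y_op[OF assms(3) spec[OF pos] \<zeta> \<zeta>'])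
  qed
qed

end
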